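(* Let $m\geq n\geq1$, let $\mathbf{A}$ be a real $m\times n$ matrix with singular values $\sigma_1(\mathbf{A})\ge\cdots\ge\sigma_n(\mathbf{A})\ge0$, let $k\geq1$ be an integer, and choose an oversampling parameter $p\geq4$. Let $\mathbf{K}\in\mathbb{R}^{n\times n}$ be a symmetric positive semi-definite matrix with largest eigenvalue $\lambda_1$ and $k$th largest eigenvalue $\lambda_k>0$. If $\mathbf{\Omega}\in\mathbb{R}^{n\times(k+p)}$ is a Gaussian random matrix, where each column is i.i.d. from a multivariate Gaussian distribution with mean zero and covariance matrix $\mathbf{K}$, and $\mathbf{Q}\mathbf{R}=\mathbf{A}\mathbf{\Omega}$ is the economized QR decomposition of $\mathbf{A}\mathbf{\Omega}$, then for all $u,t\geq1$, $$\|\mathbf{A}-\mathbf{Q}\mathbf{Q}^*\mathbf{A}\|_{\mathrm{F}}\leq\left(1+ut\sqrt{(k+p)\frac{3k}{p+1}\frac{\beta_k}{\gamma_k}}\right)\sqrt{\sum_{j=k+1}^n\sigma_j^2(\mathbf{A})},$$ with failure probability at most $t^{-p}+[ue^{-(u^2-1)/2}]^{k+p}$, where $$\gamma_k=\frac{k}{\lambda_1\operatorname{Tr}((\mathbf{V}_1^*\mathbf{K}\mathbf{V}_1)^{-1})},\qquad\beta_k=\frac{\operatorname{Tr}(\mathbf{\Sigma}_2^2\mathbf{V}_2^*\mathbf{K}\mathbf{V}_2)}{\lambda_1\|\mathbf{\Sigma}_2\|_{\mathrm{F}}^2}.$$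
   Context: Let $\mathbf{A}=\mathbf{U}\mathbf{\Sigma}\mathbf{V}^*$ be a singular value decomposition, with $\mathbf{V}$ an $n\times n$ orthogonal matrix. $\mathbf{V}_1$ is the $n\times k$ matrix of the first $k$ columns of $\mathbf{V}$ and $\mathbf{V}_2$ the $n\times(n-k)$ matrix of the remaining columns. $\mathbf{\Sigma}_2$ is the $(n-k)\times(n-k)$ diagonal matrix with entries $\sigma_{k+1}(\mathbf{A}),\ldots,\sigma_n(\mathbf{A})$. $\|\cdot\|_{\mathrm{F}}$ is the Frobenius norm. It is implicit that $\gamma_k$ and $\beta_k$ are well defined, i.e. $\mathbf{V}_1^*\mathbf{K}\mathbf{V}_1$ is invertible and $\mathbf{\Sigma}_2\neq0$. *)

theory Defs
  imports
    "HOL-Probability.Probability"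
    "Jordan_Normal_Form.Gauss_Jordan_Elimination"
    "Jordan_Normal_Form.Char_Poly"
begin

definition trace_mat :: "real mat \<Rightarrow> real" where
  "trace_mat B = (\<Sum>i<dim_row B. B $$ (i, i))"

definition frobenius_norm :: "real mat \<Rightarrow> real" where
  "frobenius_norm B = sqrt (\<Sum>i<dim_row B. \<Sum>j<dim_col B. (B $$ (i, j))\<^sup>2)"

definition orthonormal_cols :: "real mat \<Rightarrow> bool" where
  "orthonormal_cols B \<longleftrightarrow> transpose_mat B * B = 1\<^sub>m (dim_col B)"

definition sym_psd_mat :: "nat \<Rightarrow> real mat \<Rightarrow> bool" where
  "sym_psd_mat n K \<longleftrightarrow>
     K \<in> carrier_mat n n \<and> transpose_mat K = K \<and>
     (\<forall>x\<in>carrier_vec n. 0 \<le> scalar_prod x (K *\<^sub>v x))"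

text \<open>The sequences \<open>lam\<close> (eigenvalues) and \<open>\<sigma>\<close> (singular values) below are indexed from
  \<open>1\<close> to \<open>n\<close>, in contrast to matrix entries, which are indexed from \<open>0\<close>.
  Eigenvalues are listed with algebraic multiplicity.\<close>

definition eigenvalues_decreasing :: "nat \<Rightarrow> real mat \<Rightarrow> (nat \<Rightarrow> real) \<Rightarrow> bool" where
  "eigenvalues_decreasing n K lam \<longleftrightarrow>
     char_poly K = (\<Prod>i=1..n. [:- lam i, 1:]) \<and>
     (\<forall>i j. 1 \<le> i \<longrightarrow> i \<le> j \<longrightarrow> j \<le> n \<longrightarrow> lam j \<le> lam i)"

definition is_svd :: "nat \<Rightarrow> nat \<Rightarrow> real mat \<Rightarrow> real mat \<Rightarrow> (nat \<Rightarrow> real) \<Rightarrow> real mat \<Rightarrow> bool" where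
  "is_svd m n A U \<sigma> V \<longleftrightarrow>
     U \<in> carrier_mat m n \<and> orthonormal_cols U \<and>
     V \<in> carrier_mat n n \<and> orthonormal_cols V \<and>
     (\<forall>i j. 1 \<le> i \<longrightarrow> i \<le> j \<longrightarrow> j \<le> n \<longrightarrow> \<sigma> j \<le> \<sigma> i) \<and>
     (\<forall>i. 1 \<le> i \<longrightarrow> i \<le> n \<longrightarrow> 0 \<le> \<sigma> i) \<and>
     A = U * mat_diag n (\<lambda>i. \<sigma> (i + 1)) * transpose_mat V"

definition V1_mat :: "nat \<Rightarrow> nat \<Rightarrow> real mat \<Rightarrow> real mat" where
  "V1_mat n k V = Matrix.mat n k (\<lambda>(i, j). V $$ (i, j))"

definition V2_mat :: "nat \<Rightarrow> nat \<Rightarrow> real mat \<Rightarrow> real mat" where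
  "V2_mat n k V = Matrix.mat n (n - k) (\<lambda>(i, j). V $$ (i, k + j))"

definition Sigma2_mat :: "nat \<Rightarrow> nat \<Rightarrow> (nat \<Rightarrow> real) \<Rightarrow> real mat" where
  "Sigma2_mat n k \<sigma> = mat_diag (n - k) (\<lambda>i. \<sigma> (k + i + 1))"

definition gamma_k :: "nat \<Rightarrow> nat \<Rightarrow> real mat \<Rightarrow> real mat \<Rightarrow> real \<Rightarrow> real" where
  "gamma_k n k V K lam1 =
     real k / (lam1 * trace_mat (the (mat_inverse (transpose_mat (V1_mat n k V) * K * V1_mat n k V))))"

definition beta_k :: "nat \<Rightarrow> nat \<Rightarrow> (nat \<Rightarrow> real) \<Rightarrow> real mat \<Rightarrow> real mat \<Rightarrow> real \<Rightarrow> real" where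
  "beta_k n k \<sigma> V K lam1 =
     trace_mat (Sigma2_mat n k \<sigma> * Sigma2_mat n k \<sigma> * transpose_mat (V2_mat n k V) * K * V2_mat n k V) /
     (lam1 * (frobenius_norm (Sigma2_mat n k \<sigma>))\<^sup>2)"

text \<open>The factor \<open>R\<close> is upper trapezoidal if \<open>B\<close> has more columns than rows. \<open>B\<close> may be rank
  deficient, in which case neither \<open>Q\<close> nor its range is determined by \<open>B\<close>.\<close>

definition economized_qr :: "real mat \<Rightarrow> real mat \<Rightarrow> real mat \<Rightarrow> bool" where
  "economized_qr B Q R \<longleftrightarrow>
     Q \<in> carrier_mat (dim_row B) (min (dim_row B) (dim_col B)) \<and> orthonormal_cols Q \<and>
     R \<in> carrier_mat (min (dim_row B) (dim_col B)) (dim_col B) \<and> upper_triangular R \<and>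
     Q * R = B"

text \<open>A point mass counts as a Gaussian distribution of variance \<open>0\<close>, which is needed for
  singular covariance matrices.\<close>

definition gaussian_rv :: "'w measure \<Rightarrow> ('w \<Rightarrow> real) \<Rightarrow> bool" where
  "gaussian_rv M X \<longleftrightarrow>
     X \<in> borel_measurable M \<and>
     ((\<exists>\<mu>. AE \<omega> in M. X \<omega> = \<mu>) \<or>
      (\<exists>\<mu> s. 0 < s \<and> distributed M lborel X (\<lambda>x. ennreal (normal_density \<mu> s x))))"

definition multivariate_gaussian ::
    "'w measure \<Rightarrow> nat \<Rightarrow> ('w \<Rightarrow> real vec) \<Rightarrow> real vec \<Rightarrow> real mat \<Rightarrow> bool" where
  "multivariate_gaussian M n X \<mu> C \<longleftrightarrow>
     (\<forall>\<omega>\<in>space M. X \<omega> \<in> carrier_vec n) \<and>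
     (\<forall>a\<in>carrier_vec n. gaussian_rv M (\<lambda>\<omega>. scalar_prod a (X \<omega>))) \<and>
     (\<forall>i<n. integral\<^sup>L M (\<lambda>\<omega>. vec_index (X \<omega>) i) = vec_index \<mu> i) \<and>
     (\<forall>i<n. \<forall>j<n.
        integral\<^sup>L M (\<lambda>\<omega>. (vec_index (X \<omega>) i - vec_index \<mu> i) * (vec_index (X \<omega>) j - vec_index \<mu> j))
          = C $$ (i, j))"

definition gaussian_random_matrix ::
    "'w measure \<Rightarrow> nat \<Rightarrow> nat \<Rightarrow> ('w \<Rightarrow> real mat) \<Rightarrow> real mat \<Rightarrow> bool" where
  "gaussian_random_matrix M n l \<Omega> K \<longleftrightarrow>
     (\<forall>\<omega>\<in>space M. \<Omega> \<omega> \<in> carrier_mat n l) \<and>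
     (\<forall>j<l. multivariate_gaussian M n (\<lambda>\<omega>. col (\<Omega> \<omega>) j) (0\<^sub>v n) K) \<and>
     prob_space.indep_vars M (\<lambda>_. \<Pi>\<^sub>M i\<in>{..<n}. borel)
       (\<lambda>j \<omega>. \<lambda>i\<in>{..<n}. \<Omega> \<omega> $$ (i, j)) {..<l}"

end

theory Submission
  imports Defs
begin

text \<open>Write \<open>\<Omega>\<^sub>1 = V\<^sub>1\<^sup>* \<Omega>\<close> and \<open>\<Omega>\<^sub>2 = V\<^sub>2\<^sup>* \<Omega>\<close>. For every right inverse \<open>G\<close> of \<open>\<Omega>\<^sub>1\<close>, the range of \<open>Q\<close> contains
  that of \<open>A \<Omega> G V\<^sub>1\<^sup>*\<close>, so the error is at most the norm of \<open>A - A \<Omega> G V\<^sub>1\<^sup>*\<close>, which is at most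
  \<open>\<parallel>\<Sigma>\<^sub>2\<parallel> + \<parallel>\<Sigma>\<^sub>2 \<Omega>\<^sub>2\<parallel> \<parallel>G\<parallel>\<close> (Frobenius norms). The two factors are controlled separately, so no
  independence of \<open>\<Omega>\<^sub>1\<close> and \<open>\<Omega>\<^sub>2\<close> is needed.

  For \<open>\<parallel>\<Sigma>\<^sub>2 \<Omega>\<^sub>2\<parallel>\<close> this is a Chernoff bound over the independent columns. For \<open>\<parallel>G\<parallel>\<close>, take as
  column \<open>i\<close> of \<open>G\<close> the minimal vector dual to row \<open>i\<close> of \<open>\<Omega>\<^sub>1\<close>: its squared norm is \<open>S\<^sup>-\<^sup>1\<^sub>i\<^sub>i / D\<close>,
  where \<open>S = V\<^sub>1\<^sup>* K V\<^sub>1\<close> and \<open>D\<close> is the squared distance of a standard Gaussian vector, independent of the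
  other \<open>k - 1\<close> rows, to the span of these rows. Hence \<open>D\<close> dominates a chi-square variable with \<open>p + 1\<close>
  degrees of freedom, and Markov's inequality applies to its moment of order \<open>- p / 2\<close>.\<close>

section \<open>Uniqueness of joint characteristic functions\<close>

text \<open>\<open>K\<close> may be singular and Gaussianity is given only through linear
  functionals of single columns, so neither a density nor a standard Gaussian source of
  \<open>\<Omega>\<close> is at hand. Independence of directions that are uncorrelated under
  \<open>K\<close> is therefore extracted from characteristic functions, which requires their
  uniqueness theorem in several variables. The standard Gaussian vector attached to row
  \<open>i\<close> comes from a dual basis. With \<open>w a\<close> the columns of
  \<open>V\<^sub>1\<close> and \<open>B\<close> the inverse of \<open>S\<close>, the vector z_i =
  sum_c B_ci w_c satisfies w_a^* K z_i = [a = i]. Hence z_i / sqrt B_ii has variance one and is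
  uncorrelated with every row other than \<open>i\<close>, while it gives sqrt B_ii times row
  \<open>i\<close> plus a combination of the other rows. The k - 1 other rows leave at least p + 1
  free dimensions out of k + p. The k column norms B_ii / D_i are dependent; since the weights B_ii
  / Tr B sum to one, convexity of x^(p/2) controls their sum without a union bound over the rows.
  The factor 3 / (p + 1) is an upper bound for the power 2 / p of the inverse chi-square
  moment.\<close>

lemma (in prob_space) weighted_char_eq_imp_set_eq:
  fixes h X :: "'a \<Rightarrow> real" and h' Y :: "'b \<Rightarrow> real"
  assumes N: "prob_space N"
    and [measurable]: "h \<in> borel_measurable M" "X \<in> borel_measurable M"
      "h' \<in> borel_measurable N" "Y \<in> borel_measurable N"
    and h: "\<And>x. 0 \<le> h x" "\<And>x. h x \<le> c" and h': "\<And>x. 0 \<le> h' x" "\<And>x. h' x \<le> c"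
    and eq: "\<And>s. (\<integral>x. complex_of_real (h x) * iexp (s * X x) \<partial>M)
                  = (\<integral>x. complex_of_real (h' x) * iexp (s * Y x) \<partial>N)"
    and S: "S \<in> sets borel"
  shows "(\<integral>x. h x * indicator S (X x) \<partial>M) = (\<integral>x. h' x * indicator S (Y x) \<partial>N)"
proof -
  interpret N: prob_space N by fact
  note [measurable] = S
  define I where "I = (\<integral>x. h x \<partial>M)"
  have ih: "integrable M h"
    by (rule integrable_const_bound[where B=c]) (use h in auto)
  have ih': "integrable N h'"
    by (rule N.integrable_const_bound[where B=c]) (use h' in auto)
  have I': "I = (\<integral>x. h' x \<partial>N)"
  proof -
    have "complex_of_real (\<integral>x. h x \<partial>M) = complex_of_real (\<integral>x. h' x \<partial>N)"
      using eq[of 0] by (simp add: integral_complex_of_real)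
    then show ?thesis by (simp only: of_real_eq_iff I_def)
  qed
  have I0: "0 \<le> I" unfolding I_def by (intro integral_nonneg_AE) (use h in auto)
  show ?thesis
  proof (cases "I = 0")
    case True
    have "AE x in M. h x = 0"
      using integral_nonneg_eq_0_iff_AE[OF ih] True h(1) unfolding I_def by auto
    then have "(\<integral>x. h x * indicator S (X x) \<partial>M) = (\<integral>x. 0 \<partial>M)"
      by (intro integral_cong_AE) auto
    moreover have "AE x in N. h' x = 0"
      using integral_nonneg_eq_0_iff_AE[OF ih'] True h'(1) unfolding I' by auto
    then have "(\<integral>x. h' x * indicator S (Y x) \<partial>N) = (\<integral>x. 0 \<partial>N)"
      by (intro integral_cong_AE) auto
    ultimately show ?thesis by simp
  next
    case False
    with I0 have Ip: "0 < I" by simp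
    \<comment> \<open>The value \<open>s = 0\<close> of the hypothesis shows that both weights have
      the same mass \<open>I\<close>. Divided by it they are probability densities, and the
      hypothesis says that \<open>X\<close> and \<open>Y\<close> have the same characteristic
      function under them, so Levy uniqueness applies.\<close>
    define P where "P = density M (\<lambda>x. ennreal (h x / I))"
    define R where "R = density N (\<lambda>x. ennreal (h' x / I))"
    have "emeasure P (space P) = 1"
      unfolding P_def using Ip h ih
      by (simp add: emeasure_density nn_integral_eq_integral ih I_def[symmetric])
    then interpret P: prob_space P by (rule prob_spaceI)
    have "emeasure R (space R) = 1"
      unfolding R_def using Ip h' ih'
      by (simp add: emeasure_density nn_integral_eq_integral ih' I'[symmetric])
    then interpret R: prob_space R by (rule prob_spaceI)
    have [measurable]: "X \<in> borel_measurable P" "Y \<in> borel_measurable R"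
      unfolding P_def R_def by simp_all
    have dP: "real_distribution (distr P borel X)"
      by (intro P.real_distribution_distr) simp
    have dR: "real_distribution (distr R borel Y)"
      by (intro R.real_distribution_distr) simp
    have cP: "char (distr P borel X) s = (\<integral>x. complex_of_real (h x) * iexp (s * X x) \<partial>M) / I" for s
    proof -
      have "char (distr P borel X) s = (\<integral>x. iexp (s * X x) \<partial>P)"
        unfolding char_def by (subst integral_distr) simp_all
      also have "\<dots> = (\<integral>x. (h x / I) *\<^sub>R iexp (s * X x) \<partial>M)"
        unfolding P_def by (subst integral_density) (use h Ip in auto)
      also have "\<dots> = (\<integral>x. complex_of_real (h x) * iexp (s * X x) / complex_of_real I \<partial>M)"
        by (intro Bochner_Integration.integral_cong) (auto simp: scaleR_conv_of_real)
      finally show ?thesis by simp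
    qed
    have cR: "char (distr R borel Y) s = (\<integral>x. complex_of_real (h' x) * iexp (s * Y x) \<partial>N) / I" for s
    proof -
      have "char (distr R borel Y) s = (\<integral>x. iexp (s * Y x) \<partial>R)"
        unfolding char_def by (subst integral_distr) simp_all
      also have "\<dots> = (\<integral>x. (h' x / I) *\<^sub>R iexp (s * Y x) \<partial>N)"
        unfolding R_def by (subst integral_density) (use h' Ip in auto)
      also have "\<dots> = (\<integral>x. complex_of_real (h' x) * iexp (s * Y x) / complex_of_real I \<partial>N)"
        by (intro Bochner_Integration.integral_cong) (auto simp: scaleR_conv_of_real)
      finally show ?thesis by simp
    qed
    have *: "distr P borel X = distr R borel Y"
      by (rule Levy_uniqueness[OF dP dR]) (simp only: fun_eq_iff cP cR eq simp_thms)
    have "(\<integral>x. indicator S x \<partial>distr P borel X) = (\<integral>x. h x / I * indicator S (X x) \<partial>M)"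
      by (subst integral_distr, simp, simp, unfold P_def, subst integral_density) (use h Ip in auto)
    moreover have "(\<integral>x. indicator S x \<partial>distr R borel Y) = (\<integral>x. h' x / I * indicator S (Y x) \<partial>N)"
      by (subst integral_distr, simp, simp, unfold R_def, subst integral_density) (use h' Ip in auto)
    ultimately have "(\<integral>x. h x / I * indicator S (X x) \<partial>M) = (\<integral>x. h' x / I * indicator S (Y x) \<partial>N)"
      using * by simp
    then show ?thesis using Ip by simp
  qed
qed

lemma integral_iexp_parts:
  fixes w \<phi> :: "'a \<Rightarrow> real"
  assumes "prob_space M" and [measurable]: "w \<in> borel_measurable M" "\<phi> \<in> borel_measurable M"
    and w: "\<And>x. \<bar>w x\<bar> \<le> 1"
  shows "(\<integral>x. complex_of_real (w x) * iexp (\<phi> x) \<partial>M)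
    = Complex (\<integral>x. w x * cos (\<phi> x) \<partial>M) (\<integral>x. w x * sin (\<phi> x) \<partial>M)"
proof -
  interpret prob_space M by fact
  have "integrable M (\<lambda>x. complex_of_real (w x) * iexp (\<phi> x))"
    by (rule integrable_const_bound[where B=1]) (use w in \<open>auto simp: norm_mult\<close>)
  then show ?thesis
    by (auto simp: complex_eq_iff integral_Re[symmetric] integral_Im[symmetric] Re_exp Im_exp)
qed

text \<open>The indicator functions of the coordinates in \<open>A\<close> are split off one at a time, each by
  the one-dimensional uniqueness theorem for a measure weighted with the remaining factors.\<close>

lemma char_eq_imp_mixed_eq:
  fixes X :: "'i \<Rightarrow> 'a \<Rightarrow> real" and Y :: "'i \<Rightarrow> 'b \<Rightarrow> real"
  assumes "finite A" and "finite B" and "A \<inter> B = {}"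
    and M: "prob_space M" and N: "prob_space N"
    and X: "\<And>i. i \<in> A \<union> B \<Longrightarrow> X i \<in> borel_measurable M"
    and Y: "\<And>i. i \<in> A \<union> B \<Longrightarrow> Y i \<in> borel_measurable N"
    and eq: "\<And>t. (\<integral>x. iexp (\<Sum>i\<in>A \<union> B. t i * X i x) \<partial>M) = (\<integral>x. iexp (\<Sum>i\<in>A \<union> B. t i * Y i x) \<partial>N)"
    and S: "\<And>i. i \<in> A \<Longrightarrow> S i \<in> sets borel"
  shows "(\<integral>x. complex_of_real (\<Prod>i\<in>A. indicator (S i) (X i x)) * iexp (\<Sum>i\<in>B. t i * X i x) \<partial>M)
       = (\<integral>x. complex_of_real (\<Prod>i\<in>A. indicator (S i) (Y i x)) * iexp (\<Sum>i\<in>B. t i * Y i x) \<partial>N)"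
  using assms(1-3) X Y eq S
proof (induction A arbitrary: B t)
  case empty
  then show ?case by simp
next
  case (insert b A B t)
  interpret M: prob_space M by fact
  interpret N: prob_space N by fact
  note [measurable] = insert.prems(3,4,6)
  define w where "w x = (\<Prod>i\<in>A. indicator (S i) (X i x) :: real)" for x
  define v where "v x = (\<Prod>i\<in>A. indicator (S i) (Y i x) :: real)" for x
  have [measurable]: "X i \<in> borel_measurable M" "Y i \<in> borel_measurable N" 
    if "i \<in> A" for i using insert.prems(3,4) that by auto
  have [measurable]: "X i \<in> borel_measurable M" "Y i \<in> borel_measurable N" 
    if "i \<in> B" for i using insert.prems(3,4) that by auto
  have [measurable]: "X b \<in> borel_measurable M" "Y b \<in> borel_measurable N" "S b \<in> sets borel"
    using insert.prems by auto
  have [measurable]: "S i \<in> sets borel" if "i \<in> A" for i using insert.prems(6) that by auto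
  have wm[measurable]: "w \<in> borel_measurable M" unfolding w_def by measurable
  have vm[measurable]: "v \<in> borel_measurable N" unfolding v_def by measurable
  have w: "0 \<le> w x" "w x \<le> 1" for x unfolding w_def
    by (auto intro!: prod_nonneg prod_le_1 simp: indicator_def)
  have v: "0 \<le> v x" "v x \<le> 1" for x unfolding v_def
    by (auto intro!: prod_nonneg prod_le_1 simp: indicator_def)
  define \<phi> where "\<phi> t x = (\<Sum>i\<in>B. t i * X i x)" for t x
  define \<psi> where "\<psi> t x = (\<Sum>i\<in>B. t i * Y i x)" for t x
  have pm[measurable]: "\<phi> t \<in> borel_measurable M" "\<psi> t \<in> borel_measurable N" for t
    unfolding \<phi>_def \<psi>_def by measurable
  \<comment> \<open>The coordinate \<open>b\<close> joins the frequency coordinates with a free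
    frequency \<open>s\<close>. This is the characteristic function of \<open>X b\<close> under the
    weight formed by the indicators of \<open>A\<close> and the phase of \<open>B\<close>.\<close>
  have IH: "(\<integral>x. complex_of_real (w x) * iexp (s * X b x + \<phi> t x) \<partial>M)
        = (\<integral>x. complex_of_real (v x) * iexp (s * Y b x + \<psi> t x) \<partial>N)" for s t
  proof -
    have U: "A \<union> insert b B = insert b A \<union> B" by auto
    have b: "b \<notin> B" using insert.prems by auto
    have "(\<integral>x. complex_of_real (w x) * iexp (\<Sum>i\<in>insert b B. (t(b := s)) i * X i x) \<partial>M)
        = (\<integral>x. complex_of_real (v x) * iexp (\<Sum>i\<in>insert b B. (t(b := s)) i * Y i x) \<partial>N)"
      unfolding w_def v_def
      by (rule insert.IH) (use insert.prems insert.hyps in \<open>auto simp del: Un_insert_right simp: U\<close>)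
    moreover have "(\<Sum>i\<in>insert b B. (t(b := s)) i * Z i) = s * Z b + (\<Sum>i\<in>B. t i * Z i)"
      for Z :: "'i \<Rightarrow> real"
    proof -
      have "(\<Sum>i\<in>B. (t(b := s)) i * Z i) = (\<Sum>i\<in>B. t i * Z i)"
        by (rule sum.cong) (use b in auto)
      then show ?thesis using b insert.prems(1) by simp
    qed
    ultimately show ?thesis unfolding \<phi>_def \<psi>_def by (simp only:)
  qed
  have neg: "\<phi> (\<lambda>i. - t i) x = - \<phi> t x" "\<psi> (\<lambda>i. - t i) y = - \<psi> t y" for x y
    by (simp_all add: \<phi>_def \<psi>_def sum_negf)
  have z: "\<phi> (\<lambda>i. 0) x = 0" "\<psi> (\<lambda>i. 0) y = 0" for x y by (simp_all add: \<phi>_def \<psi>_def)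
  have inM: "integrable M (\<lambda>x. complex_of_real (w x) * iexp (f x))" if "f \<in> borel_measurable M" for f
    by (rule M.integrable_const_bound[where B=1]) (use w that in \<open>auto simp: norm_mult\<close>)
  have inN: "integrable N (\<lambda>x. complex_of_real (v x) * iexp (f x))" if "f \<in> borel_measurable N" for f
    by (rule N.integrable_const_bound[where B=1]) (use v that in \<open>auto simp: norm_mult\<close>)
  have e0: "(\<integral>x. w x * indicator (S b) (X b x) \<partial>M) = (\<integral>x. v x * indicator (S b) (Y b x) \<partial>N)"
    by (rule M.weighted_char_eq_imp_set_eq[OF N, where c=1])
      (use w v IH[of _ "\<lambda>i. 0"] in \<open>auto simp: z\<close>)
  \<comment> \<open>The one-dimensional lemma needs real nonnegative weights, but the phase of the
    coordinates in \<open>B\<close> is complex. Its real and imaginary parts are made nonnegative by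
    adding 1; the contribution of the 1 is \<open>e0\<close> and is subtracted afterwards.\<close>
  have e1: "(\<integral>x. w x * (1 + cos (\<phi> t x)) * indicator (S b) (X b x) \<partial>M)
          = (\<integral>x. v x * (1 + cos (\<psi> t x)) * indicator (S b) (Y b x) \<partial>N)"
  proof (rule M.weighted_char_eq_imp_set_eq[OF N, where c=2])
    fix s
    \<comment> \<open>Euler's formula turns the shifted weight into phases \<open>q\<close>,
      \<open>q + p\<close> and \<open>q - p\<close>, which are covered by \<open>IH\<close> at the
      frequency vectors 0, \<open>t\<close> and \<open>- t\<close>.\<close>
    have ident: "complex_of_real (a * (1 + cos p)) * iexp q
      = complex_of_real a * iexp q + (complex_of_real a * iexp (q + p) + complex_of_real a * iexp (q - p)) / 2" for a p q
      by (simp add: complex_eq_iff Re_exp Im_exp cos_add sin_add cos_diff sin_diff algebra_simps)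
    show "(\<integral>x. complex_of_real (w x * (1 + cos (\<phi> t x))) * iexp (s * X b x) \<partial>M)
        = (\<integral>x. complex_of_real (v x * (1 + cos (\<psi> t x))) * iexp (s * Y b x) \<partial>N)"
      unfolding ident using IH[of s "\<lambda>i. 0"] IH[of s t] IH[of s "\<lambda>i. - t i"] 
      by (simp add: inM inN z neg del: of_real_add of_real_mult of_real_diff)
    have c: "0 \<le> 1 + cos x" "1 + cos x \<le> 2" for x :: real using cos_ge_minus_one[of x] cos_le_one[of x] by linarith+
    show "0 \<le> w x * (1 + cos (\<phi> t x))" "w x * (1 + cos (\<phi> t x)) \<le> 2" for x
      using c[of "\<phi> t x"] w[of x] mult_mono[of "w x" 1 "1 + cos (\<phi> t x)" 2] by auto
    show "0 \<le> v x * (1 + cos (\<psi> t x))" "v x * (1 + cos (\<psi> t x)) \<le> 2" for x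
      using c[of "\<psi> t x"] v[of x] mult_mono[of "v x" 1 "1 + cos (\<psi> t x)" 2] by auto
  qed auto
  have e2: "(\<integral>x. w x * (1 + sin (\<phi> t x)) * indicator (S b) (X b x) \<partial>M)
          = (\<integral>x. v x * (1 + sin (\<psi> t x)) * indicator (S b) (Y b x) \<partial>N)"
  proof (rule M.weighted_char_eq_imp_set_eq[OF N, where c=2])
    fix s
    have ident: "complex_of_real (a * (1 + sin p)) * iexp q
      = complex_of_real a * iexp q + (complex_of_real a * iexp (q + p) - complex_of_real a * iexp (q - p)) / (2 * \<i>)" for a p q
      by (simp add: complex_eq_iff Re_exp Im_exp cos_add sin_add cos_diff sin_diff algebra_simps Re_divide Im_divide)
    show "(\<integral>x. complex_of_real (w x * (1 + sin (\<phi> t x))) * iexp (s * X b x) \<partial>M)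
        = (\<integral>x. complex_of_real (v x * (1 + sin (\<psi> t x))) * iexp (s * Y b x) \<partial>N)"
      unfolding ident using IH[of s "\<lambda>i. 0"] IH[of s t] IH[of s "\<lambda>i. - t i"] 
      by (simp add: inM inN z neg del: of_real_add of_real_mult of_real_diff)
    have c: "0 \<le> 1 + sin x" "1 + sin x \<le> 2" for x :: real using sin_ge_minus_one[of x] sin_le_one[of x] by linarith+
    show "0 \<le> w x * (1 + sin (\<phi> t x))" "w x * (1 + sin (\<phi> t x)) \<le> 2" for x
      using c[of "\<phi> t x"] w[of x] mult_mono[of "w x" 1 "1 + sin (\<phi> t x)" 2] by auto
    show "0 \<le> v x * (1 + sin (\<psi> t x))" "v x * (1 + sin (\<psi> t x)) \<le> 2" for x
      using c[of "\<psi> t x"] v[of x] mult_mono[of "v x" 1 "1 + sin (\<psi> t x)" 2] by auto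
  qed auto
  define w' where "w' x = w x * indicator (S b) (X b x)" for x
  define v' where "v' x = v x * indicator (S b) (Y b x)" for x
  have [measurable]: "w' \<in> borel_measurable M" "v' \<in> borel_measurable N"
    unfolding w'_def v'_def by measurable
  have w': "\<bar>w' x\<bar> \<le> 1" and v': "\<bar>v' y\<bar> \<le> 1" for x y 
    unfolding w'_def v'_def using w v by (auto simp: indicator_def)
  have bdM: "integrable M (\<lambda>x. w' x * f x)" if "f \<in> borel_measurable M" "\<And>x. \<bar>f x\<bar> \<le> 1" for f
    by (rule M.integrable_const_bound[where B=1]) 
       (use w' that in \<open>auto simp: abs_mult intro!: mult_le_one\<close>)
  have bdN: "integrable N (\<lambda>x. v' x * f x)" if "f \<in> borel_measurable N" "\<And>x. \<bar>f x\<bar> \<le> 1" for f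
    by (rule N.integrable_const_bound[where B=1]) 
       (use v' that in \<open>auto simp: abs_mult intro!: mult_le_one\<close>)
  have e0': "(\<integral>x. w' x * 1 \<partial>M) = (\<integral>x. v' x * 1 \<partial>N)" using e0 by (simp add: w'_def v'_def)
  have "(\<integral>x. w' x * 1 + w' x * cos (\<phi> t x) \<partial>M) = (\<integral>x. v' x * 1 + v' x * cos (\<psi> t x) \<partial>N)"
    using e1 by (simp add: w'_def v'_def algebra_simps)
  then have e1': "(\<integral>x. w' x * cos (\<phi> t x) \<partial>M) = (\<integral>x. v' x * cos (\<psi> t x) \<partial>N)"
    using e0' bdM[of "\<lambda>_. 1"] bdN[of "\<lambda>_. 1"] by (subst (asm) (1 2) Bochner_Integration.integral_add) (auto intro!: bdM bdN simp del: mult_1_right)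
  have "(\<integral>x. w' x * 1 + w' x * sin (\<phi> t x) \<partial>M) = (\<integral>x. v' x * 1 + v' x * sin (\<psi> t x) \<partial>N)"
    using e2 by (simp add: w'_def v'_def algebra_simps)
  then have e2': "(\<integral>x. w' x * sin (\<phi> t x) \<partial>M) = (\<integral>x. v' x * sin (\<psi> t x) \<partial>N)"
    using e0' bdM[of "\<lambda>_. 1"] bdN[of "\<lambda>_. 1"] by (subst (asm) (1 2) Bochner_Integration.integral_add) (auto intro!: bdM bdN simp del: mult_1_right)
  have "(\<integral>x. complex_of_real (w' x) * iexp (\<phi> t x) \<partial>M) = (\<integral>x. complex_of_real (v' x) * iexp (\<psi> t x) \<partial>N)"
    using e1' e2' by (simp add: integral_iexp_parts M N w' v')
  moreover have "(\<Prod>i\<in>insert b A. indicator (S i) (X i x)) = w' x" for x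
    using insert.hyps by (simp add: w'_def w_def mult.commute)
  moreover have "(\<Prod>i\<in>insert b A. indicator (S i) (Y i x)) = v' x" for x
    using insert.hyps by (simp add: v'_def v_def mult.commute)
  ultimately show ?case by (simp only: \<phi>_def \<psi>_def)
qed

text \<open>Taking every coordinate as an indicator coordinate in
  \<open>char_eq_imp_mixed_eq\<close> gives equality on boxes, and finite measures on a finite
  product are determined by their values on boxes.\<close>

lemma distr_eq_if_joint_char_eq:
  fixes X :: "'i \<Rightarrow> 'a \<Rightarrow> real" and Y :: "'i \<Rightarrow> 'b \<Rightarrow> real"
  assumes I: "finite I"
    and M: "prob_space M" and N: "prob_space N"
    and X: "\<And>i. i \<in> I \<Longrightarrow> X i \<in> borel_measurable M"
    and Y: "\<And>i. i \<in> I \<Longrightarrow> Y i \<in> borel_measurable N"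
    and eq: "\<And>t. (\<integral>x. iexp (\<Sum>i\<in>I. t i * X i x) \<partial>M) = (\<integral>x. iexp (\<Sum>i\<in>I. t i * Y i x) \<partial>N)"
  shows "distr M (\<Pi>\<^sub>M i\<in>I. borel) (\<lambda>x. \<lambda>i\<in>I. X i x) = distr N (\<Pi>\<^sub>M i\<in>I. borel) (\<lambda>x. \<lambda>i\<in>I. Y i x)"
proof -
  interpret M: prob_space M by fact
  interpret N: prob_space N by fact
  have Xm[measurable]: "(\<lambda>x. \<lambda>i\<in>I. X i x) \<in> measurable M (\<Pi>\<^sub>M i\<in>I. borel)"
    using X by (intro measurable_restrict) auto
  have Ym[measurable]: "(\<lambda>x. \<lambda>i\<in>I. Y i x) \<in> measurable N (\<Pi>\<^sub>M i\<in>I. borel)"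
    using Y by (intro measurable_restrict) auto
  show ?thesis
  proof (rule measure_eqI_PiM_finite[OF I])
    fix S :: "'i \<Rightarrow> real set" assume S: "\<And>i. i \<in> I \<Longrightarrow> S i \<in> sets borel"
    then have Sm[measurable]: "Pi\<^sub>E I S \<in> sets (\<Pi>\<^sub>M i\<in>I. borel)" using I by (intro sets_PiM_I_finite) auto
    have ind: "indicator (Pi\<^sub>E I S) (\<lambda>i\<in>I. Z i) = (\<Prod>i\<in>I. indicator (S i) (Z i) :: real)" for Z
    proof (cases "\<forall>i\<in>I. Z i \<in> S i")
      case True
      then show ?thesis by (auto simp: indicator_def PiE_iff)
    next
      case False
      then obtain j where "j \<in> I" "Z j \<notin> S j" by auto
      then have "(\<Prod>i\<in>I. indicator (S i) (Z i) :: real) = 0"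
        using I by (intro prod_zero) (auto intro!: bexI[of _ j])
      then show ?thesis using False by (auto simp: indicator_def PiE_iff)
    qed
    have "(\<integral>x. complex_of_real (\<Prod>i\<in>I. indicator (S i) (X i x)) * iexp (\<Sum>i\<in>{}. 0 * X i x) \<partial>M)
       = (\<integral>x. complex_of_real (\<Prod>i\<in>I. indicator (S i) (Y i x)) * iexp (\<Sum>i\<in>{}. 0 * Y i x) \<partial>N)"
      by (rule char_eq_imp_mixed_eq[where t="\<lambda>i. 0"]) (use assms S in auto)
    then have e: "(\<integral>x. (\<Prod>i\<in>I. indicator (S i) (X i x) :: real) \<partial>M) = (\<integral>x. (\<Prod>i\<in>I. indicator (S i) (Y i x)) \<partial>N)"
      by (simp add: integral_complex_of_real del: of_real_prod)
    have "measure (distr M (\<Pi>\<^sub>M i\<in>I. borel) (\<lambda>x. \<lambda>i\<in>I. X i x)) (Pi\<^sub>E I S)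
        = (\<integral>z. indicator (Pi\<^sub>E I S) z \<partial>distr M (\<Pi>\<^sub>M i\<in>I. borel) (\<lambda>x. \<lambda>i\<in>I. X i x))"
      using sets.sets_into_space[OF Sm] by (simp add: Int_absorb2)
    also have "\<dots> = (\<integral>x. indicator (Pi\<^sub>E I S) (\<lambda>i\<in>I. X i x) \<partial>M)"
      by (subst integral_distr) auto
    also have "\<dots> = (\<integral>x. indicator (Pi\<^sub>E I S) (\<lambda>i\<in>I. Y i x) \<partial>N)"
      unfolding ind by (rule e)
    also have "\<dots> = (\<integral>z. indicator (Pi\<^sub>E I S) z \<partial>distr N (\<Pi>\<^sub>M i\<in>I. borel) (\<lambda>x. \<lambda>i\<in>I. Y i x))"
      by (subst integral_distr) auto
    also have "\<dots> = measure (distr N (\<Pi>\<^sub>M i\<in>I. borel) (\<lambda>x. \<lambda>i\<in>I. Y i x)) (Pi\<^sub>E I S)"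
      using sets.sets_into_space[OF Sm] by (simp add: Int_absorb2)
    finally have m: "measure (distr M (\<Pi>\<^sub>M i\<in>I. borel) (\<lambda>x. \<lambda>i\<in>I. X i x)) (Pi\<^sub>E I S)
      = measure (distr N (\<Pi>\<^sub>M i\<in>I. borel) (\<lambda>x. \<lambda>i\<in>I. Y i x)) (Pi\<^sub>E I S)" .
    interpret DM: prob_space "distr M (\<Pi>\<^sub>M i\<in>I. borel) (\<lambda>x. \<lambda>i\<in>I. X i x)"
      by (rule M.prob_space_distr) simp
    interpret DN: prob_space "distr N (\<Pi>\<^sub>M i\<in>I. borel) (\<lambda>x. \<lambda>i\<in>I. Y i x)"
      by (rule N.prob_space_distr) simp
    show "emeasure (distr M (\<Pi>\<^sub>M i\<in>I. borel) (\<lambda>x. \<lambda>i\<in>I. X i x)) (Pi\<^sub>E I S)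
      = emeasure (distr N (\<Pi>\<^sub>M i\<in>I. borel) (\<lambda>x. \<lambda>i\<in>I. Y i x)) (Pi\<^sub>E I S)"
      using m by (simp add: DM.emeasure_eq_measure DN.emeasure_eq_measure)
  next
    show "range (\<lambda>_::nat. \<Pi>\<^sub>E i\<in>I. UNIV) \<subseteq> prod_algebra I (\<lambda>i. borel::real measure)"
      using I by (auto intro!: prod_algebraI_finite)
    show "(\<Union>n::nat. \<Pi>\<^sub>E i\<in>I. UNIV) = space (Pi\<^sub>M I (\<lambda>i. borel::real measure))"
      by (simp add: space_PiM)
    interpret DM: prob_space "distr M (\<Pi>\<^sub>M i\<in>I. borel) (\<lambda>x. \<lambda>i\<in>I. X i x)"
      by (rule M.prob_space_distr) simp
    show "emeasure (distr M (\<Pi>\<^sub>M i\<in>I. borel) (\<lambda>x. \<lambda>i\<in>I. X i x)) (\<Pi>\<^sub>E i\<in>I. UNIV) \<noteq> \<infinity>" for n::nat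
      by (simp add: DM.emeasure_eq_measure)
  qed simp_all
qed

section \<open>Gaussian and chi-square integrals\<close>

lemma prob_space_std_normal: "prob_space std_normal_distribution"
  using real_dist_normal_dist by (simp add: real_distribution_def)

text \<open>Multiplying the standard normal density by exp(c x^2) gives \<open>\<sigma>\<close>
  times the centered normal density of variance \<open>\<sigma>\<^sup>2\<close> = 1 / (1 - 2c), so
  the integral is \<open>\<sigma>\<close>.\<close>

lemma nn_integral_exp_square_std_normal:
  fixes c :: real
  assumes "c < 1 / 2"
  shows "(\<integral>\<^sup>+x. ennreal (exp (c * x\<^sup>2)) \<partial>std_normal_distribution) = ennreal ((1 - 2 * c) powr (- 1 / 2))"
proof -
  define \<sigma> where "\<sigma> = 1 / sqrt (1 - 2 * c)"
  have s: "0 < \<sigma>" "\<sigma>\<^sup>2 = 1 / (1 - 2 * c)" using assms by (simp_all add: \<sigma>_def power_divide)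
  have pw: "(1 - 2 * c) powr (- 1 / 2) = \<sigma>"
    using assms by (simp add: \<sigma>_def powr_minus_divide powr_half_sqrt)
  have sq: "sqrt (2 * pi * \<sigma>\<^sup>2) = sqrt (2 * pi) * \<sigma>" using s(1) by (simp add: real_sqrt_mult)
  have e: "std_normal_density x * exp (c * x\<^sup>2) = \<sigma> * normal_density 0 \<sigma> x" for x
  proof -
    have *: "- (x\<^sup>2 / 2) + c * x\<^sup>2 = - (x\<^sup>2 / (2 * \<sigma>\<^sup>2))"
      unfolding s(2) using assms by (simp add: field_simps)
    have "exp (- (x\<^sup>2 / 2)) * exp (c * x\<^sup>2) = exp (- (x\<^sup>2 / (2 * \<sigma>\<^sup>2)))"
      unfolding exp_add[symmetric] * ..
    then show ?thesis using s(1)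
      by (simp add: std_normal_density_def normal_density_def sq)
  qed
  have "(\<integral>\<^sup>+x. ennreal (exp (c * x\<^sup>2)) \<partial>std_normal_distribution)
      = (\<integral>\<^sup>+x. ennreal (\<sigma> * normal_density 0 \<sigma> x) \<partial>lborel)"
    by (subst nn_integral_density) (auto simp: ennreal_mult[symmetric] e)
  also have "\<dots> = ennreal \<sigma>"
    using s(1) by (subst nn_integral_eq_integral) auto
  finally show ?thesis by (simp only: pw)
qed

text \<open>The Gamma integral after the substitution t = x s. Read from right to left, it writes a
  negative power of \<open>x\<close> as a mixture of exponentials exp(- x s), which factor when
  \<open>x\<close> is a sum of independent terms.\<close>

lemma nn_integral_Gamma_scaled:
  fixes q x :: real
  assumes q: "0 < q" and x: "0 < x"
  shows "(\<integral>\<^sup>+s. ennreal (indicator {0..} s * s powr (q - 1) * exp (- (x * s))) \<partial>lborel)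
       = ennreal (Gamma q * x powr (- q))"
proof -
  have "ennreal (Gamma q) = (\<integral>\<^sup>+t. ennreal (indicator {0..} t * t powr (q - 1) / exp t) \<partial>lborel)"
    by (rule Gamma_conv_nn_integral_real[OF q])
  also have "\<dots> = ennreal \<bar>x\<bar> * (\<integral>\<^sup>+s. ennreal (indicator {0..} (0 + x * s) * (0 + x * s) powr (q - 1) / exp (0 + x * s)) \<partial>lborel)"
    by (rule nn_integral_real_affine) (use x in auto)
  also have "\<dots> = ennreal x * (\<integral>\<^sup>+s. ennreal (x powr (q - 1)) * ennreal (indicator {0..} s * s powr (q - 1) * exp (- (x * s))) \<partial>lborel)"
    using x by (intro arg_cong2[where f="(*)"] nn_integral_cong)
      (auto simp: ennreal_mult[symmetric] powr_mult indicator_def zero_le_mult_iff exp_minus field_simps)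
  also have "\<dots> = ennreal (x powr q) * (\<integral>\<^sup>+s. ennreal (indicator {0..} s * s powr (q - 1) * exp (- (x * s))) \<partial>lborel)"
    using x by (subst nn_integral_cmult) (auto simp: mult.assoc[symmetric] ennreal_mult[symmetric] powr_diff)
  finally have "ennreal (x powr (- q)) * ennreal (Gamma q) 
    = ennreal (x powr (- q)) * (ennreal (x powr q) * (\<integral>\<^sup>+s. ennreal (indicator {0..} s * s powr (q - 1) * exp (- (x * s))) \<partial>lborel))"
    by simp
  also have "\<dots> = (\<integral>\<^sup>+s. ennreal (indicator {0..} s * s powr (q - 1) * exp (- (x * s))) \<partial>lborel)"
    using x by (simp add: mult.assoc[symmetric] ennreal_mult[symmetric] powr_add[symmetric])
  finally show ?thesis using x q by (simp add: ennreal_mult[symmetric] Gamma_real_nonneg mult.commute)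
qed

text \<open>The value \<open>\<infinity>\<close> at \<open>0\<close> makes Markov's inequality also cover linearly dependent rows.\<close>

definition inv_powr :: "real \<Rightarrow> real \<Rightarrow> ennreal" where
  "inv_powr q x = (if x \<le> 0 then \<infinity> else ennreal (x powr (- q)))"

lemma inv_powr_antimono: "0 \<le> q \<Longrightarrow> x \<le> y \<Longrightarrow> inv_powr q y \<le> inv_powr q x"
  by (auto simp: inv_powr_def intro!: ennreal_leI powr_mono2')

lemma borel_measurable_inv_powr [measurable]: "inv_powr q \<in> borel_measurable borel"
  unfolding inv_powr_def[abs_def] by measurable

text \<open>Writing \<open>(1 + 2 * s) powr (- r)\<close> as a Gamma integral and exchanging the integrals avoids a
  substitution.\<close>

lemma nn_integral_Beta_half_line:
  fixes q :: real
  assumes q: "0 < q"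
  shows "(\<integral>\<^sup>+s. ennreal (indicator {0..} s * s powr (q - 1) * (1 + 2 * s) powr (- (q + 1 / 2))) \<partial>lborel)
    = ennreal (2 powr (- q) * Gamma q * Gamma (1 / 2) / Gamma (q + 1 / 2))"
proof -
  define r where "r = q + 1 / 2"
  have r: "0 < r" using q by (simp add: r_def)
  have Gr: "0 < Gamma r" "0 < Gamma q" using r q by (auto intro: Gamma_real_pos)
  define f where "f s v = ennreal (indicator {0..} s * s powr (q - 1) * (indicator {0..} v * v powr (r - 1)) * exp (- ((1 + 2 * s) * v)) / Gamma r)" for s v :: real
  have fm[measurable]: "case_prod f \<in> borel_measurable (lborel \<Otimes>\<^sub>M lborel)"
    unfolding f_def by (simp add: case_prod_beta)
  have 1: "(\<integral>\<^sup>+v. f s v \<partial>lborel) = ennreal (indicator {0..} s * s powr (q - 1) * (1 + 2 * s) powr (- r))" for s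
  proof (cases "0 \<le> s")
    case True
    have "(\<integral>\<^sup>+v. f s v \<partial>lborel) = (\<integral>\<^sup>+v. ennreal (s powr (q - 1) / Gamma r) * ennreal (indicator {0..} v * v powr (r - 1) * exp (- ((1 + 2 * s) * v))) \<partial>lborel)"
      using True Gr by (intro nn_integral_cong) (auto simp: f_def ennreal_mult[symmetric] field_simps)
    also have "\<dots> = ennreal (s powr (q - 1) / Gamma r) * ennreal (Gamma r * (1 + 2 * s) powr (- r))"
      using True r by (subst nn_integral_cmult) (auto simp: nn_integral_Gamma_scaled)
    finally show ?thesis using True Gr by (simp add: ennreal_mult[symmetric])
  qed (simp add: f_def)
  \<comment> \<open>For fixed \<open>v\<close> the inner integral is a Gamma integral of rate
    \<open>2 * v\<close>. The powers of \<open>v\<close> then combine to r - 1 - q = 1/2 - 1, which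
    is why the outer integral is Gamma(1/2).\<close>
  have 2: "(\<integral>\<^sup>+s. f s v \<partial>lborel) = ennreal (2 powr (- q) * Gamma q / Gamma r) * ennreal (indicator {0..} v * v powr (1 / 2 - 1) * exp (- (1 * v)))"
    if "v \<noteq> 0" for v
  proof (cases "0 \<le> v")
    case True
    with that have v: "0 < v" by simp
    have "(\<integral>\<^sup>+s. f s v \<partial>lborel) = (\<integral>\<^sup>+s. ennreal (v powr (r - 1) * exp (- v) / Gamma r) * ennreal (indicator {0..} s * s powr (q - 1) * exp (- (2 * v * s))) \<partial>lborel)"
      using v Gr by (intro nn_integral_cong)
        (auto simp: f_def ennreal_mult[symmetric] field_simps indicator_def exp_add[symmetric])
    also have "\<dots> = ennreal (v powr (r - 1) * exp (- v) / Gamma r) * ennreal (Gamma q * (2 * v) powr (- q))"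
      using v q by (subst nn_integral_cmult) (auto simp: nn_integral_Gamma_scaled)
    also have "\<dots> = ennreal (2 powr (- q) * Gamma q / Gamma r * (v powr (1 / 2 - 1) * exp (- v)))"
    proof -
      have "v powr (r - 1) * (2 * v) powr (- q) = 2 powr (- q) * v powr (1 / 2 - 1)"
        using v by (simp add: powr_mult powr_add[symmetric] r_def)
      then have "v powr (r - 1) * exp (- v) / Gamma r * (Gamma q * (2 * v) powr (- q)) = 2 powr (- q) * Gamma q / Gamma r * (v powr (1 / 2 - 1) * exp (- v))"
        by (simp add: field_simps)
      then show ?thesis using Gr by (simp add: ennreal_mult[symmetric] del: times_divide_eq_left times_divide_eq_right)
    qed
    finally show ?thesis using v Gr by (simp add: ennreal_mult[symmetric])
  qed (simp add: f_def)
  have "(\<integral>\<^sup>+s. ennreal (indicator {0..} s * s powr (q - 1) * (1 + 2 * s) powr (- r)) \<partial>lborel)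
      = (\<integral>\<^sup>+s. \<integral>\<^sup>+v. f s v \<partial>lborel \<partial>lborel)" by (simp add: 1)
  also have "\<dots> = (\<integral>\<^sup>+v. \<integral>\<^sup>+s. f s v \<partial>lborel \<partial>lborel)"
    by (rule lborel_pair.Fubini'[symmetric]) simp
  also have "\<dots> = (\<integral>\<^sup>+v. ennreal (2 powr (- q) * Gamma q / Gamma r) * ennreal (indicator {0..} v * v powr (1 / 2 - 1) * exp (- (1 * v))) \<partial>lborel)"
    using AE_lborel_singleton[of 0] by (intro nn_integral_cong_AE) (auto simp: 2)
  also have "\<dots> = ennreal (2 powr (- q) * Gamma q / Gamma r) * ennreal (Gamma (1 / 2) * 1 powr (- 1 / 2))"
    using nn_integral_Gamma_scaled[of "1 / 2" 1] by (subst nn_integral_cmult) auto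
  finally show ?thesis using Gr
    by (simp add: ennreal_mult[symmetric] r_def Gamma_real_nonneg)
qed

text \<open>With q = p / 2, the negative power is written as a Gamma mixture of exp(- s X). Each of
  the p + 1 independent squares contributes (1 + 2s)^(-1/2), so the total exponent is q + 1/2,
  exactly the integrand of \<open>nn_integral_Beta_half_line\<close>.\<close>

lemma nn_integral_chi_square_inv_powr:
  fixes p :: nat
  assumes p: "1 \<le> p"
  shows "(\<integral>\<^sup>+x. inv_powr (p / 2) (\<Sum>i<p+1. (x i)\<^sup>2) \<partial>(\<Pi>\<^sub>M i\<in>{..<p+1}. std_normal_distribution))
    = ennreal (2 powr (- (p / 2)) * Gamma (1 / 2) / Gamma ((p + 1) / 2))"
proof -
  let ?S = "std_normal_distribution" and ?P = "\<Pi>\<^sub>M i\<in>{..<p+1}. std_normal_distribution"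
  interpret S: prob_space ?S by (rule prob_space_std_normal)
  interpret PS: product_prob_space "\<lambda>_. ?S" "{..<p+1}" ..
  interpret P: prob_space ?P by (rule prob_space_PiM) (rule prob_space_std_normal)
  define q where "q = real p / 2"
  have q: "0 < q" using p by (simp add: q_def)
  have Gq: "0 < Gamma q" using q by (auto intro: Gamma_real_pos)
  define X where "X x = (\<Sum>i<p+1. (x i)\<^sup>2)" for x :: "nat \<Rightarrow> real"
  have Xm[measurable]: "X \<in> borel_measurable ?P" unfolding X_def by measurable
  have "AE x in ?S. x \<noteq> 0"
    using AE_lborel_singleton[of "0::real"] by (subst AE_density) auto
  then have "AE x in ?P. x 0 \<noteq> 0"
    by (intro AE_PiM_component) (auto simp: prob_space_std_normal)
  then have Xpos: "AE x in ?P. 0 < X x"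
  proof (rule AE_mp, intro AE_I2 impI)
    fix x :: "nat \<Rightarrow> real" assume "x 0 \<noteq> 0"
    then show "0 < X x" unfolding X_def by (intro sum_pos2[of _ 0]) auto
  qed
  define f where "f x s = ennreal (indicator {0..} s * s powr (q - 1) * exp (- (X x * s)) / Gamma q)" for x s
  have fm: "case_prod f \<in> borel_measurable (?P \<Otimes>\<^sub>M lborel)"
    unfolding f_def by measurable
  have 1: "inv_powr q (X x) = (\<integral>\<^sup>+s. f x s \<partial>lborel)" if "0 < X x" for x
  proof -
    have "(\<integral>\<^sup>+s. f x s \<partial>lborel) = (\<integral>\<^sup>+s. ennreal (1 / Gamma q) * ennreal (indicator {0..} s * s powr (q - 1) * exp (- (X x * s))) \<partial>lborel)"
      using Gq by (intro nn_integral_cong) (auto simp: f_def ennreal_mult[symmetric])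
    also have "\<dots> = ennreal (1 / Gamma q) * ennreal (Gamma q * X x powr (- q))"
      using q that by (subst nn_integral_cmult) (auto simp: nn_integral_Gamma_scaled)
    finally show ?thesis using that Gq by (simp add: ennreal_mult[symmetric] inv_powr_def)
  qed
  have 2: "(\<integral>\<^sup>+x. f x s \<partial>?P) = ennreal (1 / Gamma q) * ennreal (indicator {0..} s * s powr (q - 1) * (1 + 2 * s) powr (- (q + 1 / 2)))" for s
  proof (cases "0 \<le> s")
    case True
    have "f x s = ennreal (s powr (q - 1) / Gamma q) * (\<Prod>i<p+1. ennreal (exp (- s * (x i)\<^sup>2)))" for x
    proof -
      have "exp (- (X x * s)) = (\<Prod>i<p+1. exp (- s * (x i)\<^sup>2))"
      proof -
        have "- (X x * s) = - s * X x" by simp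
        also have "\<dots> = (\<Sum>i<p+1. - s * (x i)\<^sup>2)" unfolding X_def by (rule sum_distrib_left)
        finally show ?thesis by (simp only: exp_sum finite_lessThan)
      qed
      then show ?thesis
        using True Gq by (simp add: f_def ennreal_mult[symmetric] prod_ennreal prod_nonneg del: prod.lessThan_Suc)
    qed
    then have "(\<integral>\<^sup>+x. f x s \<partial>?P) = ennreal (s powr (q - 1) / Gamma q) * (\<integral>\<^sup>+x. (\<Prod>i<p+1. ennreal (exp (- s * (x i)\<^sup>2))) \<partial>?P)"
      by (simp add: nn_integral_cmult del: prod.lessThan_Suc)
    also have "(\<integral>\<^sup>+x. (\<Prod>i<p+1. ennreal (exp (- s * (x i)\<^sup>2))) \<partial>?P) = (\<Prod>i<p+1. \<integral>\<^sup>+x. ennreal (exp (- s * x\<^sup>2)) \<partial>?S)"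
      by (rule PS.product_nn_integral_prod) auto
    also have "\<dots> = ennreal (((1 + 2 * s) powr (- 1 / 2)) ^ (p + 1))"
      using True by (subst nn_integral_exp_square_std_normal) (auto simp: ennreal_power simp flip: power_Suc)
    also have "((1 + 2 * s) powr (- 1 / 2)) ^ (p + 1) = (1 + 2 * s) powr (- (q + 1 / 2))"
      using True by (simp add: powr_realpow[symmetric] powr_powr q_def field_simps flip: power_Suc)
    finally show ?thesis using True Gq by (simp add: ennreal_mult[symmetric])
  qed (simp add: f_def)
  have "(\<integral>\<^sup>+x. inv_powr q (X x) \<partial>?P) = (\<integral>\<^sup>+x. \<integral>\<^sup>+s. f x s \<partial>lborel \<partial>?P)"
    using Xpos by (intro nn_integral_cong_AE) (auto simp: 1)
  also have "\<dots> = (\<integral>\<^sup>+s. \<integral>\<^sup>+x. f x s \<partial>?P \<partial>lborel)"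
  proof -
    interpret pair_sigma_finite ?P lborel ..
    show ?thesis by (rule Fubini'[OF fm, symmetric])
  qed
  also have "\<dots> = ennreal (1 / Gamma q) * ennreal (2 powr (- q) * Gamma q * Gamma (1 / 2) / Gamma (q + 1 / 2))"
    unfolding 2 by (subst nn_integral_cmult) (simp, simp only: nn_integral_Beta_half_line[OF q])
  also have "\<dots> = ennreal (2 powr (- q) * Gamma (1 / 2) / Gamma (q + 1 / 2))"
    using Gq by (simp add: ennreal_mult[symmetric] Gamma_real_nonneg q_def)
  finally show ?thesis by (simp add: q_def X_def add_divide_distrib add.commute del: sum.lessThan_Suc)
qed

section \<open>Upper estimate of the inverse chi-square moment and origin of the constant 3\<close>

lemma ln_one_plus_cubic_upper:
  fixes z :: real
  assumes "0 \<le> z"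
  shows "ln (1 + z) \<le> z - z\<^sup>2 / 2 + z ^ 3 / 3"
proof -
  define f where "f z = z - z\<^sup>2 / 2 + z ^ 3 / 3 - ln (1 + z)" for z :: real
  have "f 0 \<le> f z"
  proof (rule DERIV_nonneg_imp_nondecreasing[OF assms])
    fix x :: real assume x: "0 \<le> x" "x \<le> z"
    have "(f has_real_derivative (1 - x + x\<^sup>2 - 1 / (1 + x))) (at x)"
      unfolding f_def using x
      by (auto intro!: derivative_eq_intros simp: field_simps power2_eq_square power3_eq_cube)
    moreover have "1 - x + x\<^sup>2 - 1 / (1 + x) = x ^ 3 / (1 + x)"
      using x by (simp add: field_simps power2_eq_square power3_eq_cube)
    ultimately show "\<exists>y. (f has_real_derivative y) (at x) \<and> 0 \<le> y" using x by auto
  qed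
  then show ?thesis by (simp add: f_def)
qed

text \<open>The left side tends to e as \<open>x\<close> grows, which leaves some slack below 3.
  With z = 2 / x its logarithm is (1/z + 1/2) ln(1 + z). The bound ln(1 + z) \<le> z alone would
  give 1 + z/2, too large at z = 2/5; with the cubic bound the terms linear in z cancel.\<close>

lemma powr_ratio_le_3:
  fixes x :: real
  assumes "5 \<le> x"
  shows "((x + 2) / x) powr ((x + 1) / 2) \<le> 3"
proof -
  define z where "z = 2 / x"
  have z: "0 < z" "z \<le> 2 / 5" using assms by (auto simp: z_def field_simps)
  have x: "(x + 1) / 2 = 1 / z + 1 / 2" "(x + 2) / x = 1 + z"
    using assms by (auto simp: z_def field_simps)
  have "(1 / z + 1 / 2) * ln (1 + z) \<le> (1 / z + 1 / 2) * (z - z\<^sup>2 / 2 + z ^ 3 / 3)"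
    using z by (intro mult_left_mono ln_one_plus_cubic_upper) auto
  also have "\<dots> = 1 + z\<^sup>2 / 12 + z ^ 3 / 6"
    using z by (simp add: field_simps power2_eq_square power3_eq_cube)
  also have "\<dots> \<le> 1 + (2 / 5)\<^sup>2 / 12 + (2 / 5) ^ 3 / 6"
    using z by (intro add_mono divide_right_mono power_mono) auto
  also have "\<dots> \<le> 1 + 1 / 20" by (simp add: power2_eq_square power3_eq_cube)
  finally have "(1 + z) powr (1 / z + 1 / 2) \<le> exp (1 + 1 / 20 :: real)"
    using z by (simp add: powr_def)
  also have "\<dots> = exp 1 * exp (1 / 20 :: real)" by (simp only: exp_add)
  also have "\<dots> \<le> 272 / 100 * (1 + 1 / 20 + (1 / 20)\<^sup>2)"
    using e_less_272 by (intro mult_mono exp_bound) auto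
  also have "\<dots> \<le> 3" by (simp add: power2_eq_square)
  finally show ?thesis unfolding x .
qed

text \<open>Induction in steps of two, following Gamma(y + 1) = y Gamma(y); hence the two base cases
  4 and 5. Passing from p - 2 to p, the claim survives because ((p + 1) / (p - 1))^(p/2) \<le> 3,
  which is \<open>powr_ratio_le_3\<close> at x = p - 1.\<close>

lemma chi_square_moment_bound:
  fixes p :: nat
  assumes "4 \<le> p"
  shows "2 powr (- (p / 2)) * Gamma (1 / 2) / Gamma ((p + 1) / 2) \<le> (3 / (real p + 1)) powr (p / 2)"
  using assms
proof (induction p rule: less_induct)
  case (less p)
  consider "p = 4" | "p = 5" | "6 \<le> p" using less.prems by linarith
  then show ?case
  proof cases
    case 1
    have np: "x \<notin> \<int>\<^sub>\<le>\<^sub>0" if "0 < x" for x :: real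
      using that by (auto elim!: nonpos_Ints_cases)
    have "Gamma (5 / 2 :: real) = 3 / 2 * Gamma (3 / 2)" "Gamma (3 / 2 :: real) = 1 / 2 * Gamma (1 / 2)"
      using Gamma_plus1[of "3 / 2 :: real"] Gamma_plus1[of "1 / 2 :: real"] np by auto
    then have "Gamma (5 / 2 :: real) = 3 / 4 * Gamma (1 / 2)" by simp
    moreover have "Gamma (1 / 2 :: real) \<noteq> 0"
      using Gamma_real_pos[of "1 / 2"] by linarith
    ultimately have "Gamma (1 / 2) / Gamma (5 / 2 :: real) = 4 / 3" by (simp add: divide_eq_eq)
    then show ?thesis using 1 by (simp add: powr_minus power2_eq_square)
  next
    case 2
    have "Gamma (3 :: real) = 2" using Gamma_fact[of 2, where 'a=real] by simp
    moreover have "sqrt pi \<le> 2" using pi_less_4 real_sqrt_le_mono[of pi 4] by simp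
    ultimately show ?thesis using 2
      by (simp add: Gamma_one_half_real powr_divide powr_minus field_simps)
  next
    case 3
    define r where "r = p - 2"
    have 3: "p = r + 2" "4 \<le> r" using 3 by (auto simp: r_def)
    define x where "x = real r + 1"
    have x: "5 \<le> x" using 3 by (simp add: x_def)
    have np: "x / 2 \<notin> \<int>\<^sub>\<le>\<^sub>0" using x by (auto elim!: nonpos_Ints_cases)
    have G: "Gamma ((real p + 1) / 2) = x / 2 * Gamma (x / 2)"
      using Gamma_plus1[OF np] by (simp add: 3 x_def add_divide_distrib add_ac)
    have "2 powr (- (real p / 2)) = 2 powr (- (real r / 2)) / 2"
      using powr_add[of 2 "- (real r / 2)" "- 1"] by (simp add: 3 add_divide_distrib powr_minus algebra_simps)
    then have "2 powr (- (real p / 2)) * Gamma (1 / 2) / Gamma ((real p + 1) / 2)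
        = (2 powr (- (real r / 2)) * Gamma (1 / 2) / Gamma ((real r + 1) / 2)) / x"
      unfolding G by (simp add: x_def mult_ac)
    also have "\<dots> \<le> (3 / x) powr (real r / 2) / x"
      using less.IH[of r] 3 x by (intro divide_right_mono) (auto simp: x_def add_ac)
    also have "\<dots> = (3 / x) powr ((x + 1) / 2) / 3"
    proof -
      have e: "(x + 1) / 2 = real r / 2 + 1" by (simp add: x_def)
      show ?thesis unfolding e using x by (simp add: powr_add)
    qed
    also have "\<dots> \<le> (3 / x) powr ((x + 1) / 2) / ((x + 2) / x) powr ((x + 1) / 2)"
      using powr_ratio_le_3[OF x] x by (intro divide_left_mono) auto
    also have "\<dots> = (3 / (x + 2)) powr ((x + 1) / 2)"
      using x by (simp add: powr_divide)
    finally show ?thesis by (simp add: 3 x_def add_ac)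
  qed
qed

section \<open>Distance to a span\<close>

text \<open>Vectors of length \<open>l\<close> are functions on \<open>nat\<close> whose values at arguments \<open>\<ge> l\<close> are irrelevant.\<close>

definition dotp :: "nat \<Rightarrow> (nat \<Rightarrow> real) \<Rightarrow> (nat \<Rightarrow> real) \<Rightarrow> real" where
  "dotp l x y = (\<Sum>j<l. x j * y j)"

lemma dotp_commute: "dotp l x y = dotp l y x"
  by (simp add: dotp_def mult.commute)

lemma dotp_self_nonneg: "0 \<le> dotp l x x"
  by (simp add: dotp_def sum_nonneg)

lemma dotp_diff_left: "dotp l (\<lambda>j. x j - y j) z = dotp l x z - dotp l y z"
  by (simp add: dotp_def algebra_simps sum_subtractf)

lemma dotp_scale_left: "dotp l (\<lambda>j. c * x j) z = c * dotp l x z"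
  by (simp add: dotp_def sum_distrib_left mult_ac)

lemma dotp_diff_right: "dotp l z (\<lambda>j. x j - y j) = dotp l z x - dotp l z y"
  by (simp add: dotp_def algebra_simps sum_subtractf)

lemma dotp_scale_right: "dotp l z (\<lambda>j. c * x j) = c * dotp l z x"
  by (simp add: dotp_def sum_distrib_left mult_ac)

lemma dotp_sum_left: "dotp l (\<lambda>j. \<Sum>a\<in>A. f a j) z = (\<Sum>a\<in>A. dotp l (f a) z)"
  unfolding dotp_def by (simp add: sum_distrib_right) (rule sum.swap)

lemma dotp_lincomb_left: "dotp l (\<lambda>j. \<Sum>a\<in>A. c a * r a j) z = (\<Sum>a\<in>A. c a * dotp l (r a) z)"
  by (simp add: dotp_sum_left dotp_scale_left)

lemma dotp_lincomb_right: "dotp l z (\<lambda>j. \<Sum>a\<in>A. c a * r a j) = (\<Sum>a\<in>A. c a * dotp l z (r a))"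
  using dotp_lincomb_left[of l c r A z] by (simp add: dotp_commute)

lemma dotp_self_zero_imp:
  assumes "dotp l x x = 0"
  shows "dotp l x y = 0"
proof -
  have "\<forall>j\<in>{..<l}. x j * x j = 0"
    using assms unfolding dotp_def by (subst (asm) sum_nonneg_eq_0_iff) auto
  then show ?thesis by (auto simp: dotp_def)
qed

text \<open>The vectors \<open>w a\<close>, padded with zero rows to a square matrix, give a
  singular matrix because at least one row is zero. A normalised kernel vector is the
  witness.\<close>

lemma exists_unit_orthogonal:
  fixes w :: "'i \<Rightarrow> nat \<Rightarrow> real"
  assumes A: "finite A" "card A < l"
  shows "\<exists>v. dotp l v v = 1 \<and> (\<forall>a\<in>A. dotp l (w a) v = 0)"
proof -
  obtain h where h: "bij_betw h {..<card A} A"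
    using ex_bij_betw_nat_finite[OF A(1)] by (auto simp: atLeast0LessThan)
  define W where "W = Matrix.mat l l (\<lambda>(i, j). if i < card A then w (h i) j else 0)"
  have W: "W \<in> carrier_mat l l" by (simp add: W_def)
  have "det W = 0"
  proof -
    have "det W = (\<Sum>j<l. W $$ (card A, j) * cofactor W (card A) j)"
      using A(2) by (rule laplace_expansion_row[OF W])
    also have "\<dots> = 0" using A(2) by (simp add: W_def)
    finally show ?thesis .
  qed
  then obtain v where v: "v \<in> carrier_vec l" "v \<noteq> 0\<^sub>v l" "W *\<^sub>v v = 0\<^sub>v l"
    using det_0_iff_vec_prod_zero[OF W] by auto
  define f where "f j = vec_index v j" for j
  have ne: "dotp l f f \<noteq> 0"
  proof
    assume "dotp l f f = 0"
    then have "\<forall>j\<in>{..<l}. f j * f j = 0"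
      unfolding dotp_def by (subst (asm) sum_nonneg_eq_0_iff) auto
    then have "v = 0\<^sub>v l" using v(1) by (intro eq_vecI) (auto simp: f_def)
    with v(2) show False by simp
  qed
  with dotp_self_nonneg[of l f] have pos: "0 < dotp l f f" by simp
  have orth: "dotp l (w a) f = 0" if "a \<in> A" for a
  proof -
    have "a \<in> h ` {..<card A}" using bij_betw_imp_surj_on[OF h] that by simp
    then obtain i where i: "i < card A" "a = h i" by auto
    have "vec_index (W *\<^sub>v v) i = 0" using v(3) i A(2) by simp
    moreover have "vec_index (W *\<^sub>v v) i = dotp l (w a) f"
      using i A(2) v(1) W by (auto simp: scalar_prod_def dotp_def f_def W_def atLeast0LessThan intro!: sum.cong)
    ultimately show ?thesis by simp
  qed
  define c where "c = 1 / sqrt (dotp l f f)"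
  have "c * (c * dotp l f f) = 1" using pos by (simp add: c_def field_simps)
  then have "dotp l (\<lambda>j. c * f j) (\<lambda>j. c * f j) = 1"
    by (simp add: dotp_scale_left dotp_scale_right)
  moreover have "dotp l (w a) (\<lambda>j. c * f j) = 0" if "a \<in> A" for a
    using orth[OF that] by (simp add: dotp_scale_right)
  ultimately show ?thesis by (intro exI[of _ "\<lambda>j. c * f j"]) auto
qed

text \<open>Unit vectors are appended one at a time, each orthogonal to the \<open>r a\<close> and
  to the vectors already found; the sum type lists both families as one.\<close>

lemma exists_orthonormal_complement:
  fixes r :: "'i \<Rightarrow> nat \<Rightarrow> real"
  assumes A: "finite A" and "card A + d \<le> l"
  shows "\<exists>q. (\<forall>i<d. \<forall>j<d. dotp l (q i) (q j) = of_bool (i = j)) \<and> (\<forall>i<d. \<forall>a\<in>A. dotp l (r a) (q i) = 0)"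
  using assms(2)
proof (induction d)
  case (Suc d)
  then have "card A + d \<le> l" by simp
  from Suc.IH[OF this] obtain q
    where q: "\<forall>i<d. \<forall>j<d. dotp l (q i) (q j) = of_bool (i = j)"
      "\<forall>i<d. \<forall>a\<in>A. dotp l (r a) (q i) = 0"
    by blast
  let ?B = "Inl ` A \<union> Inr ` {..<d} :: ('i + nat) set"
  have fin: "finite ?B" using A by auto
  have "card ?B \<le> card A + d"
    by (rule order_trans[OF card_Un_le]) (auto intro!: add_mono simp: card_image)
  with Suc.prems have card: "card ?B < l" by simp
  obtain v where v: "dotp l v v = 1" "\<And>b. b \<in> ?B \<Longrightarrow> dotp l (case_sum r q b) v = 0"
    using exists_unit_orthogonal[OF fin card, of "case_sum r q"] by blast
  have vr: "dotp l (r a) v = 0" if "a \<in> A" for a using v(2)[of "Inl a"] that by auto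
  have vq: "dotp l (q i) v = 0" "dotp l v (q i) = 0" if "i < d" for i
    using v(2)[of "Inr i"] that by (auto simp: dotp_commute[of l v "q i"])
  define q' where "q' i = (if i = d then v else q i)" for i
  have "dotp l (q' i) (q' j) = of_bool (i = j)" if "i < Suc d" "j < Suc d" for i j
  proof (cases "i = d"; cases "j = d")
    assume "i \<noteq> d" "j \<noteq> d"
    then show ?thesis using that q(1) by (simp add: q'_def)
  qed (use that vq v(1) in \<open>simp_all add: q'_def\<close>)
  moreover have "dotp l (r a) (q' i) = 0" if "i < Suc d" "a \<in> A" for i a
    using that q(2) vr[of a] by (auto simp: q'_def less_Suc_eq)
  ultimately show ?case by blast
qed simp

text \<open>A Gram-Schmidt step: the residuals of \<open>x\<close> and of the new vector
  \<open>r b\<close> with respect to \<open>A\<close> are formed, and the first is made orthogonal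
  to the second. The vectors may be linearly dependent, since the rows to which this is applied are
  random.\<close>

lemma exists_orthogonal_projection:
  fixes r :: "'i \<Rightarrow> nat \<Rightarrow> real"
  assumes "finite A"
  shows "\<exists>c. \<forall>a\<in>A. dotp l (\<lambda>j. x j - (\<Sum>b\<in>A. c b * r b j)) (r a) = 0"
  using assms
proof (induction A arbitrary: x rule: finite_induct)
  case (insert b A)
  obtain c where c: "\<And>a. a \<in> A \<Longrightarrow> dotp l (\<lambda>j. x j - (\<Sum>b\<in>A. c b * r b j)) (r a) = 0"
    using insert.IH[of x] by auto
  obtain d where d: "\<And>a. a \<in> A \<Longrightarrow> dotp l (\<lambda>j. r b j - (\<Sum>b\<in>A. d b * r b j)) (r a) = 0"
    using insert.IH[of "r b"] by auto
  define x' where "x' j = x j - (\<Sum>b\<in>A. c b * r b j)" for j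
  define r' where "r' j = r b j - (\<Sum>b\<in>A. d b * r b j)" for j
  \<comment> \<open>If \<open>r b\<close> already lies in the span of the others, then
    \<open>r'\<close> has norm zero and division by zero gives \<open>k = 0\<close>. This is the
    right value, because \<open>dotp l x' r'\<close> vanishes as well.\<close>
  define k where "k = dotp l x' r' / dotp l r' r'"
  have x': "dotp l x' (r a) = 0" and r': "dotp l r' (r a) = 0" if "a \<in> A" for a
    using c d that by (simp_all add: x'_def[abs_def] r'_def[abs_def])
  have rb: "dotp l y (r b) = dotp l y r'" if "\<And>a. a \<in> A \<Longrightarrow> dotp l y (r a) = 0" for y
  proof -
    have "dotp l y r' = dotp l y (r b) - (\<Sum>a\<in>A. d a * dotp l y (r a))"
      by (simp add: r'_def[abs_def] dotp_diff_right dotp_lincomb_right)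
    also have "(\<Sum>a\<in>A. d a * dotp l y (r a)) = 0"
      using that by (intro sum.neutral) simp
    finally show ?thesis by simp
  qed
  define e where "e = (\<lambda>a. if a = b then k else c a - k * d a)"
  have eq: "x j - (\<Sum>a\<in>insert b A. e a * r a j) = x' j - k * r' j" for j
  proof -
    have "(\<Sum>a\<in>A. e a * r a j) = (\<Sum>a\<in>A. c a * r a j - k * (d a * r a j))"
      using insert.hyps by (intro sum.cong) (auto simp: e_def algebra_simps)
    also have "\<dots> = (\<Sum>a\<in>A. c a * r a j) - k * (\<Sum>a\<in>A. d a * r a j)"
      by (simp add: sum_subtractf sum_distrib_left)
    finally show ?thesis using insert.hyps by (simp add: e_def x'_def r'_def algebra_simps)
  qed
  have "dotp l (\<lambda>j. x' j - k * r' j) (r a) = 0" if "a \<in> insert b A" for a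
  proof (cases "a \<in> A")
    case True
    then show ?thesis by (simp add: dotp_diff_left dotp_scale_left x' r')
  next
    case False
    with that have "a = b" by simp
    moreover have "dotp l x' r' - k * dotp l r' r' = 0"
      using dotp_self_zero_imp[of l r' x'] by (auto simp: k_def dotp_commute[of l x' r'])
    ultimately show ?thesis by (simp add: dotp_diff_left dotp_scale_left rb x' r')
  qed
  then show ?case by (intro exI[of _ e]) (simp add: eq)
qed simp

lemma bessel_inequality:
  fixes d :: nat
  assumes q: "\<And>i j. i < d \<Longrightarrow> j < d \<Longrightarrow> dotp l (q i) (q j) = of_bool (i = j)"
  shows "(\<Sum>i<d. (dotp l (q i) x)\<^sup>2) \<le> dotp l x x"
proof -
  define y where "y j = (\<Sum>i<d. dotp l (q i) x * q i j)" for j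
  have yz: "dotp l y z = (\<Sum>i<d. dotp l (q i) x * dotp l (q i) z)" for z
    unfolding y_def[abs_def] by (rule dotp_lincomb_left)
  have qy: "dotp l (q i) y = dotp l (q i) x" if "i < d" for i
  proof -
    have "dotp l y (q i) = (\<Sum>j<d. if i = j then dotp l (q j) x else 0)"
      unfolding yz using that by (intro sum.cong) (auto simp: q)
    then show ?thesis using that by (simp add: dotp_commute[of l "q i" y])
  qed
  have yy: "dotp l y y = (\<Sum>i<d. (dotp l (q i) x)\<^sup>2)" "dotp l y x = (\<Sum>i<d. (dotp l (q i) x)\<^sup>2)"
    by (auto simp: yz qy power2_eq_square)
  have "0 \<le> dotp l (\<lambda>j. x j - y j) (\<lambda>j. x j - y j)" by (rule dotp_self_nonneg)
  also have "\<dots> = dotp l x x - 2 * dotp l y x + dotp l y y"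
    by (simp add: dotp_diff_left dotp_diff_right dotp_commute[of l x y])
  finally show ?thesis using yy by simp
qed

text \<open>The squared distance of \<open>x\<close> to the span of the vectors \<open>r a\<close>. The infimum ranges over
  rational coefficients only, so that the distance is visibly a measurable function of all entries.\<close>

definition span_dist2 :: "nat \<Rightarrow> 'i set \<Rightarrow> (nat \<Rightarrow> real) \<Rightarrow> ('i \<Rightarrow> nat \<Rightarrow> real) \<Rightarrow> real" where
  "span_dist2 l A x r = (INF c\<in>(\<Pi>\<^sub>E a\<in>A. \<rat>). 
     dotp l (\<lambda>j. x j - (\<Sum>a\<in>A. c a * r a j)) (\<lambda>j. x j - (\<Sum>a\<in>A. c a * r a j)))"

lemma span_dist2_bdd_below:
  "bdd_below ((\<lambda>c. dotp l (\<lambda>j. x j - (\<Sum>a\<in>A. c a * r a j)) (\<lambda>j. x j - (\<Sum>a\<in>A. c a * r a j))) ` C)"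
  by (rule bdd_belowI[of _ 0]) (auto simp: dotp_self_nonneg)

lemma PiE_Rats_nonempty: "(\<Pi>\<^sub>E a\<in>A. (\<rat> :: real set)) \<noteq> {}"
  by (metis PiE_eq_empty_iff Rats_0 empty_iff)

text \<open>Real coefficients are limits of rational ones, and the squared norm is continuous in the
  finitely many coefficients.\<close>

lemma span_dist2_le:
  fixes r :: "'i \<Rightarrow> nat \<Rightarrow> real"
  assumes A: "finite A"
  shows "span_dist2 l A x r \<le> dotp l (\<lambda>j. x j - (\<Sum>a\<in>A. c a * r a j)) (\<lambda>j. x j - (\<Sum>a\<in>A. c a * r a j))"
proof -
  have "\<exists>f. \<forall>n. f n \<in> \<rat> \<and> \<bar>f n - c a\<bar> < 1 / Suc n" for a
  proof (rule choice, rule allI)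
    fix n
    obtain s where "s \<in> \<rat>" "c a - 1 / Suc n < s" "s < c a + 1 / Suc n"
      using Rats_dense_in_real[of "c a - 1 / Suc n" "c a + 1 / Suc n"] 
      by (auto simp del: of_nat_Suc simp: add_strict_mono field_simps)
    then show "\<exists>s. s \<in> \<rat> \<and> \<bar>s - c a\<bar> < 1 / Suc n" by (intro exI[of _ s]) auto
  qed
  then obtain f where f: "\<And>a n. f a n \<in> \<rat>" "\<And>a n. \<bar>f a n - c a\<bar> < 1 / Suc n" by metis
  have lim: "(\<lambda>n. f a n) \<longlonglongrightarrow> c a" for a
  proof (rule LIM_zero_cancel, rule Lim_null_comparison)
    show "\<forall>\<^sub>F n in sequentially. norm (f a n - c a) \<le> 1 / Suc n" using f(2) by (auto simp: less_imp_le)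
    show "(\<lambda>n. 1 / real (Suc n)) \<longlonglongrightarrow> 0" using LIMSEQ_inverse_real_of_nat by (simp add: inverse_eq_divide)
  qed
  let ?D = "\<lambda>c. dotp l (\<lambda>j. x j - (\<Sum>a\<in>A. c a * r a j)) (\<lambda>j. x j - (\<Sum>a\<in>A. c a * r a j))"
  have "(\<lambda>n. ?D (\<lambda>a. f a n)) \<longlonglongrightarrow> ?D c"
    unfolding dotp_def by (intro tendsto_intros lim)
  moreover have "span_dist2 l A x r \<le> ?D (\<lambda>a. f a n)" for n
  proof -
    have "span_dist2 l A x r \<le> ?D (\<lambda>a\<in>A. f a n)"
      unfolding span_dist2_def by (rule cINF_lower[OF span_dist2_bdd_below]) (auto simp: f(1))
    then show ?thesis by (simp cong: sum.cong)
  qed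
  ultimately show ?thesis by (intro LIMSEQ_le_const) auto
qed

text \<open>Subtracting a combination of the \<open>r a\<close> does not change the coordinates
  along the \<open>q i\<close>, so Bessel's inequality bounds every candidate in the infimum from
  below.\<close>

lemma span_dist2_ge:
  fixes d :: nat
  assumes q: "\<And>i j. i < d \<Longrightarrow> j < d \<Longrightarrow> dotp l (q i) (q j) = of_bool (i = j)"
    and r: "\<And>i a. i < d \<Longrightarrow> a \<in> A \<Longrightarrow> dotp l (r a) (q i) = 0"
  shows "(\<Sum>i<d. (dotp l (q i) x)\<^sup>2) \<le> span_dist2 l A x r"
  unfolding span_dist2_def
proof (rule cINF_greatest[OF PiE_Rats_nonempty])
  fix c
  let ?y = "\<lambda>j. x j - (\<Sum>a\<in>A. c a * r a j)"
  have "dotp l (q i) ?y = dotp l (q i) x" if "i < d" for i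
    using r[OF that] by (simp add: dotp_diff_right dotp_lincomb_right dotp_commute[of l "q i" "r _"])
  then have "(\<Sum>i<d. (dotp l (q i) x)\<^sup>2) = (\<Sum>i<d. (dotp l (q i) ?y)\<^sup>2)" by simp
  also have "\<dots> \<le> dotp l ?y ?y" by (rule bessel_inequality[OF q])
  finally show "(\<Sum>i<d. (dotp l (q i) x)\<^sup>2) \<le> dotp l ?y ?y" .
qed

text \<open>The witness is the residual \<open>h\<close> of \<open>x\<close> after projection onto
  the span, divided by its squared norm. Since \<open>h\<close> is orthogonal to the span, its
  product with \<open>x\<close> equals its squared norm, which is at least
  \<open>span_dist2 l A x r\<close>.\<close>

lemma exists_dual_vector:
  fixes r :: "'i \<Rightarrow> nat \<Rightarrow> real"
  assumes A: "finite A" and D: "0 < span_dist2 l A x r"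
  shows "\<exists>g. dotp l g x = 1 \<and> (\<forall>a\<in>A. dotp l g (r a) = 0) \<and> dotp l g g \<le> 1 / span_dist2 l A x r"
proof -
  obtain c where c: "\<And>a. a \<in> A \<Longrightarrow> dotp l (\<lambda>j. x j - (\<Sum>b\<in>A. c b * r b j)) (r a) = 0"
    using exists_orthogonal_projection[OF A, of l x r] by blast
  define h where "h j = x j - (\<Sum>b\<in>A. c b * r b j)" for j
  have hr: "dotp l h (r a) = 0" if "a \<in> A" for a using c[OF that] by (simp add: h_def[abs_def])
  have le: "span_dist2 l A x r \<le> dotp l h h"
    unfolding h_def[abs_def] by (rule span_dist2_le[OF A])
  have "dotp l h h = dotp l h (\<lambda>j. x j - (\<Sum>b\<in>A. c b * r b j))" by (simp add: h_def[abs_def])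
  also have "\<dots> = dotp l h x" by (simp add: dotp_diff_right dotp_lincomb_right hr)
  finally have hx: "dotp l h x = dotp l h h" ..
  define k where "k = 1 / dotp l h h"
  have k: "k * dotp l h h = 1" using D le by (simp add: k_def)
  have "dotp l (\<lambda>j. k * h j) (\<lambda>j. k * h j) = k * (k * dotp l h h)"
    by (simp add: dotp_scale_left dotp_scale_right)
  also have "\<dots> = k" by (simp add: k)
  also have "\<dots> \<le> 1 / span_dist2 l A x r" using le D by (simp add: k_def frac_le)
  finally show ?thesis
    by (intro exI[of _ "\<lambda>j. k * h j"]) (simp add: dotp_scale_left hx k hr)
qed

lemma borel_measurable_span_dist2 [measurable (raw)]:
  fixes r :: "'i \<Rightarrow> nat \<Rightarrow> 'w \<Rightarrow> real"
  assumes A: "finite A"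
    and [measurable]: "\<And>j. j < l \<Longrightarrow> x j \<in> borel_measurable M"
      "\<And>a j. a \<in> A \<Longrightarrow> j < l \<Longrightarrow> r a j \<in> borel_measurable M"
  shows "(\<lambda>\<omega>. span_dist2 l A (\<lambda>j. x j \<omega>) (\<lambda>a j. r a j \<omega>)) \<in> borel_measurable M"
  unfolding span_dist2_def
proof (rule borel_measurable_cINF)
  show "countable (\<Pi>\<^sub>E a\<in>A. (\<rat> :: real set))" using A by (intro countable_PiE) (auto simp: countable_rat)
  show "(\<lambda>\<omega>. dotp l (\<lambda>j. x j \<omega> - (\<Sum>a\<in>A. c a * r a j \<omega>)) (\<lambda>j. x j \<omega> - (\<Sum>a\<in>A. c a * r a j \<omega>))) \<in> borel_measurable M" for c
    unfolding dotp_def by measurable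
qed (rule span_dist2_bdd_below)

section \<open>Distance of a Gaussian vector to a span\<close>

lemma integral_iexp_PiM_std_normal:
  fixes l :: nat
  shows "(\<integral>x. iexp (\<Sum>j<l. s j * x j) \<partial>(\<Pi>\<^sub>M j\<in>{..<l}. std_normal_distribution))
    = complex_of_real (exp (- (\<Sum>j<l. (s j)\<^sup>2) / 2))"
proof -
  let ?S = "std_normal_distribution"
  interpret S: prob_space ?S by (rule prob_space_std_normal)
  interpret PS: product_prob_space "\<lambda>_. ?S" "{..<l}" ..
  have "(\<integral>x. iexp (\<Sum>j<l. s j * x j) \<partial>PiM {..<l} (\<lambda>_. ?S)) = (\<integral>x. (\<Prod>j<l. iexp (s j * x j)) \<partial>PiM {..<l} (\<lambda>_. ?S))"
    by (simp add: exp_sum sum_distrib_left)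
  also have "\<dots> = (\<Prod>j<l. \<integral>x. iexp (s j * x) \<partial>?S)"
    by (rule PS.product_integral_prod) (auto intro!: S.integrable_const_bound[where B=1])
  also have "\<dots> = (\<Prod>j<l. complex_of_real (exp (- (s j)\<^sup>2 / 2)))"
    using char_std_normal_distribution by (simp add: char_def fun_eq_iff)
  also have "\<dots> = complex_of_real (exp (- (\<Sum>j<l. (s j)\<^sup>2) / 2))"
    by (simp add: exp_sum sum_divide_distrib sum_negf[symmetric])
  finally show ?thesis .
qed

text \<open>Rotation invariance of the standard Gaussian law, by characteristic functions:
  orthonormality gives the combination of the \<open>q i\<close> with coefficients
  \<open>t i\<close> the same norm as \<open>t\<close>, and that norm determines both sides.\<close>

lemma distr_orthonormal_std_normal:
  fixes d l :: nat
  assumes q: "\<And>i j. i < d \<Longrightarrow> j < d \<Longrightarrow> dotp l (q i) (q j) = of_bool (i = j)"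
  shows "distr (\<Pi>\<^sub>M j\<in>{..<l}. std_normal_distribution) (\<Pi>\<^sub>M i\<in>{..<d}. borel) (\<lambda>x. \<lambda>i\<in>{..<d}. dotp l (q i) x)
    = distr (\<Pi>\<^sub>M j\<in>{..<d}. std_normal_distribution) (\<Pi>\<^sub>M i\<in>{..<d}. borel) (\<lambda>x. \<lambda>i\<in>{..<d}. x i)"
proof (rule distr_eq_if_joint_char_eq)
  show "prob_space (\<Pi>\<^sub>M j\<in>{..<l}. std_normal_distribution)" "prob_space (\<Pi>\<^sub>M j\<in>{..<d}. std_normal_distribution)"
    by (auto intro!: prob_space_PiM prob_space_std_normal)
  show "(\<lambda>x. dotp l (q i) x) \<in> borel_measurable (\<Pi>\<^sub>M j\<in>{..<l}. std_normal_distribution)" for i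
    unfolding dotp_def by measurable
  show "(\<lambda>x. x i) \<in> borel_measurable (\<Pi>\<^sub>M j\<in>{..<d}. std_normal_distribution)" if "i \<in> {..<d}" for i
    using that by measurable
  fix t :: "nat \<Rightarrow> real"
  define y where "y j = (\<Sum>i<d. t i * q i j)" for j
  have e: "(\<Sum>i<d. t i * dotp l (q i) x) = (\<Sum>j<l. y j * x j)" for x
    using dotp_lincomb_left[of l t q "{..<d}" x] by (simp add: y_def dotp_def)
  have "dotp l y y = (\<Sum>i<d. t i * (\<Sum>j<d. t j * dotp l (q i) (q j)))"
    unfolding y_def[abs_def] by (simp add: dotp_lincomb_left dotp_lincomb_right)
  also have "\<dots> = (\<Sum>i<d. t i * (\<Sum>j<d. if i = j then t j else 0))"
    by (intro sum.cong arg_cong2[where f="(*)"]) (auto simp: q)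
  also have "\<dots> = (\<Sum>i<d. (t i)\<^sup>2)"
    by (intro sum.cong) (auto simp: power2_eq_square)
  finally have "(\<Sum>j<l. (y j)\<^sup>2) = (\<Sum>i<d. (t i)\<^sup>2)" by (simp add: dotp_def power2_eq_square)
  then show "(\<integral>x. iexp (\<Sum>i<d. t i * dotp l (q i) x) \<partial>(\<Pi>\<^sub>M j\<in>{..<l}. std_normal_distribution))
    = (\<integral>x. iexp (\<Sum>i<d. t i * x i) \<partial>(\<Pi>\<^sub>M j\<in>{..<d}. std_normal_distribution))"
    unfolding e integral_iexp_PiM_std_normal by simp
qed simp

text \<open>For fixed \<open>r\<close> the orthogonal complement of the span contains p + 1
  orthonormal vectors. The squared coordinates along them sum to a chi-square variable below the
  squared distance, and \<open>inv_powr\<close> reverses the inequality.\<close>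

lemma nn_integral_span_dist2_std_normal_le:
  fixes r :: "'i \<Rightarrow> nat \<Rightarrow> real"
  assumes A: "finite A" "card A + (p + 1) \<le> l" and p: "4 \<le> p"
  shows "(\<integral>\<^sup>+x. inv_powr (p / 2) (span_dist2 l A x r) \<partial>(\<Pi>\<^sub>M j\<in>{..<l}. std_normal_distribution))
    \<le> ennreal ((3 / (real p + 1)) powr (p / 2))"
proof -
  let ?S = "std_normal_distribution"
  define d where "d = p + 1"
  obtain q where q: "\<And>i j. i < d \<Longrightarrow> j < d \<Longrightarrow> dotp l (q i) (q j) = of_bool (i = j)"
    "\<And>i a. i < d \<Longrightarrow> a \<in> A \<Longrightarrow> dotp l (r a) (q i) = 0"
    using exists_orthonormal_complement[OF A, of r] unfolding d_def by metis
  define f where "f z = inv_powr (p / 2) (\<Sum>i<d. (z i)\<^sup>2)" for z :: "nat \<Rightarrow> real"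
  have [measurable]: "f \<in> borel_measurable (\<Pi>\<^sub>M i\<in>{..<d}. borel)"
    unfolding f_def by measurable
  have [measurable]: "(\<lambda>x. \<lambda>i\<in>{..<d}. dotp l (q i) x) \<in> measurable (\<Pi>\<^sub>M j\<in>{..<l}. ?S) (\<Pi>\<^sub>M i\<in>{..<d}. borel)"
    unfolding dotp_def by measurable
  have [measurable]: "(\<lambda>x. \<lambda>i\<in>{..<d}. x i) \<in> measurable (\<Pi>\<^sub>M j\<in>{..<d}. ?S) (\<Pi>\<^sub>M i\<in>{..<d}. borel)"
    by measurable
  have f_restrict: "f (\<lambda>i\<in>{..<d}. z i) = f z" for z
    unfolding f_def by (intro arg_cong[where f="inv_powr _"] sum.cong) auto
  have "(\<integral>\<^sup>+x. inv_powr (p / 2) (span_dist2 l A x r) \<partial>(\<Pi>\<^sub>M j\<in>{..<l}. ?S))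
      \<le> (\<integral>\<^sup>+x. f (\<lambda>i\<in>{..<d}. dotp l (q i) x) \<partial>(\<Pi>\<^sub>M j\<in>{..<l}. ?S))"
    unfolding f_restrict unfolding f_def
    by (intro nn_integral_mono inv_powr_antimono span_dist2_ge q) auto
  also have "\<dots> = (\<integral>\<^sup>+z. f z \<partial>distr (\<Pi>\<^sub>M j\<in>{..<l}. ?S) (\<Pi>\<^sub>M i\<in>{..<d}. borel) (\<lambda>x. \<lambda>i\<in>{..<d}. dotp l (q i) x))"
    by (subst nn_integral_distr) auto
  also have "\<dots> = (\<integral>\<^sup>+z. f z \<partial>distr (\<Pi>\<^sub>M j\<in>{..<d}. ?S) (\<Pi>\<^sub>M i\<in>{..<d}. borel) (\<lambda>x. \<lambda>i\<in>{..<d}. x i))"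
    using distr_orthonormal_std_normal[of d l q] q(1) by simp
  also have "\<dots> = (\<integral>\<^sup>+z. f (\<lambda>i\<in>{..<d}. z i) \<partial>(\<Pi>\<^sub>M j\<in>{..<d}. ?S))"
    by (subst nn_integral_distr) auto
  also have "\<dots> = ennreal (2 powr (- (p / 2)) * Gamma (1 / 2) / Gamma ((p + 1) / 2))"
    unfolding f_restrict unfolding f_def d_def using p by (intro nn_integral_chi_square_inv_powr) simp
  also have "\<dots> \<le> ennreal ((3 / (real p + 1)) powr (p / 2))"
    by (intro ennreal_leI chi_square_moment_bound p)
  finally show ?thesis .
qed

lemma span_dist2_cong:
  assumes "\<And>j. j < l \<Longrightarrow> x j = x' j" and "\<And>a j. a \<in> A \<Longrightarrow> j < l \<Longrightarrow> r a j = r' a j"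
  shows "span_dist2 l A x r = span_dist2 l A x' r'"
proof -
  have "dotp l (\<lambda>j. x j - (\<Sum>a\<in>A. c a * r a j)) (\<lambda>j. x j - (\<Sum>a\<in>A. c a * r a j))
      = dotp l (\<lambda>j. x' j - (\<Sum>a\<in>A. c a * r' a j)) (\<lambda>j. x' j - (\<Sum>a\<in>A. c a * r' a j))" for c
    unfolding dotp_def using assms by (intro sum.cong refl) simp
  then show ?thesis by (simp add: span_dist2_def)
qed

text \<open>The hypothesis on characteristic functions says that \<open>e\<close> is a standard Gaussian vector
  independent of the \<open>r a\<close>. The joint law is identified with that on the product space, so that
  the \<open>r a\<close> may be frozen.\<close>

lemma (in prob_space) nn_integral_span_dist2_le:
  fixes r :: "'i \<Rightarrow> nat \<Rightarrow> 'a \<Rightarrow> real" and e :: "nat \<Rightarrow> 'a \<Rightarrow> real"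
  assumes A: "finite A" "card A + (p + 1) \<le> l" and p: "4 \<le> p"
    and em: "\<And>j. j < l \<Longrightarrow> e j \<in> borel_measurable M"
    and rm: "\<And>a j. a \<in> A \<Longrightarrow> j < l \<Longrightarrow> r a j \<in> borel_measurable M"
    and char: "\<And>s t. (\<integral>\<omega>. iexp ((\<Sum>j<l. s j * e j \<omega>) + (\<Sum>a\<in>A. \<Sum>j<l. t a j * r a j \<omega>)) \<partial>M)
      = complex_of_real (exp (- (\<Sum>j<l. (s j)\<^sup>2) / 2)) * (\<integral>\<omega>. iexp (\<Sum>a\<in>A. \<Sum>j<l. t a j * r a j \<omega>) \<partial>M)"
  shows "(\<integral>\<^sup>+\<omega>. inv_powr (p / 2) (span_dist2 l A (\<lambda>j. e j \<omega>) (\<lambda>a j. r a j \<omega>)) \<partial>M)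
    \<le> ennreal ((3 / (real p + 1)) powr (p / 2))"
proof -
  let ?P = "\<Pi>\<^sub>M j\<in>{..<l}. std_normal_distribution"
  interpret P: prob_space ?P by (intro prob_space_PiM prob_space_std_normal)
  interpret PM: pair_prob_space ?P M ..
  \<comment> \<open>One index set for all real coordinates: \<open>Inl\<close> for those of
    \<open>e\<close>, \<open>Inr\<close> for those of the \<open>r a\<close>. On the product space,
    \<open>Y\<close> keeps the given \<open>r a\<close> and replaces \<open>e\<close> by an
    independent standard Gaussian vector.\<close>
  define I where "I = {..<l} <+> (A \<times> {..<l})"
  have I: "finite I" using A by (auto simp: I_def)
  define X where "X i \<omega> = (case i of Inl j \<Rightarrow> e j \<omega> | Inr (a, j) \<Rightarrow> r a j \<omega>)" for i \<omega>
  define Y where "Y i z = (case i of Inl j \<Rightarrow> fst z j | Inr (a, j) \<Rightarrow> r a j (snd z))" for i and z :: "(nat \<Rightarrow> real) \<times> 'a"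
  have Xm: "X i \<in> borel_measurable M" if "i \<in> I" for i
    using that em rm by (auto simp: I_def X_def[abs_def] Plus_def)
  have Ym: "Y i \<in> borel_measurable (?P \<Otimes>\<^sub>M M)" if "i \<in> I" for i
  proof (cases i)
    case (Inl j)
    then have "j < l" using that by (auto simp: I_def)
    then show ?thesis using Inl unfolding Y_def[abs_def] by simp
  next
    case (Inr b)
    then obtain a j where b: "b = (a, j)" "a \<in> A" "j < l" using \<open>i \<in> I\<close> by (cases b) (auto simp: I_def)
    note [measurable] = rm[OF b(2,3)]
    show ?thesis unfolding Y_def[abs_def] Inr b(1) by simp
  qed
  have sumI: "(\<Sum>i\<in>I. t i * Z i) = (\<Sum>j<l. t (Inl j) * Z (Inl j)) + (\<Sum>a\<in>A. \<Sum>j<l. t (Inr (a, j)) * Z (Inr (a, j)))" for t Z :: "nat + 'i \<times> nat \<Rightarrow> real"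
    unfolding I_def using A(1) by (simp add: sum.Plus sum.cartesian_product case_prod_beta)
  have "(\<integral>\<omega>. iexp (\<Sum>i\<in>I. t i * X i \<omega>) \<partial>M) = (\<integral>z. iexp (\<Sum>i\<in>I. t i * Y i z) \<partial>(?P \<Otimes>\<^sub>M M))" for t
  proof -
    define f where "f x = iexp (\<Sum>j<l. t (Inl j) * x j)" for x :: "nat \<Rightarrow> real"
    define g where "g \<omega> = iexp (\<Sum>a\<in>A. \<Sum>j<l. t (Inr (a, j)) * r a j \<omega>)" for \<omega>
    have fm[measurable]: "f \<in> borel_measurable ?P" unfolding f_def by measurable
    have gm[measurable]: "g \<in> borel_measurable M" unfolding g_def using rm by measurable
    have "(\<integral>z. iexp (\<Sum>i\<in>I. t i * Y i z) \<partial>(?P \<Otimes>\<^sub>M M)) = (\<integral>z. f (fst z) * g (snd z) \<partial>(?P \<Otimes>\<^sub>M M))"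
      unfolding sumI by (simp add: Y_def f_def g_def exp_add distrib_left)
    also have "\<dots> = (\<integral>x. \<integral>\<omega>. f x * g \<omega> \<partial>M \<partial>?P)"
    proof -
      have "integrable (?P \<Otimes>\<^sub>M M) (\<lambda>(x, \<omega>). f x * g \<omega>)"
      proof (rule PM.P.integrable_const_bound[where B=1])
        have "norm (f x) = 1" "norm (g \<omega>) = 1" for x \<omega> by (simp_all only: f_def g_def norm_exp_i_times)
        then show "AE z in ?P \<Otimes>\<^sub>M M. norm (case z of (x, \<omega>) \<Rightarrow> f x * g \<omega>) \<le> 1"
          by (intro AE_I2) (simp add: norm_mult case_prod_beta)
      qed measurable
      from PM.integral_fst'[OF this] show ?thesis by (simp add: case_prod_beta')
    qed
    also have "\<dots> = (\<integral>x. f x \<partial>?P) * (\<integral>\<omega>. g \<omega> \<partial>M)" by simp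
    also have "(\<integral>x. f x \<partial>?P) = complex_of_real (exp (- (\<Sum>j<l. (t (Inl j))\<^sup>2) / 2))"
      unfolding f_def by (rule integral_iexp_PiM_std_normal)
    also have "\<dots> * (\<integral>\<omega>. g \<omega> \<partial>M) = (\<integral>\<omega>. iexp (\<Sum>i\<in>I. t i * X i \<omega>) \<partial>M)"
      unfolding sumI g_def using char[of "\<lambda>j. t (Inl j)" "\<lambda>a j. t (Inr (a, j))"] by (simp only: X_def sum.case prod.case)
    finally show ?thesis ..
  qed
  from distr_eq_if_joint_char_eq[OF I prob_space_axioms PM.P.prob_space_axioms Xm Ym this]
  have eq: "distr M (\<Pi>\<^sub>M i\<in>I. borel) (\<lambda>\<omega>. \<lambda>i\<in>I. X i \<omega>) = distr (?P \<Otimes>\<^sub>M M) (\<Pi>\<^sub>M i\<in>I. borel) (\<lambda>z. \<lambda>i\<in>I. Y i z)" .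
  have Xr[measurable]: "(\<lambda>\<omega>. \<lambda>i\<in>I. X i \<omega>) \<in> measurable M (\<Pi>\<^sub>M i\<in>I. borel)"
    using Xm by (intro measurable_restrict) auto
  have Yr[measurable]: "(\<lambda>z. \<lambda>i\<in>I. Y i z) \<in> measurable (?P \<Otimes>\<^sub>M M) (\<Pi>\<^sub>M i\<in>I. borel)"
    using Ym by (intro measurable_restrict) auto
  define F where "F z = inv_powr (p / 2) (span_dist2 l A (\<lambda>j. z (Inl j)) (\<lambda>a j. z (Inr (a, j))))" for z
  have Fm[measurable]: "F \<in> borel_measurable (\<Pi>\<^sub>M i\<in>I. borel)"
  proof -
    have "(\<lambda>z. span_dist2 l A (\<lambda>j. z (Inl j)) (\<lambda>a j. z (Inr (a, j)))) \<in> borel_measurable (\<Pi>\<^sub>M i\<in>I. borel)"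
      using A(1) by (intro borel_measurable_span_dist2 measurable_component_singleton) (auto simp: I_def)
    then show ?thesis unfolding F_def by measurable
  qed
  have F_restrict: "F (\<lambda>i\<in>I. Z i) = F Z" for Z
    unfolding F_def by (intro arg_cong[where f="inv_powr _"] span_dist2_cong) (auto simp: I_def)
  have "(\<integral>\<^sup>+\<omega>. inv_powr (p / 2) (span_dist2 l A (\<lambda>j. e j \<omega>) (\<lambda>a j. r a j \<omega>)) \<partial>M) = (\<integral>\<^sup>+\<omega>. F (\<lambda>i\<in>I. X i \<omega>) \<partial>M)"
    unfolding F_restrict by (simp add: F_def X_def)
  also have "\<dots> = (\<integral>\<^sup>+z. F z \<partial>distr M (\<Pi>\<^sub>M i\<in>I. borel) (\<lambda>\<omega>. \<lambda>i\<in>I. X i \<omega>))"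
    by (subst nn_integral_distr) auto
  also have "\<dots> = (\<integral>\<^sup>+z. F (\<lambda>i\<in>I. Y i z) \<partial>(?P \<Otimes>\<^sub>M M))"
    unfolding eq by (subst nn_integral_distr) auto
  also have "\<dots> = (\<integral>\<^sup>+\<omega>. \<integral>\<^sup>+x. F (\<lambda>i\<in>I. Y i (x, \<omega>)) \<partial>?P \<partial>M)"
    by (subst PM.nn_integral_snd[symmetric]) auto
  also have "\<dots> = (\<integral>\<^sup>+\<omega>. \<integral>\<^sup>+x. inv_powr (p / 2) (span_dist2 l A x (\<lambda>a j. r a j \<omega>)) \<partial>?P \<partial>M)"
    unfolding F_restrict by (simp add: F_def Y_def)
  also have "\<dots> \<le> (\<integral>\<^sup>+\<omega>. ennreal ((3 / (real p + 1)) powr (p / 2)) \<partial>M)"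
    by (intro nn_integral_mono nn_integral_span_dist2_std_normal_le A p)
  also have "\<dots> = ennreal ((3 / (real p + 1)) powr (p / 2))"
    by (simp add: emeasure_space_1)
  finally show ?thesis .
qed

section \<open>Gaussian matrices\<close>

definition centered_gaussian :: "'w measure \<Rightarrow> ('w \<Rightarrow> real) \<Rightarrow> real \<Rightarrow> bool" where
  "centered_gaussian M X v \<longleftrightarrow> X \<in> borel_measurable M \<and>
     (v = 0 \<and> (AE \<omega> in M. X \<omega> = 0) \<or>
      0 < v \<and> distr M borel (\<lambda>\<omega>. X \<omega> / sqrt v) = std_normal_distribution)"

text \<open>Dimensions of the random matrix are known on \<open>space M\<close> only, so rewriting a
  scalar product as an explicit sum is valid only there.\<close>

lemma gaussian_rv_cong:
  assumes eq: "\<And>\<omega>. \<omega> \<in> space M \<Longrightarrow> X \<omega> = Y \<omega>"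
  shows "gaussian_rv M X \<longleftrightarrow> gaussian_rv M Y"
proof -
  have "distr M lborel X = distr M lborel Y" by (rule distr_cong) (auto simp: eq)
  moreover have "X \<in> borel_measurable M \<longleftrightarrow> Y \<in> borel_measurable M"
    by (rule measurable_cong) (rule eq)
  moreover have "(AE \<omega> in M. X \<omega> = \<mu>) \<longleftrightarrow> (AE \<omega> in M. Y \<omega> = \<mu>)" for \<mu>
    by (rule AE_cong) (simp add: eq)
  ultimately show ?thesis by (simp add: gaussian_rv_def distributed_def)
qed

context prob_space
begin

text \<open>Needed before expectations of sums may be split. In the nondegenerate case the second
  moment is assembled from central ones through x^2 = (x - \<mu>)^2 + 2 \<mu> (x - \<mu>) +
  \<mu>^2.\<close>

lemma gaussian_rv_integrable:
  assumes "gaussian_rv M X"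
  shows "integrable M X" "integrable M (\<lambda>\<omega>. (X \<omega>)\<^sup>2)"
proof -
  have [measurable]: "X \<in> borel_measurable M" using assms by (simp add: gaussian_rv_def)
  from assms consider \<mu> where "AE \<omega> in M. X \<omega> = \<mu>"
    | \<mu> s where "0 < s" "distributed M lborel X (\<lambda>x. ennreal (normal_density \<mu> s x))"
    by (auto simp: gaussian_rv_def)
  then have "integrable M (\<lambda>\<omega>. (X \<omega>)\<^sup>2)"
  proof cases
    case 1
    then show ?thesis
      by (intro integrable_const_bound[where B="\<mu>\<^sup>2"]) auto
  next
    case 2
    have "integrable lborel (\<lambda>x. normal_density \<mu> s x * (x - \<mu>) ^ 2 + 2 * \<mu> * (normal_density \<mu> s x * (x - \<mu>) ^ 1) + \<mu>\<^sup>2 * (normal_density \<mu> s x * (x - \<mu>) ^ 0))"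
      using 2(1) by (intro Bochner_Integration.integrable_add integrable_mult_right integrable_normal_moment) auto
    also have "(\<lambda>x. normal_density \<mu> s x * (x - \<mu>) ^ 2 + 2 * \<mu> * (normal_density \<mu> s x * (x - \<mu>) ^ 1) + \<mu>\<^sup>2 * (normal_density \<mu> s x * (x - \<mu>) ^ 0))
       = (\<lambda>x. normal_density \<mu> s x * x\<^sup>2)"
      by (auto simp: fun_eq_iff power2_eq_square algebra_simps)
    finally show ?thesis
      by (subst distributed_integrable[OF 2(2), symmetric]) auto
  qed
  then show "integrable M (\<lambda>\<omega>. (X \<omega>)\<^sup>2)" "integrable M X"
    by (auto intro: square_integrable_imp_integrable)
qed

lemma gaussian_rv_centered:
  assumes X: "gaussian_rv M X" and m: "expectation X = 0" and v: "expectation (\<lambda>\<omega>. (X \<omega>)\<^sup>2) = v"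
  shows "centered_gaussian M X v"
proof -
  have Xm[measurable]: "X \<in> borel_measurable M" using assms by (simp add: gaussian_rv_def)
  from X consider \<mu> where "AE \<omega> in M. X \<omega> = \<mu>"
    | \<mu> s where "0 < s" "distributed M lborel X (\<lambda>x. ennreal (normal_density \<mu> s x))"
    by (auto simp: gaussian_rv_def)
  then show ?thesis
  proof cases
    case 1
    then have "expectation X = expectation (\<lambda>_. \<mu>)" by (intro integral_cong_AE) auto
    then have "\<mu> = 0" using m by (simp add: prob_space)
    with 1 have ae: "AE \<omega> in M. X \<omega> = 0" by simp
    then have "expectation (\<lambda>\<omega>. (X \<omega>)\<^sup>2) = expectation (\<lambda>_. 0)" by (intro integral_cong_AE) auto
    then show ?thesis using v ae by (simp add: centered_gaussian_def)
  next
    case 2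
    have mu: "\<mu> = 0" using normal_distributed_expectation[OF 2] m by simp
    have "variance X = s\<^sup>2" by (rule normal_distributed_variance[OF 2])
    then have vs: "v = s\<^sup>2" using v m by simp
    have "distributed M lborel (\<lambda>\<omega>. (X \<omega> - \<mu>) / s) std_normal_density"
      using normal_standard_normal_convert[OF 2(1), of X \<mu>] 2(2) by simp
    then have "distr M lborel (\<lambda>\<omega>. X \<omega> / s) = std_normal_distribution"
      by (simp add: mu distributed_def)
    moreover have "distr M lborel (\<lambda>\<omega>. X \<omega> / s) = distr M borel (\<lambda>\<omega>. X \<omega> / s)"
      by (rule distr_cong) auto
    ultimately show ?thesis using 2(1) by (simp add: centered_gaussian_def vs)
  qed
qed

lemma centered_gaussian_char:
  assumes "centered_gaussian M X v"
  shows "expectation (\<lambda>\<omega>. iexp (X \<omega>)) = complex_of_real (exp (- v / 2))"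
proof -
  have [measurable]: "X \<in> borel_measurable M" using assms by (simp add: centered_gaussian_def)
  consider "v = 0" "AE \<omega> in M. X \<omega> = 0" | "0 < v" "distr M borel (\<lambda>\<omega>. X \<omega> / sqrt v) = std_normal_distribution"
    using assms by (auto simp: centered_gaussian_def)
  then show ?thesis
  proof cases
    case 1
    have "expectation (\<lambda>\<omega>. iexp (X \<omega>)) = expectation (\<lambda>\<omega>. 1)"
      using 1(2) by (intro integral_cong_AE) auto
    then show ?thesis using 1(1) by (simp add: prob_space)
  next
    case 2
    have "char std_normal_distribution (sqrt v) = expectation (\<lambda>\<omega>. iexp (sqrt v * (X \<omega> / sqrt v)))"
      unfolding char_def 2(2)[symmetric] by (subst integral_distr) auto
    then show ?thesis using 2(1) by (simp add: char_std_normal_distribution)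
  qed
qed

lemma centered_gaussian_exp_square_le:
  assumes "centered_gaussian M X v" and c: "0 \<le> c" "c < 1 / 2"
  shows "(\<integral>\<^sup>+\<omega>. ennreal (exp (c * ((X \<omega>)\<^sup>2 / v))) \<partial>M) \<le> ennreal ((1 - 2 * c) powr (- 1 / 2))"
proof -
  have [measurable]: "X \<in> borel_measurable M" using assms by (simp add: centered_gaussian_def)
  consider "v = 0" | "0 < v" "distr M borel (\<lambda>\<omega>. X \<omega> / sqrt v) = std_normal_distribution"
    using assms by (auto simp: centered_gaussian_def)
  then show ?thesis
  proof cases
    case 1
    \<comment> \<open>For variance zero the quotient by \<open>v\<close> is 0 by convention, so the
      integrand is the constant 1 and the bound only has to be at least 1.\<close>
    have "1 powr (- 1 / 2) \<le> (1 - 2 * c) powr (- 1 / 2)"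
      using c by (intro powr_mono2') auto
    then show ?thesis using 1 by (simp add: emeasure_space_1)
  next
    case 2
    have "(\<integral>\<^sup>+x. ennreal (exp (c * x\<^sup>2)) \<partial>std_normal_distribution) = (\<integral>\<^sup>+\<omega>. ennreal (exp (c * ((X \<omega>)\<^sup>2 / v))) \<partial>M)"
      unfolding 2(2)[symmetric] using 2(1) by (subst nn_integral_distr) (auto simp: power_divide)
    then show ?thesis using nn_integral_exp_square_std_normal[OF c(2)] by simp
  qed
qed

end

text \<open>For the columns of the Gaussian matrix this is the covariance of the functionals with
  coefficients \<open>v\<close> and \<open>w\<close>. It is positive semi-definite but possibly
  degenerate.\<close>

definition bil :: "nat \<Rightarrow> real mat \<Rightarrow> (nat \<Rightarrow> real) \<Rightarrow> (nat \<Rightarrow> real) \<Rightarrow> real" where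
  "bil n K v w = (\<Sum>i<n. \<Sum>j<n. v i * w j * K $$ (i, j))"

lemma bil_add_left: "bil n K (\<lambda>i. v i + v' i) w = bil n K v w + bil n K v' w"
  by (simp add: bil_def algebra_simps sum.distrib)

lemma bil_add_right: "bil n K w (\<lambda>i. v i + v' i) = bil n K w v + bil n K w v'"
  by (simp add: bil_def algebra_simps sum.distrib)

lemma bil_scale_left: "bil n K (\<lambda>i. c * v i) w = c * bil n K v w"
  by (simp add: bil_def sum_distrib_left mult_ac)

lemma bil_scale_right: "bil n K w (\<lambda>i. c * v i) = c * bil n K w v"
  by (simp add: bil_def sum_distrib_left mult_ac)

lemma bil_sum_left: "bil n K (\<lambda>i. \<Sum>a\<in>A. f a i) w = (\<Sum>a\<in>A. bil n K (f a) w)"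
proof (induction A rule: infinite_finite_induct)
  case (insert x F)
  then show ?case by (simp add: bil_add_left)
qed (simp_all add: bil_def)

lemma bil_sum_right: "bil n K w (\<lambda>i. \<Sum>a\<in>A. f a i) = (\<Sum>a\<in>A. bil n K w (f a))"
proof (induction A rule: infinite_finite_induct)
  case (insert x F)
  then show ?case by (simp add: bil_add_right)
qed (simp_all add: bil_def)

section \<open>Linear functionals of the columns of a Gaussian matrix\<close>

locale gaussian_columns = prob_space M for M :: "'w measure" +
  fixes n l :: nat and \<Omega> :: "'w \<Rightarrow> real mat" and K :: "real mat"
  assumes gauss: "gaussian_random_matrix M n l \<Omega> K"
    and psd: "sym_psd_mat n K"
begin

text \<open>As \<open>j\<close> varies this is the row vector \<open>v\<^sup>*\<close>
  \<open>\<Omega>\<close>; for \<open>v\<close> a column of \<open>V\<^sub>1\<close> it is a row of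
  \<open>\<Omega>\<^sub>1\<close>.\<close>

definition lin :: "(nat \<Rightarrow> real) \<Rightarrow> nat \<Rightarrow> 'w \<Rightarrow> real" where
  "lin v j \<omega> = (\<Sum>i<n. v i * \<Omega> \<omega> $$ (i, j))"

lemma bil_commute: "bil n K v w = bil n K w v"
proof -
  have "K $$ (i, j) = K $$ (j, i)" if "i < n" "j < n" for i j
  proof -
    have K: "K \<in> carrier_mat n n" "transpose_mat K = K" using psd by (auto simp: sym_psd_mat_def)
    have "K $$ (i, j) = transpose_mat K $$ (i, j)" by (simp only: K(2))
    also have "\<dots> = K $$ (j, i)" using that K(1) by (intro index_transpose_mat(1)) auto
    finally show ?thesis .
  qed
  then have "bil n K v w = (\<Sum>i<n. \<Sum>j<n. w j * v i * K $$ (j, i))"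
    unfolding bil_def by (intro sum.cong refl) auto
  also have "\<dots> = bil n K w v" unfolding bil_def by (rule sum.swap)
  finally show ?thesis .
qed

lemma bil_self_nonneg: "0 \<le> bil n K v v"
proof -
  define x where "x = Matrix.vec n v"
  have "0 \<le> scalar_prod x (K *\<^sub>v x)" using psd by (auto simp: sym_psd_mat_def x_def)
  also have "\<dots> = bil n K v v"
    using psd by (auto simp: sym_psd_mat_def x_def bil_def scalar_prod_def atLeast0LessThan sum_distrib_left mult_ac intro!: sum.cong)
  finally show ?thesis .
qed

lemma lin_gaussian:
  assumes j: "j < l"
  shows "gaussian_rv M (lin v j)"
proof -
  have "gaussian_rv M (\<lambda>\<omega>. scalar_prod (Matrix.vec n v) (col (\<Omega> \<omega>) j))"
    using gauss j by (auto simp: gaussian_random_matrix_def multivariate_gaussian_def)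
  moreover have eq: "scalar_prod (Matrix.vec n v) (col (\<Omega> \<omega>) j) = lin v j \<omega>" if "\<omega> \<in> space M" for \<omega>
  proof -
    have "\<Omega> \<omega> \<in> carrier_mat n l" using gauss that by (auto simp: gaussian_random_matrix_def)
    then show ?thesis using j by (auto simp: scalar_prod_def lin_def atLeast0LessThan intro!: sum.cong)
  qed
  ultimately show ?thesis
    using gaussian_rv_cong[of M "\<lambda>\<omega>. scalar_prod (Matrix.vec n v) (col (\<Omega> \<omega>) j)" "lin v j"] by simp
qed

lemma lin_measurable [measurable]: "j < l \<Longrightarrow> lin v j \<in> borel_measurable M"
  using lin_gaussian[of j v] by (simp add: gaussian_rv_def)

lemma entry_lin:
  assumes "i < n"
  shows "lin (\<lambda>i'. of_bool (i' = i)) j \<omega> = \<Omega> \<omega> $$ (i, j)"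
proof -
  have "lin (\<lambda>i'. of_bool (i' = i)) j \<omega> = (\<Sum>i'<n. if i' = i then \<Omega> \<omega> $$ (i', j) else 0)"
    unfolding lin_def by (intro sum.cong) auto
  then show ?thesis using assms by simp
qed

lemma entry_integrable:
  assumes "i < n" "j < l"
  shows "integrable M (\<lambda>\<omega>. \<Omega> \<omega> $$ (i, j))" "integrable M (\<lambda>\<omega>. (\<Omega> \<omega> $$ (i, j))\<^sup>2)"
proof -
  have e: "lin (\<lambda>i'. of_bool (i' = i)) j = (\<lambda>\<omega>. \<Omega> \<omega> $$ (i, j))"
    by (simp add: fun_eq_iff entry_lin[OF assms(1)])
  show "integrable M (\<lambda>\<omega>. \<Omega> \<omega> $$ (i, j))" "integrable M (\<lambda>\<omega>. (\<Omega> \<omega> $$ (i, j))\<^sup>2)"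
    using gaussian_rv_integrable[OF lin_gaussian[OF assms(2), of "\<lambda>i'. of_bool (i' = i)"]]
    by (simp_all only: e)
qed

lemma entry_prod_integrable:
  assumes "i < n" "i' < n" "j < l"
  shows "integrable M (\<lambda>\<omega>. \<Omega> \<omega> $$ (i, j) * \<Omega> \<omega> $$ (i', j))"
proof (rule Bochner_Integration.integrable_bound)
  show "integrable M (\<lambda>\<omega>. (\<Omega> \<omega> $$ (i, j))\<^sup>2 + (\<Omega> \<omega> $$ (i', j))\<^sup>2)"
    using assms by (intro Bochner_Integration.integrable_add entry_integrable)
  show "(\<lambda>\<omega>. \<Omega> \<omega> $$ (i, j) * \<Omega> \<omega> $$ (i', j)) \<in> borel_measurable M"
    using assms by (intro borel_measurable_times borel_measurable_integrable entry_integrable)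
  show "AE \<omega> in M. norm (\<Omega> \<omega> $$ (i, j) * \<Omega> \<omega> $$ (i', j)) \<le> norm ((\<Omega> \<omega> $$ (i, j))\<^sup>2 + (\<Omega> \<omega> $$ (i', j))\<^sup>2)"
  proof (rule AE_I2)
    fix \<omega>
    have "2 * \<bar>x * y\<bar> \<le> x\<^sup>2 + y\<^sup>2" for x y :: real
      using sum_squares_bound[of "\<bar>x\<bar>" "\<bar>y\<bar>"] by (simp add: abs_mult mult.assoc)
    from this[of "\<Omega> \<omega> $$ (i, j)" "\<Omega> \<omega> $$ (i', j)"]
    show "norm (\<Omega> \<omega> $$ (i, j) * \<Omega> \<omega> $$ (i', j)) \<le> norm ((\<Omega> \<omega> $$ (i, j))\<^sup>2 + (\<Omega> \<omega> $$ (i', j))\<^sup>2)"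
      by simp
  qed
qed

text \<open>Gaussianity holds by definition, so only mean and second moment remain. Both follow from
  the entrywise mean and covariance by expanding the square, with integrability of products of
  entries justifying the exchange.\<close>

lemma lin_centered_gaussian:
  assumes j: "j < l"
  shows "centered_gaussian M (lin v j) (bil n K v v)"
proof (rule gaussian_rv_centered[OF lin_gaussian[OF j]])
  have car: "\<Omega> \<omega> \<in> carrier_mat n l" if "\<omega> \<in> space M" for \<omega>
    using gauss that by (auto simp: gaussian_random_matrix_def)
  have mean: "expectation (\<lambda>\<omega>. \<Omega> \<omega> $$ (i, j)) = 0" if "i < n" for i
  proof -
    have "expectation (\<lambda>\<omega>. \<Omega> \<omega> $$ (i, j)) = expectation (\<lambda>\<omega>. vec_index (col (\<Omega> \<omega>) j) i)"
      using that j car by (intro Bochner_Integration.integral_cong) (auto dest!: car)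
    also have "\<dots> = 0" using gauss j that by (simp add: gaussian_random_matrix_def multivariate_gaussian_def)
    finally show ?thesis .
  qed
  have cov: "expectation (\<lambda>\<omega>. \<Omega> \<omega> $$ (i, j) * \<Omega> \<omega> $$ (i', j)) = K $$ (i, i')" if "i < n" "i' < n" for i i'
  proof -
    have "expectation (\<lambda>\<omega>. \<Omega> \<omega> $$ (i, j) * \<Omega> \<omega> $$ (i', j))
      = expectation (\<lambda>\<omega>. (vec_index (col (\<Omega> \<omega>) j) i - vec_index (0\<^sub>v n) i) * (vec_index (col (\<Omega> \<omega>) j) i' - vec_index (0\<^sub>v n) i'))"
      using that j car by (intro Bochner_Integration.integral_cong) (auto dest!: car)
    also have "\<dots> = K $$ (i, i')" using gauss j that unfolding gaussian_random_matrix_def multivariate_gaussian_def by blast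
    finally show ?thesis .
  qed
  show "expectation (lin v j) = 0"
    unfolding lin_def[abs_def] using j by (simp add: entry_integrable mean)
  have "(lin v j \<omega>)\<^sup>2 = (\<Sum>i<n. \<Sum>i'<n. v i * v i' * (\<Omega> \<omega> $$ (i, j) * \<Omega> \<omega> $$ (i', j)))" for \<omega>
    unfolding lin_def power2_eq_square sum_product by (simp add: mult_ac)
  then have "expectation (\<lambda>\<omega>. (lin v j \<omega>)\<^sup>2)
      = expectation (\<lambda>\<omega>. \<Sum>i<n. \<Sum>i'<n. v i * v i' * (\<Omega> \<omega> $$ (i, j) * \<Omega> \<omega> $$ (i', j)))"
    by simp
  also have "\<dots> = (\<Sum>i<n. expectation (\<lambda>\<omega>. \<Sum>i'<n. v i * v i' * (\<Omega> \<omega> $$ (i, j) * \<Omega> \<omega> $$ (i', j))))"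
    using j by (intro Bochner_Integration.integral_sum Bochner_Integration.integrable_sum
        integrable_mult_right entry_prod_integrable) auto
  also have "\<dots> = (\<Sum>i<n. \<Sum>i'<n. expectation (\<lambda>\<omega>. v i * v i' * (\<Omega> \<omega> $$ (i, j) * \<Omega> \<omega> $$ (i', j))))"
    using j by (intro sum.cong refl Bochner_Integration.integral_sum
        integrable_mult_right entry_prod_integrable) auto
  also have "\<dots> = bil n K v v" by (simp add: cov bil_def)
  finally show "expectation (\<lambda>\<omega>. (lin v j \<omega>)\<^sup>2) = bil n K v v" .
qed

lemma indep_columns:
  assumes f: "\<And>j. j < l \<Longrightarrow> f j \<in> measurable (\<Pi>\<^sub>M i\<in>{..<n}. borel) N"
    and g: "\<And>j \<omega>. j < l \<Longrightarrow> g j \<omega> = f j (\<lambda>i\<in>{..<n}. \<Omega> \<omega> $$ (i, j))"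
  shows "indep_vars (\<lambda>_. N) g {..<l}"
proof -
  have "indep_vars (\<lambda>_. \<Pi>\<^sub>M i\<in>{..<n}. borel) (\<lambda>j \<omega>. \<lambda>i\<in>{..<n}. \<Omega> \<omega> $$ (i, j)) {..<l}"
    using gauss by (simp only: gaussian_random_matrix_def)
  then have "indep_vars (\<lambda>_. N) (\<lambda>j \<omega>. f j (\<lambda>i\<in>{..<n}. \<Omega> \<omega> $$ (i, j))) {..<l}"
    by (rule indep_vars_compose2) (use f in auto)
  moreover have "indep_vars (\<lambda>_. N) g {..<l} = indep_vars (\<lambda>_. N) (\<lambda>j \<omega>. f j (\<lambda>i\<in>{..<n}. \<Omega> \<omega> $$ (i, j))) {..<l}"
    by (rule indep_vars_cong) (use g in auto)
  ultimately show ?thesis by simp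
qed

lemma lin_add: "lin (\<lambda>i. v i + w i) j \<omega> = lin v j \<omega> + lin w j \<omega>"
  by (simp add: lin_def algebra_simps sum.distrib)

lemma lin_scale: "lin (\<lambda>i. c * v i) j \<omega> = c * lin v j \<omega>"
  by (simp add: lin_def sum_distrib_left mult_ac)

lemma lin_sum: "lin (\<lambda>i. \<Sum>a\<in>A. f a i) j \<omega> = (\<Sum>a\<in>A. lin (f a) j \<omega>)"
  unfolding lin_def by (simp add: sum_distrib_right) (rule sum.swap)

text \<open>A separate direction \<open>v j\<close> for each column covers every linear functional
  of the whole matrix, so this is the joint characteristic function of all entries. Independence of
  the columns turns it into a product.\<close>

lemma joint_char:
  "expectation (\<lambda>\<omega>. iexp (\<Sum>j<l. lin (v j) j \<omega>)) = complex_of_real (exp (- (\<Sum>j<l. bil n K (v j) (v j)) / 2))"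
proof -
  have "expectation (\<lambda>\<omega>. iexp (\<Sum>j<l. lin (v j) j \<omega>)) = expectation (\<lambda>\<omega>. \<Prod>j<l. iexp (lin (v j) j \<omega>))"
    by (simp add: exp_sum sum_distrib_left)
  also have "\<dots> = (\<Prod>j<l. expectation (\<lambda>\<omega>. iexp (lin (v j) j \<omega>)))"
  proof (rule indep_vars_lebesgue_integral)
    show "indep_vars (\<lambda>_. borel) (\<lambda>j \<omega>. iexp (lin (v j) j \<omega>)) {..<l}"
    proof (rule indep_columns[where f="\<lambda>j x. iexp (\<Sum>i<n. v j i * x i)"])
      show "iexp (lin (v j) j \<omega>) = iexp (\<Sum>i<n. v j i * (\<lambda>i\<in>{..<n}. \<Omega> \<omega> $$ (i, j)) i)" for j \<omega>
        by (simp add: lin_def)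
    qed measurable
    show "integrable M (\<lambda>\<omega>. iexp (lin (v j) j \<omega>))" if "j \<in> {..<l}" for j
      using that by (intro integrable_const_bound[where B=1]) auto
  qed simp
  also have "\<dots> = (\<Prod>j<l. complex_of_real (exp (- bil n K (v j) (v j) / 2)))"
    by (intro prod.cong refl centered_gaussian_char lin_centered_gaussian) simp
  also have "\<dots> = complex_of_real (exp (- (\<Sum>j<l. bil n K (v j) (v j)) / 2))"
    by (simp add: exp_sum sum_divide_distrib sum_negf[symmetric])
  finally show ?thesis .
qed

text \<open>For jointly Gaussian vectors uncorrelated means independent: the cross terms of the
  quadratic form vanish, so the exponential splits. The result has the shape required by
  \<open>nn_integral_span_dist2_le\<close>.\<close>

lemma joint_char_factor:
  fixes w :: "'i \<Rightarrow> nat \<Rightarrow> real"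
  assumes b: "bil n K b b = 1" "\<And>a. a \<in> A \<Longrightarrow> bil n K b (w a) = 0"
  shows "expectation (\<lambda>\<omega>. iexp ((\<Sum>j<l. s j * lin b j \<omega>) + (\<Sum>a\<in>A. \<Sum>j<l. t a j * lin (w a) j \<omega>)))
    = complex_of_real (exp (- (\<Sum>j<l. (s j)\<^sup>2) / 2))
      * expectation (\<lambda>\<omega>. iexp (\<Sum>a\<in>A. \<Sum>j<l. t a j * lin (w a) j \<omega>))"
proof -
  \<comment> \<open>For column \<open>j\<close>, the directions \<open>w a\<close> weighted with
    their frequencies merge into a single direction, as \<open>joint_char\<close> requires.\<close>
  define u where "u j i = (\<Sum>a\<in>A. t a j * w a i)" for j i
  have lu: "(\<Sum>a\<in>A. \<Sum>j<l. t a j * lin (w a) j \<omega>) = (\<Sum>j<l. lin (u j) j \<omega>)" for \<omega>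
    unfolding u_def[abs_def] lin_sum lin_scale by (rule sum.swap)
  have bu: "bil n K b (u j) = 0" "bil n K (u j) b = 0" for j
  proof -
    show "bil n K b (u j) = 0"
      unfolding u_def[abs_def] bil_sum_right bil_scale_right using b(2) by simp
    then show "bil n K (u j) b = 0" by (simp add: bil_commute[of "u j" b])
  qed
  have "expectation (\<lambda>\<omega>. iexp ((\<Sum>j<l. s j * lin b j \<omega>) + (\<Sum>a\<in>A. \<Sum>j<l. t a j * lin (w a) j \<omega>)))
    = expectation (\<lambda>\<omega>. iexp (\<Sum>j<l. lin (\<lambda>i. s j * b i + u j i) j \<omega>))"
    unfolding lu lin_add lin_scale sum.distrib ..
  also have "\<dots> = complex_of_real (exp (- (\<Sum>j<l. (s j)\<^sup>2 + bil n K (u j) (u j)) / 2))"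
    unfolding joint_char
    by (simp add: bil_add_left bil_add_right bil_scale_left bil_scale_right b(1) bu power2_eq_square)
  also have "- (\<Sum>j<l. (s j)\<^sup>2 + bil n K (u j) (u j)) / 2 = - (\<Sum>j<l. (s j)\<^sup>2) / 2 + - (\<Sum>j<l. bil n K (u j) (u j)) / 2"
    by (simp add: sum.distrib add_divide_distrib)
  also have "complex_of_real (exp \<dots>) = complex_of_real (exp (- (\<Sum>j<l. (s j)\<^sup>2) / 2)) * complex_of_real (exp (- (\<Sum>j<l. bil n K (u j) (u j)) / 2))"
    unfolding exp_add of_real_mult ..
  also have "complex_of_real (exp (- (\<Sum>j<l. bil n K (u j) (u j)) / 2)) = expectation (\<lambda>\<omega>. iexp (\<Sum>a\<in>A. \<Sum>j<l. t a j * lin (w a) j \<omega>))"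
    unfolding lu joint_char ..
  finally show ?thesis .
qed

text \<open>Jensen's inequality with weights \<open>bil n K (w i) (w i) / T\<close> reduces the exponential moment of a
  correlated Gaussian vector to that of a single Gaussian variable, without diagonalising.\<close>

lemma exp_sum_squares_le:
  fixes w :: "'i \<Rightarrow> nat \<Rightarrow> real"
  assumes J: "finite J" and j: "j < l" and c: "0 \<le> c" "c < 1 / 2"
    and T: "T = (\<Sum>i\<in>J. bil n K (w i) (w i))" "0 < T"
  shows "(\<integral>\<^sup>+\<omega>. ennreal (exp (c / T * (\<Sum>i\<in>J. (lin (w i) j \<omega>)\<^sup>2))) \<partial>M) \<le> ennreal ((1 - 2 * c) powr (- 1 / 2))"
proof -
  define v where "v i = bil n K (w i) (w i)" for i
  have v: "0 \<le> v i" for i by (simp add: v_def bil_self_nonneg)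
  have J0: "J \<noteq> {}" using T by auto
  have s1: "(\<Sum>i\<in>J. v i / T) = 1" using T by (simp add: v_def sum_divide_distrib[symmetric])
  note [measurable] = lin_measurable[OF j]
  \<comment> \<open>Dividing by the variance is harmless even when it is zero: the functional then
    vanishes almost surely and both sides are 0.\<close>
  have "AE \<omega> in M. (lin (w i) j \<omega>)\<^sup>2 = v i * ((lin (w i) j \<omega>)\<^sup>2 / v i)" for i
  proof (cases "v i = 0")
    case True
    then have "AE \<omega> in M. lin (w i) j \<omega> = 0"
      using lin_centered_gaussian[OF j, of "w i"] by (simp add: centered_gaussian_def v_def)
    then show ?thesis by (rule AE_mp) (simp add: True)
  qed simp
  then have "AE \<omega> in M. \<forall>i\<in>J. (lin (w i) j \<omega>)\<^sup>2 = v i * ((lin (w i) j \<omega>)\<^sup>2 / v i)"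
    using J by (intro AE_finite_allI) auto
  then have "AE \<omega> in M. ennreal (exp (c / T * (\<Sum>i\<in>J. (lin (w i) j \<omega>)\<^sup>2)))
      \<le> (\<Sum>i\<in>J. ennreal (v i / T) * ennreal (exp (c * ((lin (w i) j \<omega>)\<^sup>2 / v i))))"
  proof (rule AE_mp, intro AE_I2 impI)
    fix \<omega> assume *: "\<forall>i\<in>J. (lin (w i) j \<omega>)\<^sup>2 = v i * ((lin (w i) j \<omega>)\<^sup>2 / v i)"
    define y where "y i = c * ((lin (w i) j \<omega>)\<^sup>2 / v i)" for i
    have "c / T * (\<Sum>i\<in>J. (lin (w i) j \<omega>)\<^sup>2) = c / T * (\<Sum>i\<in>J. v i * ((lin (w i) j \<omega>)\<^sup>2 / v i))"
      using * by (intro arg_cong2[where f="(*)"] sum.cong) auto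
    also have "\<dots> = (\<Sum>i\<in>J. (v i / T) *\<^sub>R y i)"
      unfolding sum_distrib_left y_def by (intro sum.cong) auto
    finally have "exp (c / T * (\<Sum>i\<in>J. (lin (w i) j \<omega>)\<^sup>2)) = exp (\<Sum>i\<in>J. (v i / T) *\<^sub>R y i)" by simp
    also have "\<dots> \<le> (\<Sum>i\<in>J. (v i / T) * exp (y i))"
      using v T by (intro convex_on_sum[OF J J0 exp_convex s1]) auto
    finally have "ennreal (exp (c / T * (\<Sum>i\<in>J. (lin (w i) j \<omega>)\<^sup>2))) \<le> ennreal (\<Sum>i\<in>J. (v i / T) * exp (y i))"
      by (rule ennreal_leI)
    also have "\<dots> = (\<Sum>i\<in>J. ennreal (v i / T) * ennreal (exp (y i)))"
      using v T(2) by (subst sum_ennreal[symmetric])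
        (auto simp: ennreal_mult[symmetric] simp del: times_divide_eq_left intro!: sum.cong)
    finally show "ennreal (exp (c / T * (\<Sum>i\<in>J. (lin (w i) j \<omega>)\<^sup>2)))
      \<le> (\<Sum>i\<in>J. ennreal (v i / T) * ennreal (exp (c * ((lin (w i) j \<omega>)\<^sup>2 / v i))))"
      by (simp add: y_def)
  qed
  then have "(\<integral>\<^sup>+\<omega>. ennreal (exp (c / T * (\<Sum>i\<in>J. (lin (w i) j \<omega>)\<^sup>2))) \<partial>M)
    \<le> (\<integral>\<^sup>+\<omega>. (\<Sum>i\<in>J. ennreal (v i / T) * ennreal (exp (c * ((lin (w i) j \<omega>)\<^sup>2 / v i)))) \<partial>M)"
    by (rule nn_integral_mono_AE)
  also have "\<dots> = (\<Sum>i\<in>J. ennreal (v i / T) * (\<integral>\<^sup>+\<omega>. ennreal (exp (c * ((lin (w i) j \<omega>)\<^sup>2 / v i))) \<partial>M))"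
    by (subst nn_integral_sum) (auto simp: nn_integral_cmult)
  also have "\<dots> \<le> (\<Sum>i\<in>J. ennreal (v i / T) * ennreal ((1 - 2 * c) powr (- 1 / 2)))"
    unfolding v_def
    by (intro sum_mono mult_left_mono centered_gaussian_exp_square_le lin_centered_gaussian j c) auto
  also have "\<dots> = ennreal (\<Sum>i\<in>J. v i / T) * ennreal ((1 - 2 * c) powr (- 1 / 2))"
    unfolding sum_distrib_right[symmetric] using v T(2) by (subst sum_ennreal) auto
  finally show ?thesis by (simp add: s1)
qed

text \<open>Markov's inequality for the exponential of c / T times the sum, which factors over the
  columns, gives ((1 - 2c)^(-1/2) exp(- c u^2))^l. If T = 0 the sum vanishes almost surely and the
  strict inequality defines a null event.\<close>

lemma sum_squares_tail:
  fixes w :: "'i \<Rightarrow> nat \<Rightarrow> real" and u :: real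
  assumes J: "finite J" and u: "1 \<le> u" and T: "T = (\<Sum>i\<in>J. bil n K (w i) (w i))"
  shows "prob {\<omega> \<in> space M. u\<^sup>2 * (real l * T) < (\<Sum>j<l. \<Sum>i\<in>J. (lin (w i) j \<omega>)\<^sup>2)}
    \<le> (u * exp (- (u\<^sup>2 - 1) / 2)) ^ l"
proof (cases "T = 0")
  case True
  have z: "bil n K (w i) (w i) = 0" if "i \<in> J" for i
    using True T that J by (subst (asm) (2) eq_commute) (auto simp: sum_nonneg_eq_0_iff bil_self_nonneg)
  have "AE \<omega> in M. lin (w i) j \<omega> = 0" if "i \<in> J" "j < l" for i j
    using lin_centered_gaussian[OF that(2), of "w i"] z[OF that(1)] by (simp add: centered_gaussian_def)
  then have "AE \<omega> in M. \<forall>j\<in>{..<l}. \<forall>i\<in>J. lin (w i) j \<omega> = 0"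
    using J by (intro AE_finite_allI) auto
  then have "AE \<omega> in M. \<not> (u\<^sup>2 * (real l * T) < (\<Sum>j<l. \<Sum>i\<in>J. (lin (w i) j \<omega>)\<^sup>2))"
    by (rule AE_mp) (auto simp: True)
  then have "prob {\<omega> \<in> space M. u\<^sup>2 * (real l * T) < (\<Sum>j<l. \<Sum>i\<in>J. (lin (w i) j \<omega>)\<^sup>2)} = 0"
    by (subst prob_eq_0) auto
  then show ?thesis using u by simp
next
  case False
  have "0 \<le> T" unfolding T by (intro sum_nonneg bil_self_nonneg)
  with False have T0: "0 < T" by simp
  \<comment> \<open>The minimiser of (1 - 2c)^(-1/2) exp(- c u^2), determined by 1 - 2c = 1 / u^2.
    It is nonnegative because \<open>u\<close> is at least 1.\<close>
  define c where "c = (1 - 1 / u\<^sup>2) / 2"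
  have u2: "1 \<le> u\<^sup>2" using u by simp
  have c: "0 \<le> c" "c < 1 / 2" using u u2 by (auto simp: c_def field_simps)
  have "1 - 2 * c = u powr (- 2)" using u by (simp add: c_def powr_minus field_simps)
  then have cu: "(1 - 2 * c) powr (- 1 / 2) = u" using u by (simp add: powr_powr)
  have cu2: "c * u\<^sup>2 = (u\<^sup>2 - 1) / 2" using u by (simp add: c_def field_simps)
  define Z where "Z j \<omega> = ennreal (exp (c / T * (\<Sum>i\<in>J. (lin (w i) j \<omega>)\<^sup>2)))" for j \<omega>
  have Zm[measurable]: "Z j \<in> borel_measurable M" if "j < l" for j unfolding Z_def using that by measurable
  have "(\<integral>\<^sup>+\<omega>. (\<Prod>j<l. Z j \<omega>) \<partial>M) = (\<Prod>j<l. \<integral>\<^sup>+\<omega>. Z j \<omega> \<partial>M)"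
  proof (rule indep_vars_nn_integral)
    show "indep_vars (\<lambda>_. borel) Z {..<l}"
    proof (rule indep_columns[where f="\<lambda>j x. ennreal (exp (c / T * (\<Sum>i\<in>J. (\<Sum>i'<n. w i i' * x i')\<^sup>2)))"])
      show "Z j \<omega> = ennreal (exp (c / T * (\<Sum>i\<in>J. (\<Sum>i'<n. w i i' * (\<lambda>i\<in>{..<n}. \<Omega> \<omega> $$ (i, j)) i')\<^sup>2)))" for j \<omega>
        by (simp add: Z_def lin_def)
    qed measurable
  qed auto
  also have "\<dots> \<le> (\<Prod>j<l. ennreal u)"
    unfolding Z_def using exp_sum_squares_le[OF J _ c T T0] by (intro prod_mono_ennreal) (simp only: cu lessThan_iff)
  also have "\<dots> = ennreal (u ^ l)" using u by (simp add: ennreal_power)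
  finally have EZ: "(\<integral>\<^sup>+\<omega>. (\<Prod>j<l. Z j \<omega>) \<partial>M) \<le> ennreal (u ^ l)" .
  let ?a = "exp (- (c * u\<^sup>2 * real l))"
  let ?S = "{\<omega> \<in> space M. u\<^sup>2 * (real l * T) < (\<Sum>j<l. \<Sum>i\<in>J. (lin (w i) j \<omega>)\<^sup>2)}"
  have sub: "?S \<subseteq> {\<omega> \<in> space M. 1 \<le> ennreal ?a * (\<Prod>j<l. Z j \<omega>)}"
  proof clarsimp
    fix \<omega> assume *: "u\<^sup>2 * (real l * T) < (\<Sum>j<l. \<Sum>i\<in>J. (lin (w i) j \<omega>)\<^sup>2)"
    have "c * u\<^sup>2 * real l = c / T * (u\<^sup>2 * (real l * T))" using T0 by simp
    also have "\<dots> \<le> c / T * (\<Sum>j<l. \<Sum>i\<in>J. (lin (w i) j \<omega>)\<^sup>2)"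
      using * c T0 by (intro mult_left_mono) auto
    finally have "exp (c * u\<^sup>2 * real l) \<le> exp (c / T * (\<Sum>j<l. \<Sum>i\<in>J. (lin (w i) j \<omega>)\<^sup>2))" by simp
    also have "\<dots> = (\<Prod>j<l. exp (c / T * (\<Sum>i\<in>J. (lin (w i) j \<omega>)\<^sup>2)))"
      unfolding sum_distrib_left[of "c / T" _ "{..<l}"] by (rule exp_sum) simp
    finally have "1 \<le> ?a * (\<Prod>j<l. exp (c / T * (\<Sum>i\<in>J. (lin (w i) j \<omega>)\<^sup>2)))"
      by (simp add: exp_minus field_simps)
    then have "ennreal 1 \<le> ennreal (?a * (\<Prod>j<l. exp (c / T * (\<Sum>i\<in>J. (lin (w i) j \<omega>)\<^sup>2))))"
      by (rule ennreal_leI)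
    then show "1 \<le> ennreal ?a * (\<Prod>j<l. Z j \<omega>)"
      by (simp add: Z_def prod_ennreal ennreal_mult[symmetric] prod_nonneg)
  qed
  have "emeasure M ?S \<le> emeasure M {\<omega> \<in> space M. 1 \<le> ennreal ?a * (\<Prod>j<l. Z j \<omega>)}"
    by (rule emeasure_mono[OF sub]) measurable
  also have "\<dots> \<le> ennreal ?a * (\<integral>\<^sup>+\<omega>. (\<Prod>j<l. Z j \<omega>) * indicator (space M) \<omega> \<partial>M)"
    by (rule nn_integral_Markov_inequality) measurable
  also have "(\<integral>\<^sup>+\<omega>. (\<Prod>j<l. Z j \<omega>) * indicator (space M) \<omega> \<partial>M) = (\<integral>\<^sup>+\<omega>. (\<Prod>j<l. Z j \<omega>) \<partial>M)"
    by (intro nn_integral_cong) simp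
  also have "ennreal ?a * \<dots> \<le> ennreal ?a * ennreal (u ^ l)"
    by (intro mult_left_mono EZ) simp
  also have "\<dots> = ennreal ((u * exp (- (u\<^sup>2 - 1) / 2)) ^ l)"
  proof -
    have e: "- ((u\<^sup>2 - 1) / 2 * real l) = real l * (- (u\<^sup>2 - 1) / 2)" by (simp add: field_simps)
    have "?a = exp (- (u\<^sup>2 - 1) / 2) ^ l"
      unfolding cu2 e by (rule exp_of_nat_mult)
    then show ?thesis using u by (simp add: ennreal_mult[symmetric] power_mult_distrib mult.commute)
  qed
  finally show ?thesis using u by (simp add: emeasure_eq_measure)
qed

end

section \<open>Norm of a right inverse\<close>

context gaussian_columns
begin

text \<open>A null vector of a semi-definite form lies in its radical: the form is evaluated at
  \<open>z + e y\<close>, where the summand 1 in the denominator of \<open>e\<close> avoids a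
  separate case q = 0. This yields positive diagonal entries of the inverse Gram matrix even though
  \<open>K\<close> may be singular.\<close>

lemma bil_null_imp:
  assumes "bil n K z z = 0"
  shows "bil n K y z = 0"
proof -
  define h q e where "h = bil n K y z" and "q = bil n K y y" and "e = - h / (q + 1)"
  have q: "0 \<le> q" by (simp add: q_def bil_self_nonneg)
  have "0 \<le> bil n K (\<lambda>i. z i + e * y i) (\<lambda>i. z i + e * y i)" by (rule bil_self_nonneg)
  also have "\<dots> = 2 * e * h + e\<^sup>2 * q"
    using bil_commute[of z y]
    by (simp add: bil_add_left bil_add_right bil_scale_left bil_scale_right assms h_def q_def power2_eq_square algebra_simps)
  finally have ge: "0 \<le> 2 * e * h + e\<^sup>2 * q" .
  have h: "h = - e * (q + 1)" using q by (simp add: e_def)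
  have "2 * e * h + e\<^sup>2 * q = - (e\<^sup>2 * (q + 2))"
    unfolding h by (simp add: power2_eq_square algebra_simps)
  then have "e\<^sup>2 * (q + 2) \<le> 0" using ge by linarith
  then have "e = 0" using q by (simp add: mult_le_0_iff)
  then have "h = 0" using h by simp
  then show ?thesis by (simp add: h_def)
qed

text \<open>\<open>B\<close> is the inverse of the Gram matrix of the \<open>w a\<close> under
  \<open>K\<close>, and \<open>G\<close> is a right inverse of the random matrix with rows
  \<open>lin (w a)\<close>. The exceptional set comes from Markov's inequality for one averaged
  inverse moment, and \<open>G\<close> is then constructed pointwise outside it.\<close>

lemma pseudo_inverse_tail:
  fixes w B :: "nat \<Rightarrow> nat \<Rightarrow> real" and t :: real
  assumes k: "1 \<le> k" and l: "l = k + p" and p: "4 \<le> p" and t: "1 \<le> t"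
    and inv: "\<And>a b. a < k \<Longrightarrow> b < k \<Longrightarrow> (\<Sum>c<k. bil n K (w a) (w c) * B c b) = of_bool (a = b)"
  shows "0 < (\<Sum>a<k. B a a)"
    and "\<exists>F\<in>sets M. prob F \<le> 1 / t ^ p \<and>
      (\<forall>\<omega>\<in>space M - F. \<exists>G. (\<forall>a<k. \<forall>b<k. (\<Sum>j<l. lin (w a) j \<omega> * G j b) = of_bool (a = b)) \<and>
         (\<Sum>j<l. \<Sum>b<k. (G j b)\<^sup>2) \<le> 3 * t\<^sup>2 / (real p + 1) * (\<Sum>a<k. B a a))"
proof -
  \<comment> \<open>The basis dual to the \<open>w a\<close> under \<open>bil n K\<close>. Its
    squared lengths are the diagonal entries of \<open>B\<close>, whose sum is the trace in
    \<open>gamma_k\<close>.\<close>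
  define z where "z i m = (\<Sum>c<k. B c i * w c m)" for i m
  have wz: "bil n K (w a) (z i) = of_bool (a = i)" if "a < k" "i < k" for a i
    unfolding z_def[abs_def] bil_sum_right bil_scale_right using inv[OF that] by (simp add: mult.commute)
  have zz: "bil n K (z i) (z i) = B i i" if "i < k" for i
  proof -
    have "bil n K (z i) (z i) = (\<Sum>c<k. B c i * bil n K (w c) (z i))"
      by (subst (1) z_def[abs_def]) (simp add: bil_sum_left bil_scale_left)
    also have "\<dots> = (\<Sum>c<k. if i = c then B c i else 0)"
      using that by (intro sum.cong) (auto simp: wz)
    finally show ?thesis using that by simp
  qed
  have Bpos: "0 < B i i" if "i < k" for i
  proof -
    have "0 \<le> B i i" using zz[OF that] bil_self_nonneg[of "z i"] by simp
    moreover have "B i i \<noteq> 0"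
      using zz[OF that] bil_null_imp[of "z i" "w i"] wz[OF that that] by auto
    ultimately show ?thesis by simp
  qed
  define \<theta> where "\<theta> = (\<Sum>a<k. B a a)"
  have th: "0 < \<theta>" unfolding \<theta>_def using k Bpos by (intro sum_pos) (auto simp: lessThan_empty_iff)
  then show "0 < (\<Sum>a<k. B a a)" by (simp add: \<theta>_def)
  have s1: "(\<Sum>i<k. B i i / \<theta>) = 1" using th by (simp add: sum_divide_distrib[symmetric] \<theta>_def)
  \<comment> \<open>Normalised to variance one. \<open>lin (b i)\<close> equals
    \<open>sqrt (B i i)\<close> times \<open>lin (w i)\<close> plus a combination of the other rows,
    and is uncorrelated with each of those rows.\<close>
  define b where "b i m = 1 / sqrt (B i i) * z i m" for i m
  have bb: "bil n K (b i) (b i) = 1" if "i < k" for i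
    using Bpos[OF that] unfolding b_def[abs_def] by (simp only: bil_scale_left bil_scale_right zz[OF that]) simp
  have bw: "bil n K (b i) (w a) = 0" if "i < k" "a < k" "a \<noteq> i" for i a
    unfolding b_def[abs_def] using wz[of a i] that bil_commute[of "z i" "w a"] by (simp add: bil_scale_left del: times_divide_eq_left)
  define A where "A i = {..<k} - {i}" for i
  have A: "finite (A i)" "card (A i) + (p + 1) \<le> l" if "i < k" for i
    using that by (auto simp: A_def l)
  define D where "D i \<omega> = span_dist2 l (A i) (\<lambda>j. lin (b i) j \<omega>) (\<lambda>a j. lin (w a) j \<omega>)" for i \<omega>
  define q where "q = real p / 2"
  have q: "1 \<le> q" using p by (simp add: q_def)
  have Dm[measurable]: "D i \<in> borel_measurable M" if "i < k" for i
    unfolding D_def[abs_def] using A[OF that] by (intro borel_measurable_span_dist2) auto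
  have ED: "(\<integral>\<^sup>+\<omega>. inv_powr q (D i \<omega>) \<partial>M) \<le> ennreal ((3 / (real p + 1)) powr q)" if "i < k" for i
    unfolding D_def q_def
    by (intro nn_integral_span_dist2_le A that p lin_measurable joint_char_factor bb bw)
      (auto simp: A_def that)
  \<comment> \<open>The weights sum to one, so the mean of \<open>\<Psi>\<close> obeys the same
    bound as each single inverse moment.\<close>
  define \<Psi> where "\<Psi> \<omega> = (\<Sum>i<k. ennreal (B i i / \<theta>) * inv_powr q (D i \<omega>))" for \<omega>
  have Pm[measurable]: "\<Psi> \<in> borel_measurable M" unfolding \<Psi>_def by measurable
  have "(\<integral>\<^sup>+\<omega>. \<Psi> \<omega> \<partial>M) = (\<Sum>i<k. ennreal (B i i / \<theta>) * (\<integral>\<^sup>+\<omega>. inv_powr q (D i \<omega>) \<partial>M))"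
    unfolding \<Psi>_def by (subst nn_integral_sum) (auto simp: nn_integral_cmult)
  also have "\<dots> \<le> (\<Sum>i<k. ennreal (B i i / \<theta>) * ennreal ((3 / (real p + 1)) powr q))"
    by (intro sum_mono mult_left_mono ED) auto
  also have "\<dots> = ennreal (\<Sum>i<k. B i i / \<theta>) * ennreal ((3 / (real p + 1)) powr q)"
    unfolding sum_distrib_right[symmetric] using Bpos th by (subst sum_ennreal) (auto intro!: divide_nonneg_nonneg less_imp_le)
  finally have EP: "(\<integral>\<^sup>+\<omega>. \<Psi> \<omega> \<partial>M) \<le> ennreal ((3 / (real p + 1)) powr q)" by (simp add: s1)
  \<comment> \<open>Chosen so that Markov's inequality gives (3 / (p + 1))^(p/2) / \<tau>^(p/2) = 1
    / t^p.\<close>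
  define \<tau> where "\<tau> = 3 * t\<^sup>2 / (real p + 1)"
  have tau: "0 < \<tau>" using t by (simp add: \<tau>_def)
  define F where "F = {\<omega> \<in> space M. 1 \<le> ennreal (\<tau> powr (- q)) * \<Psi> \<omega>}"
  have Fs: "F \<in> sets M" unfolding F_def by measurable
  have "emeasure M F \<le> ennreal (\<tau> powr (- q)) * (\<integral>\<^sup>+\<omega>. \<Psi> \<omega> * indicator (space M) \<omega> \<partial>M)"
    unfolding F_def by (rule nn_integral_Markov_inequality) measurable
  also have "(\<integral>\<^sup>+\<omega>. \<Psi> \<omega> * indicator (space M) \<omega> \<partial>M) = (\<integral>\<^sup>+\<omega>. \<Psi> \<omega> \<partial>M)"
    by (intro nn_integral_cong) simp
  also have "ennreal (\<tau> powr (- q)) * \<dots> \<le> ennreal (\<tau> powr (- q)) * ennreal ((3 / (real p + 1)) powr q)"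
    by (intro mult_left_mono EP) simp
  also have "\<dots> = ennreal (1 / t ^ p)"
  proof -
    have "\<tau> powr q = t ^ p * (3 / (real p + 1)) powr q"
    proof -
      have "\<tau> = t\<^sup>2 * (3 / (real p + 1))" by (simp add: \<tau>_def)
      then have 1: "\<tau> powr q = (t\<^sup>2) powr q * (3 / (real p + 1)) powr q"
        using t powr_mult[of "t\<^sup>2" "3 / (real p + 1)" q] by simp
      have "(t\<^sup>2) powr q = (t powr 2) powr q" using t by (simp only: powr_numeral)
      also have "\<dots> = t powr real p" by (simp add: powr_powr q_def)
      also have "\<dots> = t ^ p" using t by (simp add: powr_realpow)
      finally show ?thesis using 1 by simp
    qed
    then have "\<tau> powr (- q) * (3 / (real p + 1)) powr q = 1 / t ^ p"
      using t by (simp add: powr_minus field_simps)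
    then show ?thesis by (simp add: ennreal_mult[symmetric])
  qed
  finally have PF: "prob F \<le> 1 / t ^ p" using t by (simp add: emeasure_eq_measure)
  have "\<exists>G. (\<forall>a<k. \<forall>b<k. (\<Sum>j<l. lin (w a) j \<omega> * G j b) = of_bool (a = b)) \<and>
         (\<Sum>j<l. \<Sum>b<k. (G j b)\<^sup>2) \<le> \<tau> * \<theta>" if \<omega>: "\<omega> \<in> space M - F" for \<omega>
  proof -
    have lt: "ennreal (\<tau> powr (- q)) * \<Psi> \<omega> < 1" using \<omega> by (auto simp: F_def not_le)
    \<comment> \<open>Linear dependence of the rows makes \<open>inv_powr\<close>, and with it
      \<open>\<Psi>\<close>, infinite, hence can occur only inside \<open>F\<close>.\<close>
    have Dpos: "0 < D i \<omega>" if i: "i < k" for i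
    proof (rule ccontr)
      assume "\<not> 0 < D i \<omega>"
      then have "ennreal (B i i / \<theta>) * inv_powr q (D i \<omega>) = \<infinity>"
        using Bpos[OF i] th by (simp add: inv_powr_def ennreal_mult_top)
      moreover have "ennreal (B i i / \<theta>) * inv_powr q (D i \<omega>) \<le> \<Psi> \<omega>"
        unfolding \<Psi>_def using i by (intro member_le_sum) auto
      ultimately have "\<Psi> \<omega> = \<infinity>" by (simp add: top_unique)
      then show False using lt tau by (simp add: ennreal_mult_top)
    qed
    define y where "y i = 1 / D i \<omega>" for i
    have y: "0 < y i" if "i < k" for i using Dpos[OF that] by (simp add: y_def)
    have yD: "inv_powr q (D i \<omega>) = ennreal (y i powr q)" if "i < k" for i
      using Dpos[OF that] by (simp add: inv_powr_def y_def powr_divide powr_minus_divide)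
    have "\<Psi> \<omega> = (\<Sum>i<k. ennreal (B i i / \<theta> * y i powr q))"
      unfolding \<Psi>_def using Bpos th Dpos
      by (intro sum.cong refl) (auto simp: yD ennreal_mult less_imp_le simp del: times_divide_eq_left)
    also have "\<dots> = ennreal (\<Sum>i<k. B i i / \<theta> * y i powr q)"
      using Bpos th by (intro sum_ennreal) (auto simp: less_imp_le)
    finally have Psi: "\<Psi> \<omega> = ennreal (\<Sum>i<k. B i i / \<theta> * y i powr q)" .
    have "0 \<le> (\<Sum>i<k. B i i / \<theta> * y i powr q)"
      using Bpos th by (intro sum_nonneg mult_nonneg_nonneg divide_nonneg_nonneg) (auto simp: less_imp_le)
    then have "\<tau> powr (- q) * (\<Sum>i<k. B i i / \<theta> * y i powr q) < 1"
      using lt unfolding Psi by (simp add: ennreal_mult[symmetric] del: times_divide_eq_left)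
    then have S: "(\<Sum>i<k. B i i / \<theta> * y i powr q) < \<tau> powr q"
      using tau by (simp add: powr_minus field_simps)
    \<comment> \<open>Jensen's inequality for the convex function x^q at this single outcome:
      smallness of the averaged powers passes to the weighted average of the \<open>y i\<close>
      itself.\<close>
    have "(\<Sum>i<k. (B i i / \<theta>) *\<^sub>R y i) powr q \<le> (\<Sum>i<k. B i i / \<theta> * y i powr q)"
      using k Bpos th y
      by (intro convex_on_sum[OF _ _ powr_convex[OF q] s1]) (auto simp: lessThan_empty_iff less_imp_le)
    then have "(\<Sum>i<k. (B i i / \<theta>) *\<^sub>R y i) powr q < \<tau> powr q" using S by simp
    then have "(\<Sum>i<k. (B i i / \<theta>) *\<^sub>R y i) < \<tau>"
      using powr_mono2[of q \<tau> "\<Sum>i<k. (B i i / \<theta>) *\<^sub>R y i"] q tau by linarith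
    then have "\<theta> * (\<Sum>i<k. (B i i / \<theta>) *\<^sub>R y i) \<le> \<theta> * \<tau>" using th by simp
    also have "\<theta> * (\<Sum>i<k. (B i i / \<theta>) *\<^sub>R y i) = (\<Sum>i<k. B i i * y i)"
      using th by (simp add: sum_distrib_left)
    finally have Sy: "(\<Sum>i<k. B i i * y i) \<le> \<tau> * \<theta>" by (simp add: mult.commute)
    have "\<exists>g. dotp l g (\<lambda>j. lin (b i) j \<omega>) = 1 \<and> (\<forall>a\<in>A i. dotp l g (\<lambda>j. lin (w a) j \<omega>) = 0) \<and> dotp l g g \<le> y i" if "i < k" for i
      using exists_dual_vector[OF A(1), of i l "\<lambda>j. lin (b i) j \<omega>" "\<lambda>a j. lin (w a) j \<omega>"] Dpos[OF that] that
      by (simp add: D_def y_def)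
    then obtain g where g: "\<And>i. i < k \<Longrightarrow> dotp l (g i) (\<lambda>j. lin (b i) j \<omega>) = 1"
      "\<And>i a. i < k \<Longrightarrow> a \<in> A i \<Longrightarrow> dotp l (g i) (\<lambda>j. lin (w a) j \<omega>) = 0"
      "\<And>i. i < k \<Longrightarrow> dotp l (g i) (g i) \<le> y i" by metis
    have gw: "dotp l (g i) (\<lambda>j. lin (w i) j \<omega>) = 1 / sqrt (B i i)" if i: "i < k" for i
    proof -
      have "lin (b i) j \<omega> = 1 / sqrt (B i i) * (\<Sum>c<k. B c i * lin (w c) j \<omega>)" for j
        unfolding b_def[abs_def] z_def[abs_def] lin_scale lin_sum ..
      then have "1 = 1 / sqrt (B i i) * (\<Sum>c<k. B c i * dotp l (g i) (\<lambda>j. lin (w c) j \<omega>))"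
        using g(1)[OF i] by (simp add: dotp_scale_right dotp_lincomb_right del: times_divide_eq_left)
      also have "(\<Sum>c<k. B c i * dotp l (g i) (\<lambda>j. lin (w c) j \<omega>)) = (\<Sum>c<k. if i = c then B c i * dotp l (g i) (\<lambda>j. lin (w c) j \<omega>) else 0)"
        using g(2)[OF i] by (intro sum.cong) (auto simp: A_def)
      also have "\<dots> = B i i * dotp l (g i) (\<lambda>j. lin (w i) j \<omega>)" using i by simp
      also have "1 / sqrt (B i i) * (B i i * dotp l (g i) (\<lambda>j. lin (w i) j \<omega>))
          = B i i / sqrt (B i i) * dotp l (g i) (\<lambda>j. lin (w i) j \<omega>)" by simp
      also have "B i i / sqrt (B i i) = sqrt (B i i)" using Bpos[OF i] by (intro real_div_sqrt) simp
      finally have "sqrt (B i i) * dotp l (g i) (\<lambda>j. lin (w i) j \<omega>) = 1" ..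
      then show ?thesis using Bpos[OF i] by (simp add: eq_divide_eq mult.commute)
    qed
    \<comment> \<open>\<open>g i\<close> is dual to \<open>lin (b i)\<close>, which contains
      \<open>lin (w i)\<close> with coefficient \<open>sqrt (B i i)\<close>. Scaling by that
      coefficient makes the column dual to \<open>lin (w i)\<close> and introduces the factor
      \<open>B i i\<close> into its squared norm.\<close>
    define G where "G j i = sqrt (B i i) * g i j" for j i
    have "(\<Sum>j<l. lin (w a) j \<omega> * G j i) = of_bool (a = i)" if "a < k" "i < k" for a i
    proof -
      have "(\<Sum>j<l. lin (w a) j \<omega> * G j i) = sqrt (B i i) * dotp l (g i) (\<lambda>j. lin (w a) j \<omega>)"
        by (simp add: G_def dotp_def sum_distrib_left mult_ac)
      also have "\<dots> = of_bool (a = i)"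
        using gw[of i] g(2)[of i a] that Bpos[of i] by (cases "a = i") (auto simp: A_def)
      finally show ?thesis .
    qed
    moreover have "(\<Sum>j<l. \<Sum>i<k. (G j i)\<^sup>2) \<le> \<tau> * \<theta>"
    proof -
      have "(\<Sum>j<l. \<Sum>i<k. (G j i)\<^sup>2) = (\<Sum>i<k. \<Sum>j<l. (G j i)\<^sup>2)" by (rule sum.swap)
      also have "\<dots> = (\<Sum>i<k. B i i * dotp l (g i) (g i))"
      proof (intro sum.cong refl)
        fix i assume "i \<in> {..<k}"
        then have "(G j i)\<^sup>2 = B i i * (g i j * g i j)" for j
          using Bpos[of i] by (simp add: G_def power_mult_distrib power2_eq_square[of "g i j"] less_imp_le)
        then show "(\<Sum>j<l. (G j i)\<^sup>2) = B i i * dotp l (g i) (g i)"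
          by (simp add: dotp_def sum_distrib_left)
      qed
      also have "\<dots> \<le> (\<Sum>i<k. B i i * y i)"
        using Bpos g(3) by (intro sum_mono mult_left_mono) (auto simp: less_imp_le)
      finally show ?thesis using Sy by simp
    qed
    ultimately show ?thesis by blast
  qed
  then show "\<exists>F\<in>sets M. prob F \<le> 1 / t ^ p \<and>
      (\<forall>\<omega>\<in>space M - F. \<exists>G. (\<forall>a<k. \<forall>b<k. (\<Sum>j<l. lin (w a) j \<omega> * G j b) = of_bool (a = b)) \<and>
         (\<Sum>j<l. \<Sum>b<k. (G j b)\<^sup>2) \<le> 3 * t\<^sup>2 / (real p + 1) * (\<Sum>a<k. B a a))"
    using Fs PF unfolding \<tau>_def \<theta>_def by (intro bexI[of _ F]) auto
qed

end

section \<open>The deterministic error bound\<close>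

lemma index_mult_mat_sum:
  assumes "A \<in> carrier_mat a b" and "B \<in> carrier_mat b c" and "i < a" and "j < c"
  shows "(A * B) $$ (i, j) = (\<Sum>t<b. A $$ (i, t) * B $$ (t, j) :: real)"
  using assms by (auto simp: scalar_prod_def atLeast0LessThan intro!: sum.cong)

lemma index_minus_mat_carrier:
  assumes "B \<in> carrier_mat a b" and "i < a" and "j < b"
  shows "(A - B) $$ (i, j) = (A $$ (i, j) - B $$ (i, j) :: real)"
  using assms by auto

lemma minus_diff_minus_mat:
  fixes A B C :: "real mat"
  assumes "A \<in> carrier_mat a b" "B \<in> carrier_mat a b" "C \<in> carrier_mat a b"
  shows "(A - C) - (B - C) = A - B"
  using assms by (intro eq_matI) auto

lemma frobenius_norm_sq:
  "(frobenius_norm B)\<^sup>2 = (\<Sum>i<dim_row B. \<Sum>j<dim_col B. (B $$ (i, j))\<^sup>2)"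
  unfolding frobenius_norm_def by (rule real_sqrt_pow2) (intro sum_nonneg, simp)

lemma frobenius_norm_nonneg: "0 \<le> frobenius_norm B"
  unfolding frobenius_norm_def by (intro real_sqrt_ge_zero sum_nonneg) simp

lemma frobenius_norm_sq_trace: "(frobenius_norm B)\<^sup>2 = trace_mat (transpose_mat B * B)"
proof -
  have "trace_mat (transpose_mat B * B) = (\<Sum>j<dim_col B. \<Sum>i<dim_row B. (B $$ (i, j))\<^sup>2)"
    unfolding trace_mat_def
    by (auto simp: scalar_prod_def power2_eq_square atLeast0LessThan intro!: sum.cong)
  also have "\<dots> = (frobenius_norm B)\<^sup>2" unfolding frobenius_norm_sq by (rule sum.swap)
  finally show ?thesis ..
qed

lemma frobenius_norm_transpose: "frobenius_norm (transpose_mat B) = frobenius_norm B"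
proof -
  have "(\<Sum>i<dim_col B. \<Sum>j<dim_row B. (transpose_mat B $$ (i, j))\<^sup>2) = (\<Sum>i<dim_col B. \<Sum>j<dim_row B. (B $$ (j, i))\<^sup>2)"
    by (intro sum.cong refl) auto
  also have "\<dots> = (\<Sum>j<dim_row B. \<Sum>i<dim_col B. (B $$ (j, i))\<^sup>2)" by (rule sum.swap)
  finally show ?thesis by (simp add: frobenius_norm_def)
qed

text \<open>The squared norm is the trace of the Gram matrix, in which the product of
  \<open>transpose_mat U\<close> and \<open>U\<close> cancels.\<close>

lemma frobenius_norm_orthonormal_mult:
  assumes U: "U \<in> carrier_mat m r" "orthonormal_cols U" and E: "E \<in> carrier_mat r c"
  shows "frobenius_norm (U * E) = frobenius_norm E"
proof -
  have Ut: "transpose_mat U \<in> carrier_mat r m" and Et: "transpose_mat E \<in> carrier_mat c r" using U E by auto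
  have "transpose_mat (U * E) * (U * E) = transpose_mat E * transpose_mat U * (U * E)"
    by (simp only: transpose_mult[OF U(1) E])
  also have "\<dots> = transpose_mat E * (transpose_mat U * (U * E))"
    by (rule assoc_mult_mat[OF Et Ut mult_carrier_mat[OF U(1) E]])
  also have "transpose_mat U * (U * E) = transpose_mat U * U * E"
    by (rule assoc_mult_mat[OF Ut U(1) E, symmetric])
  also have "\<dots> = E" using U E by (simp add: orthonormal_cols_def)
  finally have "(frobenius_norm (U * E))\<^sup>2 = (frobenius_norm E)\<^sup>2" by (simp only: frobenius_norm_sq_trace)
  then show ?thesis by (simp add: frobenius_norm_nonneg)
qed

text \<open>Pythagoras: the residual is annihilated by \<open>transpose_mat Q\<close>, so its
  entrywise inner product with the projected part is zero.\<close>

lemma frobenius_norm_residual_le: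
  assumes Q: "Q \<in> carrier_mat m r" "orthonormal_cols Q" and B: "B \<in> carrier_mat m c"
  shows "frobenius_norm (B - Q * transpose_mat Q * B) \<le> frobenius_norm B"
proof -
  define C where "C = transpose_mat Q * B"
  define R where "R = B - Q * C"
  have Qt: "transpose_mat Q \<in> carrier_mat r m" using Q by auto
  have C: "C \<in> carrier_mat r c" unfolding C_def using Qt B by auto
  have QC: "Q * C \<in> carrier_mat m c" using Q C by auto
  have R: "R \<in> carrier_mat m c" unfolding R_def by (rule minus_carrier_mat[OF QC])
  have PB: "Q * transpose_mat Q * B = Q * C"
    unfolding C_def by (rule assoc_mult_mat[OF Q(1) Qt B])
  have "transpose_mat Q * R = transpose_mat Q * B - transpose_mat Q * (Q * C)"
    unfolding R_def by (rule mult_minus_distrib_mat[OF Qt B QC])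
  also have "transpose_mat Q * (Q * C) = transpose_mat Q * Q * C"
    by (rule assoc_mult_mat[OF Qt Q(1) C, symmetric])
  also have "\<dots> = C" using Q C by (simp add: orthonormal_cols_def)
  finally have QR: "transpose_mat Q * R = 0\<^sub>m r c" using C by (simp add: C_def[symmetric])
  have orth: "(\<Sum>i<m. Q $$ (i, a) * R $$ (i, j)) = 0" if "a < r" "j < c" for a j
  proof -
    have "(transpose_mat Q * R) $$ (a, j) = (\<Sum>i<m. Q $$ (i, a) * R $$ (i, j))"
      unfolding index_mult_mat_sum[OF Qt R that] using that Q by (intro sum.cong) auto
    then show ?thesis using that by (simp add: QR)
  qed
  have Bij: "B $$ (i, j) = R $$ (i, j) + (Q * C) $$ (i, j)" if "i < m" "j < c" for i j
    using index_minus_mat_carrier[OF QC that, of B] by (simp only: R_def)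
  have "(\<Sum>i<m. \<Sum>j<c. R $$ (i, j) * (Q * C) $$ (i, j))
      = (\<Sum>i<m. \<Sum>j<c. \<Sum>a<r. C $$ (a, j) * (Q $$ (i, a) * R $$ (i, j)))"
    by (intro sum.cong refl) (simp only: index_mult_mat_sum[OF Q(1) C] lessThan_iff sum_distrib_left mult_ac)
  also have "\<dots> = (\<Sum>j<c. \<Sum>i<m. \<Sum>a<r. C $$ (a, j) * (Q $$ (i, a) * R $$ (i, j)))" by (rule sum.swap)
  also have "\<dots> = (\<Sum>j<c. \<Sum>a<r. \<Sum>i<m. C $$ (a, j) * (Q $$ (i, a) * R $$ (i, j)))"
    by (intro sum.cong refl sum.swap)
  also have "\<dots> = (\<Sum>j<c. \<Sum>a<r. C $$ (a, j) * (\<Sum>i<m. Q $$ (i, a) * R $$ (i, j)))"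
    by (simp only: sum_distrib_left)
  also have "\<dots> = 0" by (simp add: orth)
  finally have cross: "(\<Sum>i<m. \<Sum>j<c. R $$ (i, j) * (Q * C) $$ (i, j)) = 0" .
  have "(frobenius_norm B)\<^sup>2 = (\<Sum>i<m. \<Sum>j<c. (R $$ (i, j) + (Q * C) $$ (i, j))\<^sup>2)"
    unfolding frobenius_norm_sq carrier_matD[OF B] by (intro sum.cong refl) (simp only: Bij lessThan_iff)
  also have "\<dots> = (\<Sum>i<m. \<Sum>j<c. (R $$ (i, j))\<^sup>2) + 2 * (\<Sum>i<m. \<Sum>j<c. R $$ (i, j) * (Q * C) $$ (i, j)) + (\<Sum>i<m. \<Sum>j<c. ((Q * C) $$ (i, j))\<^sup>2)"
    unfolding power2_sum by (simp only: sum.distrib sum_distrib_left mult.assoc add_ac)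
  also have "(\<Sum>i<m. \<Sum>j<c. (R $$ (i, j))\<^sup>2) = (frobenius_norm R)\<^sup>2"
    unfolding frobenius_norm_sq carrier_matD[OF R] ..
  finally have "(frobenius_norm B)\<^sup>2 = (frobenius_norm R)\<^sup>2 + (\<Sum>i<m. \<Sum>j<c. ((Q * C) $$ (i, j))\<^sup>2)"
    unfolding cross by simp
  moreover have "0 \<le> (\<Sum>i<m. \<Sum>j<c. ((Q * C) $$ (i, j))\<^sup>2)" by (intro sum_nonneg) simp
  ultimately have "(frobenius_norm R)\<^sup>2 \<le> (frobenius_norm B)\<^sup>2" by linarith
  then show ?thesis unfolding PB R_def by (rule power2_le_imp_le) (rule frobenius_norm_nonneg)
qed

text \<open>In the coordinates of the singular value decomposition the comparison matrix becomes
  \<open>X\<close>. Its first \<open>k\<close> rows vanish and the remaining ones form the block row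
  (- \<open>\<Sigma>\<^sub>2\<close> \<open>\<Omega>\<^sub>2\<close> \<open>G\<close>,
  \<open>\<Sigma>\<^sub>2\<close>), so the squared norms of the two blocks add. Cauchy-Schwarz then
  separates \<open>G\<close> from the other factor.\<close>

lemma sketch_error_bound:
  fixes G :: "nat \<Rightarrow> nat \<Rightarrow> real"
  assumes k: "k < n" and svd: "is_svd m n A U \<sigma> V"
    and Om: "Om \<in> carrier_mat n l"
    and qr: "economized_qr (A * Om) Q R"
    and G: "\<And>a b. a < k \<Longrightarrow> b < k \<Longrightarrow> (\<Sum>j<l. (\<Sum>i<n. V $$ (i, a) * Om $$ (i, j)) * G j b) = of_bool (a = b)"
  shows "frobenius_norm (A - Q * transpose_mat Q * A)
    \<le> sqrt (\<Sum>i=k..<n. (\<sigma> (i + 1))\<^sup>2)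
      + sqrt (\<Sum>j<l. \<Sum>i=k..<n. (\<Sum>i'<n. \<sigma> (i + 1) * V $$ (i', i) * Om $$ (i', j))\<^sup>2)
        * sqrt (\<Sum>j<l. \<Sum>b<k. (G j b)\<^sup>2)"
proof -
  define D where "D = mat_diag n (\<lambda>i. \<sigma> (i + 1))"
  \<comment> \<open>\<open>G\<close> is padded with n - k zero columns, so that multiplying by the
    full \<open>transpose_mat V\<close> has the effect of multiplying \<open>G\<close> by the
    transpose of \<open>V\<^sub>1\<close>.\<close>
  define W where "W = Matrix.mat l n (\<lambda>(j, a). if a < k then G j a else 0)"
  have U: "U \<in> carrier_mat m n" "orthonormal_cols U" and V: "V \<in> carrier_mat n n" "orthonormal_cols V"
    and A_eq: "A = U * D * transpose_mat V"
    using svd by (auto simp: is_svd_def D_def)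
  have D: "D \<in> carrier_mat n n" by (simp add: D_def)
  have W: "W \<in> carrier_mat l n" by (simp add: W_def)
  have Vt: "transpose_mat V \<in> carrier_mat n n" using V by auto
  have A: "A \<in> carrier_mat m n" unfolding A_eq using U D Vt by auto
  have AO: "A * Om \<in> carrier_mat m l" using A Om by auto
  define r where "r = min m l"
  have Q: "Q \<in> carrier_mat m r" "orthonormal_cols Q" and R: "R \<in> carrier_mat r l" and QR: "Q * R = A * Om"
    using qr by (auto simp: economized_qr_def r_def carrier_matD[OF A] carrier_matD[OF Om])
  have Qt: "transpose_mat Q \<in> carrier_mat r m" using Q by auto
  have P: "Q * transpose_mat Q \<in> carrier_mat m m" using Q Qt by auto
  define Z where "Z = W * transpose_mat V"
  have Z: "Z \<in> carrier_mat l n" unfolding Z_def using W Vt by auto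
  have AOZ: "A * Om * Z \<in> carrier_mat m n" using AO Z by auto
  define B where "B = A - A * Om * Z"
  have B: "B \<in> carrier_mat m n" unfolding B_def by (rule minus_carrier_mat[OF AOZ])
  have PAO: "Q * transpose_mat Q * (A * Om) = A * Om"
  proof -
    have "Q * transpose_mat Q * (Q * R) = Q * (transpose_mat Q * (Q * R))"
      by (rule assoc_mult_mat[OF Q(1) Qt mult_carrier_mat[OF Q(1) R]])
    also have "transpose_mat Q * (Q * R) = transpose_mat Q * Q * R"
      by (rule assoc_mult_mat[OF Qt Q(1) R, symmetric])
    also have "\<dots> = R" using Q R by (simp add: orthonormal_cols_def)
    finally show ?thesis by (simp only: QR)
  qed
  have PB: "Q * transpose_mat Q * B = Q * transpose_mat Q * A - A * Om * Z"
  proof -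
    have "Q * transpose_mat Q * B = Q * transpose_mat Q * A - Q * transpose_mat Q * (A * Om * Z)"
      unfolding B_def by (rule mult_minus_distrib_mat[OF P A AOZ])
    also have "Q * transpose_mat Q * (A * Om * Z) = Q * transpose_mat Q * (A * Om) * Z"
      by (rule assoc_mult_mat[OF P AO Z, symmetric])
    finally show ?thesis by (simp only: PAO)
  qed
  have PA: "Q * transpose_mat Q * A \<in> carrier_mat m n" using P A by auto
  \<comment> \<open>The subtracted matrix factors through \<open>A * Om\<close>, which the
    projection fixes, so \<open>A\<close> and \<open>B\<close> have the same residual.\<close>
  have "A - Q * transpose_mat Q * A = B - Q * transpose_mat Q * B"
    unfolding PB unfolding B_def by (rule minus_diff_minus_mat[OF A PA AOZ, symmetric])
  then have 1: "frobenius_norm (A - Q * transpose_mat Q * A) \<le> frobenius_norm B"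
    using frobenius_norm_residual_le[OF Q B] by simp
  define N where "N = transpose_mat V * Om"
  have N: "N \<in> carrier_mat n l" unfolding N_def using Vt Om by auto
  have DN: "D * N \<in> carrier_mat n l" using D N by auto
  define X where "X = D - D * N * W"
  have DNW: "D * N * W \<in> carrier_mat n n" using DN W by auto
  have X: "X \<in> carrier_mat n n" unfolding X_def by (rule minus_carrier_mat[OF DNW])
  have "B = U * (X * transpose_mat V)"
  proof -
    have DV: "D * transpose_mat V \<in> carrier_mat n n" using D Vt by auto
    have UD: "U * D \<in> carrier_mat m n" using U D by auto
    have "X * transpose_mat V = D * transpose_mat V - D * N * W * transpose_mat V"
      unfolding X_def by (rule minus_mult_distrib_mat[OF D DNW Vt])
    also have "D * N * W * transpose_mat V = D * N * Z"
      unfolding Z_def by (rule assoc_mult_mat[OF DN W Vt])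
    finally have "U * (X * transpose_mat V) = U * (D * transpose_mat V) - U * (D * N * Z)"
      by (simp only: mult_minus_distrib_mat[OF U(1) DV mult_carrier_mat[OF DN Z]])
    also have "U * (D * transpose_mat V) = A"
      unfolding A_eq by (rule assoc_mult_mat[OF U(1) D Vt, symmetric])
    also have "U * (D * N * Z) = U * (D * N) * Z" by (rule assoc_mult_mat[OF U(1) DN Z, symmetric])
    also have "U * (D * N) = U * D * N" by (rule assoc_mult_mat[OF U(1) D N, symmetric])
    also have "U * D * N = A * Om" unfolding N_def A_eq by (rule assoc_mult_mat[OF UD Vt Om, symmetric])
    finally show ?thesis by (simp only: B_def)
  qed
  then have "frobenius_norm B = frobenius_norm (X * transpose_mat V)"
    using frobenius_norm_orthonormal_mult[OF U, of "X * transpose_mat V" n] X Vt by simp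
  also have "\<dots> = frobenius_norm (transpose_mat (X * transpose_mat V))" by (simp only: frobenius_norm_transpose)
  also have "transpose_mat (X * transpose_mat V) = V * transpose_mat X"
    using transpose_mult[OF X Vt] by simp
  also have "frobenius_norm (V * transpose_mat X) = frobenius_norm (transpose_mat X)"
    using frobenius_norm_orthonormal_mult[OF V, of "transpose_mat X" n] X by simp
  also have "\<dots> = frobenius_norm X" by (rule frobenius_norm_transpose)
  finally have 2: "frobenius_norm B = frobenius_norm X" .
  define Y where "Y i j = (\<Sum>i'<n. \<sigma> (i + 1) * V $$ (i', i) * Om $$ (i', j))" for i j
  have DNij: "(D * N) $$ (i, j) = Y i j" if "i < n" "j < l" for i j
  proof -
    have "(D * N) $$ (i, j) = \<sigma> (i + 1) * N $$ (i, j)"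
      unfolding D_def mat_diag_mult_left[OF N] using that by simp
    also have "N $$ (i, j) = (\<Sum>i'<n. V $$ (i', i) * Om $$ (i', j))"
      unfolding N_def index_mult_mat_sum[OF Vt Om that] using that V by (intro sum.cong) auto
    finally show ?thesis by (simp add: Y_def sum_distrib_left mult.assoc)
  qed
  have DNWij: "(D * N * W) $$ (i, a) = (if a < k then \<Sum>j<l. Y i j * G j a else 0)" if "i < n" "a < n" for i a
  proof -
    have "(D * N * W) $$ (i, a) = (\<Sum>j<l. (D * N) $$ (i, j) * W $$ (j, a))"
      by (rule index_mult_mat_sum[OF DN W that])
    also have "\<dots> = (\<Sum>j<l. Y i j * (if a < k then G j a else 0))"
      using that by (intro sum.cong refl) (auto simp: DNij W_def)
    finally show ?thesis by simp
  qed
  have Xij: "X $$ (i, a) = of_bool (i = a) * \<sigma> (i + 1) - (if a < k then \<Sum>j<l. Y i j * G j a else 0)" if "i < n" "a < n" for i a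
  proof -
    have "D $$ (i, a) = of_bool (i = a) * \<sigma> (i + 1)" using that by (auto simp: D_def mat_diag_def)
    then show ?thesis unfolding X_def index_minus_mat_carrier[OF DNW that] DNWij[OF that] by simp
  qed
  \<comment> \<open>For \<open>a < k\<close> the duality of \<open>G\<close> reproduces the diagonal
    entry and cancels it; for \<open>a \<ge> k\<close> the padding is zero and the entry is off the
    diagonal.\<close>
  have X0: "X $$ (i, a) = 0" if "i < k" "a < n" for i a
  proof (cases "a < k")
    case True
    have "(\<Sum>j<l. Y i j * G j a) = \<sigma> (i + 1) * (\<Sum>j<l. (\<Sum>i'<n. V $$ (i', i) * Om $$ (i', j)) * G j a)"
      by (simp add: Y_def sum_distrib_left sum_distrib_right mult_ac)
    also have "\<dots> = \<sigma> (i + 1) * of_bool (i = a)" by (simp only: G[OF that(1) True])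
    finally show ?thesis using Xij[of i a] that True k by simp
  next
    case False
    then show ?thesis using Xij[of i a] that k by auto
  qed
  have row: "(\<Sum>a<n. (X $$ (i, a))\<^sup>2) = (\<sigma> (i + 1))\<^sup>2 + (\<Sum>a<k. (\<Sum>j<l. Y i j * G j a)\<^sup>2)" if "k \<le> i" "i < n" for i
  proof -
    have "(\<Sum>a<n. (X $$ (i, a))\<^sup>2) = (\<Sum>a<k. (X $$ (i, a))\<^sup>2) + (\<Sum>a=k..<n. (X $$ (i, a))\<^sup>2)"
      using k sum.atLeastLessThan_concat[of 0 k n "\<lambda>a. (X $$ (i, a))\<^sup>2"] by (simp add: atLeast0LessThan)
    also have "(\<Sum>a<k. (X $$ (i, a))\<^sup>2) = (\<Sum>a<k. (\<Sum>j<l. Y i j * G j a)\<^sup>2)"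
      using that k by (intro sum.cong refl) (auto simp: Xij)
    also have "(\<Sum>a=k..<n. (X $$ (i, a))\<^sup>2) = (\<Sum>a=k..<n. if i = a then (\<sigma> (i + 1))\<^sup>2 else 0)"
      using that k by (intro sum.cong refl) (auto simp: Xij)
    also have "\<dots> = (\<sigma> (i + 1))\<^sup>2" using that by simp
    finally show ?thesis by simp
  qed
  define PY where "PY i = (\<Sum>j<l. (Y i j)\<^sup>2)" for i
  define PG where "PG a = (\<Sum>j<l. (G j a)\<^sup>2)" for a
  have "(frobenius_norm X)\<^sup>2 = (\<Sum>i<n. \<Sum>a<n. (X $$ (i, a))\<^sup>2)"
    unfolding frobenius_norm_sq carrier_matD[OF X] ..
  also have "\<dots> = (\<Sum>i<k. \<Sum>a<n. (X $$ (i, a))\<^sup>2) + (\<Sum>i=k..<n. \<Sum>a<n. (X $$ (i, a))\<^sup>2)"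
    using k sum.atLeastLessThan_concat[of 0 k n "\<lambda>i. \<Sum>a<n. (X $$ (i, a))\<^sup>2"] by (simp add: atLeast0LessThan)
  also have "\<dots> = (\<Sum>i=k..<n. (\<sigma> (i + 1))\<^sup>2 + (\<Sum>a<k. (\<Sum>j<l. Y i j * G j a)\<^sup>2))"
    by (simp add: X0 row)
  also have "\<dots> \<le> (\<Sum>i=k..<n. (\<sigma> (i + 1))\<^sup>2 + (\<Sum>a<k. PY i * PG a))"
    unfolding PY_def PG_def by (intro sum_mono add_left_mono Cauchy_Schwarz_ineq_sum)
  also have "\<dots> = (\<Sum>i=k..<n. (\<sigma> (i + 1))\<^sup>2) + (\<Sum>i=k..<n. PY i) * (\<Sum>a<k. PG a)"
    by (simp only: sum.distrib sum_product)
  finally have le: "(frobenius_norm X)\<^sup>2 \<le> (\<Sum>i=k..<n. (\<sigma> (i + 1))\<^sup>2) + (\<Sum>i=k..<n. PY i) * (\<Sum>a<k. PG a)" .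
  have "(\<Sum>i=k..<n. PY i) = (\<Sum>j<l. \<Sum>i=k..<n. (Y i j)\<^sup>2)" unfolding PY_def by (rule sum.swap)
  moreover have "(\<Sum>a<k. PG a) = (\<Sum>j<l. \<Sum>a<k. (G j a)\<^sup>2)" unfolding PG_def by (rule sum.swap)
  ultimately have 3: "(frobenius_norm X)\<^sup>2 \<le> (\<Sum>i=k..<n. (\<sigma> (i + 1))\<^sup>2) + (\<Sum>j<l. \<Sum>i=k..<n. (Y i j)\<^sup>2) * (\<Sum>j<l. \<Sum>a<k. (G j a)\<^sup>2)"
    using le by simp
  have "frobenius_norm X = sqrt ((frobenius_norm X)\<^sup>2)" by (simp add: frobenius_norm_nonneg)
  also have "\<dots> \<le> sqrt ((\<Sum>i=k..<n. (\<sigma> (i + 1))\<^sup>2) + (\<Sum>j<l. \<Sum>i=k..<n. (Y i j)\<^sup>2) * (\<Sum>j<l. \<Sum>a<k. (G j a)\<^sup>2))"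
    using 3 by (rule real_sqrt_le_mono)
  also have "\<dots> \<le> sqrt (\<Sum>i=k..<n. (\<sigma> (i + 1))\<^sup>2) + sqrt ((\<Sum>j<l. \<Sum>i=k..<n. (Y i j)\<^sup>2) * (\<Sum>j<l. \<Sum>a<k. (G j a)\<^sup>2))"
    by (intro sqrt_add_le_add_sqrt mult_nonneg_nonneg sum_nonneg) auto
  finally show ?thesis using 1 2 by (simp add: real_sqrt_mult Y_def)
qed

section \<open>The probabilistic error bound\<close>

text \<open>Guarantees that the term \<open>the (mat_inverse _)\<close> in \<open>gamma_k\<close>
  denotes a genuine inverse. The link between the two notions of invertibility is the unit group of
  the matrix ring.\<close>

lemma mat_inverse_invertible:
  fixes S :: "real mat"
  assumes S: "S \<in> carrier_mat k k" and inv: "invertible_mat S"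
  shows "the (mat_inverse S) \<in> carrier_mat k k" and "S * the (mat_inverse S) = 1\<^sub>m k"
proof -
  obtain B where B: "S * B = 1\<^sub>m (dim_row S)" "B * S = 1\<^sub>m (dim_row B)"
    using inv by (auto simp: invertible_mat_def inverts_mat_def)
  have "dim_col B = k" using arg_cong[OF B(1), of dim_col] S by simp
  moreover have "dim_row B = k" using arg_cong[OF B(2), of dim_col] S by simp
  ultimately have Bc: "B \<in> carrier_mat k k" by auto
  have "S \<in> Units (ring_mat TYPE(real) k ())"
    using S Bc B by (auto simp: Units_def ring_mat_def intro!: bexI[of _ B])
  then obtain C where "mat_inverse S = Some C"
    using mat_inverse(1)[OF S, of "()"] by (cases "mat_inverse S") auto
  then show "the (mat_inverse S) \<in> carrier_mat k k" "S * the (mat_inverse S) = 1\<^sub>m k"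
    using mat_inverse(2)[OF S] by auto
qed

lemma triple_product_index:
  fixes L K R :: "real mat"
  assumes L: "L \<in> carrier_mat a n" and K: "K \<in> carrier_mat n n" and R: "R \<in> carrier_mat n b"
    and ij: "i < a" "j < b"
  shows "(L * K * R) $$ (i, j) = bil n K (\<lambda>i'. L $$ (i, i')) (\<lambda>j'. R $$ (j', j))"
proof -
  have LK: "L * K \<in> carrier_mat a n" using L K by auto
  have "(L * K * R) $$ (i, j) = (\<Sum>j'<n. (L * K) $$ (i, j') * R $$ (j', j))"
    by (rule index_mult_mat_sum[OF LK R ij])
  also have "\<dots> = (\<Sum>j'<n. \<Sum>i'<n. L $$ (i, i') * R $$ (j', j) * K $$ (i', j'))"
    by (intro sum.cong refl)
      (simp only: index_mult_mat_sum[OF L K ij(1)] lessThan_iff sum_distrib_right sum_distrib_left mult_ac)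
  also have "\<dots> = bil n K (\<lambda>i'. L $$ (i, i')) (\<lambda>j'. R $$ (j', j))"
    unfolding bil_def by (rule sum.swap)
  finally show ?thesis .
qed

lemma bil_cong:
  assumes "\<And>i. i < n \<Longrightarrow> v i = v' i" and "\<And>i. i < n \<Longrightarrow> w i = w' i"
  shows "bil n K v w = bil n K v' w'"
  unfolding bil_def using assms by (intro sum.cong refl) auto

lemma gram_V1_index:
  assumes V: "V \<in> carrier_mat n n" and K: "K \<in> carrier_mat n n" and k: "k \<le> n" and ab: "a < k" "b < k"
  shows "(transpose_mat (V1_mat n k V) * K * V1_mat n k V) $$ (a, b) = bil n K (\<lambda>i. V $$ (i, a)) (\<lambda>i. V $$ (i, b))"
proof -
  have V1: "V1_mat n k V \<in> carrier_mat n k" by (simp add: V1_mat_def)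
  then have "(transpose_mat (V1_mat n k V) * K * V1_mat n k V) $$ (a, b)
      = bil n K (\<lambda>i. transpose_mat (V1_mat n k V) $$ (a, i)) (\<lambda>i. V1_mat n k V $$ (i, b))"
    using K ab by (intro triple_product_index[of _ k _ _ _ k]) auto
  also have "\<dots> = bil n K (\<lambda>i. V $$ (i, a)) (\<lambda>i. V $$ (i, b))"
    using ab by (intro bil_cong) (auto simp: V1_mat_def)
  finally show ?thesis .
qed

lemma sum_shift_index:
  fixes f :: "nat \<Rightarrow> real"
  shows "(\<Sum>i<n - k. f (k + i)) = (\<Sum>i=k..<n. f i)"
  by (simp add: sum.atLeastLessThan_shift_0[of f k n] atLeast0LessThan)

lemma frobenius_norm_Sigma2: "(frobenius_norm (Sigma2_mat n k \<sigma>))\<^sup>2 = (\<Sum>i=k..<n. (\<sigma> (i + 1))\<^sup>2)"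
proof -
  have "(frobenius_norm (Sigma2_mat n k \<sigma>))\<^sup>2 = (\<Sum>i<n - k. \<Sum>j<n - k. if i = j then (\<sigma> (k + i + 1))\<^sup>2 else 0)"
    unfolding frobenius_norm_sq Sigma2_mat_def mat_diag_def by (intro sum.cong) auto
  also have "\<dots> = (\<Sum>i<n - k. (\<sigma> (k + i + 1))\<^sup>2)" by simp
  also have "\<dots> = (\<Sum>i=k..<n. (\<sigma> (i + 1))\<^sup>2)"
    using sum_shift_index[where f="\<lambda>i. (\<sigma> (i + 1))\<^sup>2" and k=k and n=n] by simp
  finally show ?thesis .
qed

text \<open>One of the two factors \<open>\<sigma>\<close> goes into each argument of
  \<open>bil\<close>, so the numerator of \<open>beta_k\<close> becomes the sum of the variances of
  the entries in a column of \<open>\<Sigma>\<^sub>2\<close> \<open>\<Omega>\<^sub>2\<close>, as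
  \<open>sum_squares_tail\<close> expects.\<close>

lemma trace_Sigma2:
  assumes V: "V \<in> carrier_mat n n" and K: "K \<in> carrier_mat n n" and k: "k \<le> n"
  shows "trace_mat (Sigma2_mat n k \<sigma> * Sigma2_mat n k \<sigma> * transpose_mat (V2_mat n k V) * K * V2_mat n k V)
    = (\<Sum>i=k..<n. bil n K (\<lambda>i'. \<sigma> (i + 1) * V $$ (i', i)) (\<lambda>i'. \<sigma> (i + 1) * V $$ (i', i)))"
proof -
  define L where "L = Sigma2_mat n k \<sigma> * Sigma2_mat n k \<sigma> * transpose_mat (V2_mat n k V)"
  have V2: "V2_mat n k V \<in> carrier_mat n (n - k)" by (simp add: V2_mat_def)
  then have V2t: "transpose_mat (V2_mat n k V) \<in> carrier_mat (n - k) n" by auto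
  have L_eq: "L = Matrix.mat (n - k) n (\<lambda>(i, j). \<sigma> (k + i + 1) * \<sigma> (k + i + 1) * transpose_mat (V2_mat n k V) $$ (i, j))"
    unfolding L_def Sigma2_mat_def mat_diag_diag by (rule mat_diag_mult_left[OF V2t])
  have L: "L \<in> carrier_mat (n - k) n" by (simp add: L_eq)
  have Lij: "L $$ (i, j) = \<sigma> (k + i + 1) * (\<sigma> (k + i + 1) * V $$ (j, k + i))" if "i < n - k" "j < n" for i j
    using that by (simp add: L_eq V2_mat_def)
  have e: "(L * K * V2_mat n k V) $$ (i, i)
      = bil n K (\<lambda>i'. \<sigma> (k + i + 1) * V $$ (i', k + i)) (\<lambda>i'. \<sigma> (k + i + 1) * V $$ (i', k + i))" if i: "i < n - k" for i
  proof -
    have "(L * K * V2_mat n k V) $$ (i, i) = bil n K (\<lambda>i'. L $$ (i, i')) (\<lambda>j'. V2_mat n k V $$ (j', i))"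
      by (rule triple_product_index[OF L K V2 i i])
    also have "\<dots> = bil n K (\<lambda>i'. \<sigma> (k + i + 1) * (\<sigma> (k + i + 1) * V $$ (i', k + i))) (\<lambda>i'. V $$ (i', k + i))"
      using i by (intro bil_cong) (simp add: Lij, simp add: V2_mat_def)
    finally show ?thesis by (simp only: bil_scale_left bil_scale_right)
  qed
  have "trace_mat (L * K * V2_mat n k V) = (\<Sum>i<n - k. (L * K * V2_mat n k V) $$ (i, i))"
    unfolding trace_mat_def using L by simp
  also have "\<dots> = (\<Sum>i<n - k. bil n K (\<lambda>i'. \<sigma> (k + i + 1) * V $$ (i', k + i)) (\<lambda>i'. \<sigma> (k + i + 1) * V $$ (i', k + i)))"
    by (intro sum.cong refl) (simp only: e lessThan_iff)
  also have "\<dots> = (\<Sum>i=k..<n. bil n K (\<lambda>i'. \<sigma> (i + 1) * V $$ (i', i)) (\<lambda>i'. \<sigma> (i + 1) * V $$ (i', i)))"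
    by (rule sum_shift_index)
  finally show ?thesis by (simp only: L_def)
qed

theorem theorem3p1:
  fixes m n k p :: nat
    and A U V K :: "real mat"
    and \<sigma> lam :: "nat \<Rightarrow> real"
    and M :: "'w measure"
    and \<Omega> Q R :: "'w \<Rightarrow> real mat"
  assumes "1 \<le> n" and "n \<le> m" and "1 \<le> k" and "4 \<le> p"
    and "A \<in> carrier_mat m n"
    and "is_svd m n A U \<sigma> V"
    and "sym_psd_mat n K"
    and "eigenvalues_decreasing n K lam"
    and "0 < lam k"
    and "invertible_mat (transpose_mat (V1_mat n k V) * K * V1_mat n k V)"
    and "Sigma2_mat n k \<sigma> \<noteq> 0\<^sub>m (n - k) (n - k)"
    and "prob_space M"
    and "gaussian_random_matrix M n (k + p) \<Omega> K"
    and "\<And>\<omega>. \<omega> \<in> space M \<Longrightarrow> economized_qr (A * \<Omega> \<omega>) (Q \<omega>) (R \<omega>)"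
  shows "\<forall>u\<ge>1. \<forall>t\<ge>1. \<exists>F\<in>sets M.
    {\<omega> \<in> space M.
       \<not> frobenius_norm (A - Q \<omega> * transpose_mat (Q \<omega>) * A)
           \<le> (1 + u * t * sqrt (real (k + p) * (3 * real k / (real p + 1))
                 * (beta_k n k \<sigma> V K (lam 1) / gamma_k n k V K (lam 1))))
             * sqrt (\<Sum>j=k+1..n. (\<sigma> j)\<^sup>2)} \<subseteq> F \<and>
    measure M F \<le> 1 / t ^ p + (u * exp (- (u\<^sup>2 - 1) / 2)) ^ (k + p)"
proof (intro allI impI)
  fix u t :: real
  assume u: "1 \<le> u" and t: "1 \<le> t"
  define l where "l = k + p"
  interpret prob_space M by fact
  interpret gaussian_columns M n l \<Omega> K
    by unfold_locales (use assms in \<open>auto simp: l_def\<close>)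
  \<comment> \<open>For \<open>k \<ge> n\<close> the matrix \<open>\<Sigma>\<^sub>2\<close> would be
    empty and thus equal to the empty zero matrix.\<close>
  have kn: "k < n"
  proof (rule ccontr)
    assume "\<not> k < n"
    then have "Sigma2_mat n k \<sigma> = 0\<^sub>m (n - k) (n - k)" by (intro eq_matI) (auto simp: Sigma2_mat_def mat_diag_def)
    with assms show False by simp
  qed
  have lam1: "0 < lam 1"
    using assms(3,8,9) kn unfolding eigenvalues_decreasing_def by (meson less_imp_le less_le_trans order_refl)
  have K: "K \<in> carrier_mat n n" using assms by (simp add: sym_psd_mat_def)
  have V: "V \<in> carrier_mat n n" using assms by (simp add: is_svd_def)
  define S where "S = transpose_mat (V1_mat n k V) * K * V1_mat n k V"
  have S: "S \<in> carrier_mat k k" using K by (auto simp: S_def V1_mat_def)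
  define C where "C = the (mat_inverse S)"
  have C: "C \<in> carrier_mat k k" "S * C = 1\<^sub>m k"
    unfolding C_def using mat_inverse_invertible[OF S] assms(10) by (auto simp: S_def)
  define w where "w a i = V $$ (i, a)" for a i
  define B where "B c b = C $$ (c, b)" for c b
  have inv: "(\<Sum>c<k. bil n K (w a) (w c) * B c b) = of_bool (a = b)" if "a < k" "b < k" for a b
  proof -
    have "(\<Sum>c<k. bil n K (w a) (w c) * B c b) = (\<Sum>c<k. S $$ (a, c) * C $$ (c, b))"
      unfolding w_def[abs_def] B_def S_def using gram_V1_index[OF V K] kn that by (intro sum.cong refl) simp
    also have "\<dots> = (S * C) $$ (a, b)" by (rule index_mult_mat_sum[OF S C(1) that, symmetric])
    finally show ?thesis using that by (simp add: C(2))
  qed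
  define \<theta> where "\<theta> = (\<Sum>a<k. B a a)"
  have th: "0 < \<theta>" unfolding \<theta>_def
    by (rule pseudo_inverse_tail(1)[where w=w and t=t and p=p]) (use assms t inv in \<open>auto simp: l_def\<close>)
  obtain F1 where F1: "F1 \<in> sets M" "prob F1 \<le> 1 / t ^ p"
    and G: "\<And>\<omega>. \<omega> \<in> space M - F1 \<Longrightarrow> \<exists>G. (\<forall>a<k. \<forall>b<k. (\<Sum>j<l. lin (w a) j \<omega> * G j b) = of_bool (a = b)) \<and>
         (\<Sum>j<l. \<Sum>b<k. (G j b)\<^sup>2) \<le> 3 * t\<^sup>2 / (real p + 1) * \<theta>"
    unfolding \<theta>_def using pseudo_inverse_tail(2)[OF assms(3) l_def assms(4) t inv] by blast
  \<comment> \<open>With this direction, \<open>lin (w2 i) j\<close> for \<open>i \<ge> k\<close> is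
    the entry of \<open>\<Sigma>\<^sub>2\<close> \<open>\<Omega>\<^sub>2\<close> in row
    \<open>i - k\<close> and column \<open>j\<close>.\<close>
  define w2 where "w2 i i' = \<sigma> (i + 1) * V $$ (i', i)" for i i'
  define T where "T = (\<Sum>i=k..<n. bil n K (w2 i) (w2 i))"
  define F2 where "F2 = {\<omega> \<in> space M. u\<^sup>2 * (real l * T) < (\<Sum>j<l. \<Sum>i=k..<n. (lin (w2 i) j \<omega>)\<^sup>2)}"
  have F2s: "F2 \<in> sets M" unfolding F2_def by measurable
  have F2p: "prob F2 \<le> (u * exp (- (u\<^sup>2 - 1) / 2)) ^ l"
    unfolding F2_def by (rule sum_squares_tail[OF _ u T_def]) simp
  have T0: "0 \<le> T" unfolding T_def by (intro sum_nonneg bil_self_nonneg)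
  define \<Phi> where "\<Phi> = (\<Sum>i=k..<n. (\<sigma> (i + 1))\<^sup>2)"
  have Phi: "(\<Sum>j=k+1..n. (\<sigma> j)\<^sup>2) = \<Phi>"
  proof -
    have "(\<Sum>j=k+1..n. (\<sigma> j)\<^sup>2) = (\<Sum>j=k+1..<n+1. (\<sigma> j)\<^sup>2)"
      by (intro sum.cong) auto
    then show ?thesis unfolding \<Phi>_def sum.shift_bounds_nat_ivl .
  qed
  have Phi0: "0 < \<Phi>"
  proof (rule ccontr)
    assume "\<not> 0 < \<Phi>"
    moreover have "0 \<le> \<Phi>" unfolding \<Phi>_def by (intro sum_nonneg) simp
    ultimately have "\<Phi> = 0" by simp
    then have "\<forall>i\<in>{k..<n}. (\<sigma> (i + 1))\<^sup>2 = 0"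
      unfolding \<Phi>_def by (subst (asm) sum_nonneg_eq_0_iff) auto
    then have "\<sigma> (k + i + 1) = 0" if "i < n - k" for i using that by auto
    then have "Sigma2_mat n k \<sigma> = 0\<^sub>m (n - k) (n - k)" by (intro eq_matI) (auto simp: Sigma2_mat_def mat_diag_def)
    with assms show False by simp
  qed
  have beta: "beta_k n k \<sigma> V K (lam 1) = T / (lam 1 * \<Phi>)"
    unfolding beta_k_def frobenius_norm_Sigma2 T_def w2_def[abs_def] \<Phi>_def
    using trace_Sigma2[OF V K, of k \<sigma>] kn by simp
  have gamma: "gamma_k n k V K (lam 1) = real k / (lam 1 * \<theta>)"
    unfolding gamma_k_def S_def[symmetric] C_def[symmetric] trace_mat_def \<theta>_def B_def using C(1) by simp
  \<comment> \<open>Both \<open>lam 1\<close> and \<open>k\<close> cancel between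
    \<open>beta_k\<close> and \<open>gamma_k\<close>, and what remains is the product of the two
    tail bounds relative to \<open>\<Phi>\<close>.\<close>
  have ratio: "real l * (3 * real k / (real p + 1)) * (beta_k n k \<sigma> V K (lam 1) / gamma_k n k V K (lam 1))
      = real l * 3 / (real p + 1) * T * \<theta> / \<Phi>"
    unfolding beta gamma using lam1 th Phi0 assms(3) by (simp add: field_simps)
  have rhs: "(1 + u * t * sqrt (real l * 3 / (real p + 1) * T * \<theta> / \<Phi>)) * sqrt \<Phi>
      = sqrt \<Phi> + u * t * sqrt (real l * 3 / (real p + 1) * T * \<theta>)"
  proof -
    have "sqrt (real l * 3 / (real p + 1) * T * \<theta> / \<Phi>) * sqrt \<Phi> = sqrt (real l * 3 / (real p + 1) * T * \<theta>)"
      unfolding real_sqrt_mult[symmetric] using Phi0 by simp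
    then show ?thesis by (simp only: distrib_right mult_1 mult.assoc)
  qed
  have good: "frobenius_norm (A - Q \<omega> * transpose_mat (Q \<omega>) * A)
      \<le> sqrt \<Phi> + u * t * sqrt (real l * 3 / (real p + 1) * T * \<theta>)" if \<omega>: "\<omega> \<in> space M" "\<omega> \<notin> F1" "\<omega> \<notin> F2" for \<omega>
  proof -
    obtain G where G1: "\<And>a b. a < k \<Longrightarrow> b < k \<Longrightarrow> (\<Sum>j<l. lin (w a) j \<omega> * G j b) = of_bool (a = b)"
      and G2: "(\<Sum>j<l. \<Sum>b<k. (G j b)\<^sup>2) \<le> 3 * t\<^sup>2 / (real p + 1) * \<theta>"
      using G[of \<omega>] \<omega> by blast
    have Om: "\<Omega> \<omega> \<in> carrier_mat n l" using assms(13) \<omega> by (auto simp: gaussian_random_matrix_def l_def)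
    let ?Y = "\<Sum>j<l. \<Sum>i=k..<n. (lin (w2 i) j \<omega>)\<^sup>2" and ?G = "\<Sum>j<l. \<Sum>b<k. (G j b)\<^sup>2"
    have "frobenius_norm (A - Q \<omega> * transpose_mat (Q \<omega>) * A) \<le> sqrt \<Phi> + sqrt ?Y * sqrt ?G"
      unfolding \<Phi>_def lin_def w2_def
      by (rule sketch_error_bound[OF kn assms(6) Om assms(14)[OF \<omega>(1)]]) (use G1 in \<open>simp add: lin_def w_def\<close>)
    also have "sqrt ?Y * sqrt ?G = sqrt (?Y * ?G)" by (simp only: real_sqrt_mult)
    also have "sqrt (?Y * ?G) \<le> sqrt ((u\<^sup>2 * (real l * T)) * (3 * t\<^sup>2 / (real p + 1) * \<theta>))"
      using \<omega> G2 T0 by (intro real_sqrt_le_mono mult_mono sum_nonneg mult_nonneg_nonneg) (auto simp: F2_def not_less)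
    also have "(u\<^sup>2 * (real l * T)) * (3 * t\<^sup>2 / (real p + 1) * \<theta>) = (u * t)\<^sup>2 * (real l * 3 / (real p + 1) * T * \<theta>)"
      by (simp add: power_mult_distrib)
    also have "sqrt \<dots> = u * t * sqrt (real l * 3 / (real p + 1) * T * \<theta>)"
      using u t by (simp only: real_sqrt_mult real_sqrt_abs) simp
    finally show ?thesis by simp
  qed
  show "\<exists>F\<in>sets M. {\<omega> \<in> space M.
       \<not> frobenius_norm (A - Q \<omega> * transpose_mat (Q \<omega>) * A)
           \<le> (1 + u * t * sqrt (real (k + p) * (3 * real k / (real p + 1))
                 * (beta_k n k \<sigma> V K (lam 1) / gamma_k n k V K (lam 1))))
             * sqrt (\<Sum>j=k+1..n. (\<sigma> j)\<^sup>2)} \<subseteq> F \<and>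
    measure M F \<le> 1 / t ^ p + (u * exp (- (u\<^sup>2 - 1) / 2)) ^ (k + p)"
  \<comment> \<open>The failure set itself may be non-measurable, as \<open>Q\<close> can be any
    choice of factor at each outcome. It is covered by the two measurable tail events, which depend
    on \<open>\<Omega>\<close> alone.\<close>
  proof (intro bexI[of _ "F1 \<union> F2"] conjI)
    show "F1 \<union> F2 \<in> sets M" using F1 F2s by simp
    have "prob (F1 \<union> F2) \<le> prob F1 + prob F2" by (rule measure_Un_le[OF F1(1) F2s])
    then show "prob (F1 \<union> F2) \<le> 1 / t ^ p + (u * exp (- (u\<^sup>2 - 1) / 2)) ^ (k + p)"
      using F1(2) F2p unfolding l_def by linarith
    show "{\<omega> \<in> space M.
       \<not> frobenius_norm (A - Q \<omega> * transpose_mat (Q \<omega>) * A)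
           \<le> (1 + u * t * sqrt (real (k + p) * (3 * real k / (real p + 1))
                 * (beta_k n k \<sigma> V K (lam 1) / gamma_k n k V K (lam 1))))
             * sqrt (\<Sum>j=k+1..n. (\<sigma> j)\<^sup>2)} \<subseteq> F1 \<union> F2"
      unfolding Phi l_def[symmetric] ratio rhs using good by blast
  qed
qed

end
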